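(* Let $d\in\{4,5,6\}$, let $\mathcal{W}(d)$ be a non-singular $d$-web of $(\mathbb{C}^2,0)$ presented by $F(x,y,p)=a_0p^d+a_1p^{d-1}+\cdots+a_d\in\mathcal{O}[p]$, let $(E,\nabla)$ be the connection associated with $F$ and let $K$ be its curvature. Then $$\mathrm{tr}(K)=\sum_{k=1}^{\binom d3} d\gamma_k ,$$ where $d\gamma_1,\dots,d\gamma_{\binom d3}$ are the Blaschke curvatures of the $\binom d3$ extracted $3$-webs of $\mathcal{W}(d)$ (the $3$-webs obtained by keeping three of the $d$ families of leaves).
   Context: Notation. $\mathcal{O}=\mathbb{C}\{x,y\}$ is the ring of convergent power series, i.e. germs of holomorphic functions at $0\in\mathbb{C}^2$; $\Omega^1=\mathcal{O}dx\oplus\mathcal{O}dy$; everything is local at $0$. $\pi_d=\frac12(d-1)(d-2)$. Webs. A non-singular $d$-web $\mathcal{W}(d)$ of $(\mathbb{C}^2,0)$ is given by the level curves $\{F_i=\mathrm{const}\}$ (leaves) of $d$ germs $F_i\in\mathcal{O}$ with $F_i(0)=0$ and $dF_i(0)\wedge dF_j(0)\ne0$ for $i<j$. It is presented by $F(x,y,p)=a_0p^d+\cdots+a_d\in\mathcal{O}[p]$, where $a_0(0)\neq0$ and the $p$-discriminant of $F$ is non-zero at $0$, if the leaves are the integral curves of $F(x,y,y')=0$. Equivalently, the $d$ roots $p_1,\dots,p_d\in\mathcal{O}$ of $F(x,y,\cdot)$, which are distinct at $0$, are the slopes $p_i=-\partial_x(F_i)/\partial_y(F_i)$ of the leaves.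 The system $\mathcal{M}(d)$ (for $d\ge3$). For $b=(b_3,\dots,b_d)\in\mathcal{O}^{d-2}$ put $r(p)=b_3p^{d-3}+b_4p^{d-4}+\cdots+b_d$ and $F'_i=\partial_pF(x,y,p_i)$. There is a unique polynomial $Q_b\in\mathcal{O}[p]$ of degree $\le d-2$ such that for all $i=1,\dots,d$ $$Q_b(p_i)=F'_i\cdot\Big[\partial_x\big(r(p_i)/F'_i\big)+\partial_y\big(p_i\,r(p_i)/F'_i\big)\Big].$$ (The bracket is the coefficient of $dx\wedge dy$ in the differential of $\frac{r(p_i)}{F'_i}(dy-p_idx)$.) $\mathcal{M}(d)$ is the linear first-order system of $d-1$ equations in $d-2$ unknowns stating that all coefficients of $Q_b$ vanish. The coefficients of $p^0,p^1,\dots,p^{d-2}$ in $Q_b$ have the form $\partial_x(b_d)+\sum_lA_{1,l}b_{l+2}$; $\ \partial_x(b_{d-1})+\partial_y(b_d)+\sum_lA_{2,l}b_{l+2}$; $\dots$; $\ \partial_x(b_3)+\partial_y(b_4)+\sum_lA_{d-2,l}b_{l+2}$; $\ \partial_y(b_3)+\sum_lA_{d-1,l}b_{l+2}$, with $1\le l\le d-2$ and $A_{j,l}\in\mathcal{O}$. The connection $(E,\nabla)$. Let $J_m$ be the free $\mathcal{O}$-module of sections of the bundle of $m$-jets of $\mathcal{O}^{d-2}$, with elements $(f_{a,b})_{a+b\le m}$, $f_{a,b}\in\mathcal{O}^{d-2}$, where $f_{a,b}$ is a formal substitute for $\partial_x^a\partial_y^bf$. Put $R_{-1}=J_0=\mathcal{O}^{d-2}$.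 For $k\ge0$ let $R_k\subset J_{k+1}$ be the submodule of jets satisfying formally the equations of $\mathcal{M}(d)$ and all their partial derivatives up to order $k$. For $0\le k\le d-3$ the projection $R_k\to R_{k-1}$ is surjective with free kernel of rank $d-3-k$; in particular $R_{d-3}\to R_{d-4}$ is an isomorphism. Let $E=R_{d-3}\subset J_{d-2}$, which is free of rank $\pi_d$. The Spencer operator $D:J_{m+1}\to\Omega^1\otimes J_m$, $D(f)_{a,b}=(\partial_xf_{a,b}-f_{a+1,b})dx+(\partial_yf_{a,b}-f_{a,b+1})dy$ for $a+b\le m$, maps $R_{d-3}$ into $\Omega^1\otimes R_{d-4}$. Composing with the inverse of $R_{d-3}\cong R_{d-4}$ gives the connection $\nabla:E\to\Omega^1\otimes_{\mathcal{O}}E$ associated with $F$. In a basis of $E$ with connection matrix $\gamma$ (so $\nabla f=df+\gamma f$ on coordinate columns), the curvature is $K=d\gamma+\gamma\wedge\gamma$, and $\mathrm{tr}(K)$ is a $2$-form independent of the basis. Blaschke curvature. For a non-singular $3$-web given by $F_1,F_2,F_3$, choose units $\rho_i\in\mathcal{O}^*$ such that $\omega_i=\rho_idF_i$ satisfy $\omega_1+\omega_2+\omega_3=0$. There is a unique $1$-form $\gamma$ with $d\omega_i=\gamma\wedge\omega_i$ for $i=1,2,3$. The $2$-form $d\gamma$ depends only on the web and is called its Blaschke curvature. *)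

theory Defs
  imports
    "HOL-Analysis.Infinite_Sum"
    "HOL-Analysis.Product_Vector"
    "HOL-Library.Function_Algebras"
    "Subresultants.Resultant_Prelim"
begin

no_notation fps_nth (infixl "$" 75)

section \<open>The ring of convergent power series in two variables\<close>

text \<open>
  A formal power series in \<open>x, y\<close> is a series in \<open>y\<close> whose coefficients are series in \<open>x\<close>, so that
  \<open>fps_nth (fps_nth f j) i\<close> is the coefficient of \<open>x\<^sup>i y\<^sup>j\<close>.
\<close>

definition convergent_at :: "real \<Rightarrow> complex fps fps \<Rightarrow> bool" where
  "convergent_at r f \<longleftrightarrow>
     (\<lambda>(i, j). norm (fps_nth (fps_nth f j) i) * r ^ (i + j)) summable_on UNIV"

definition coeff_bound :: "real \<Rightarrow> real \<Rightarrow> complex fps fps \<Rightarrow> bool" where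
  "coeff_bound C r f \<longleftrightarrow> (\<forall>i j. norm (fps_nth (fps_nth f j) i) \<le> C * r ^ (i + j))"

lemma ex_coeff_bound:
  assumes "r > 0" "convergent_at r f"
  shows "\<exists>C>0. \<exists>R>0. coeff_bound C R f"
proof -
  let ?g = "\<lambda>(i, j). norm (fps_nth (fps_nth f j) i) * r ^ (i + j)"
  have s: "?g summable_on UNIV" using assms(2) by (simp add: convergent_at_def)
  define S where "S = infsum ?g UNIV"
  have le: "norm (fps_nth (fps_nth f j) i) * r ^ (i + j) \<le> S" for i j
  proof -
    have "sum ?g {(i, j)} \<le> S" unfolding S_def
      by (rule finite_sum_le_infsum[OF s]) (use assms(1) in auto)
    then show ?thesis by simp
  qed
  have "coeff_bound (S + 1) (inverse r) f" unfolding coeff_bound_def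
  proof (intro allI)
    fix i j
    have "norm (fps_nth (fps_nth f j) i) * r ^ (i + j) \<le> S + 1" using le[of j i] by simp
    then show "norm (fps_nth (fps_nth f j) i) \<le> (S + 1) * inverse r ^ (i + j)"
      using assms(1) by (simp add: field_simps)
  qed
  moreover have "S + 1 > 0" 
    using le[of 0 0] by (smt (verit) norm_ge_zero mult_nonneg_nonneg zero_le_power assms(1))
  ultimately show ?thesis using assms(1) by (meson inverse_positive_iff_positive)
qed

lemma convergent_at_coeff_bound:
  assumes "R > 0" "coeff_bound C R f"
  shows "convergent_at (inverse (2 * R)) f"
proof -
  have "norm (fps_nth (fps_nth f 0) 0) \<le> C"
    using assms(2)[unfolded coeff_bound_def, rule_format, of 0 0] by simp
  then have C: "C \<ge> 0" using norm_ge_zero order_trans by blast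
  have geo: "(\<lambda>n. (1/2::real) ^ n) sums 2"
    using geometric_sums[of "1/2::real"] by simp
  have g: "((\<lambda>n. (1/2::real) ^ n) has_sum 2) UNIV"
    using sums_nonneg_imp_has_sum[OF geo] by simp
  have "(\<lambda>(i, j). C * (1/2) ^ i * (1/2) ^ j) summable_on UNIV \<times> UNIV"
  proof (rule summable_on_SigmaI)
    fix i :: nat
    show "((\<lambda>j. case (i, j) of (i, j) \<Rightarrow> C * (1/2) ^ i * (1/2) ^ j) has_sum C * (1/2) ^ i * 2) UNIV"
      using has_sum_cmult_right[OF g, of "C * (1/2) ^ i"] by simp
  next
    show "(\<lambda>i::nat. C * (1/2) ^ i * 2) summable_on UNIV"
      using has_sum_imp_summable[OF has_sum_cmult_left[OF has_sum_cmult_right[OF g, of C], of 2]] .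
  qed (use C in auto)
  then have "(\<lambda>(i, j). C * (1/2) ^ i * (1/2) ^ j) summable_on UNIV" by simp
  then show ?thesis unfolding convergent_at_def
  proof (rule summable_on_comparison_test)
    fix p :: "nat \<times> nat"
    obtain i j where p: "p = (i, j)" by force
    have "norm (fps_nth (fps_nth f j) i) * inverse (2 * R) ^ (i + j)
        \<le> (C * R ^ (i + j)) * inverse (2 * R) ^ (i + j)"
      using assms by (intro mult_right_mono) (auto simp: coeff_bound_def)
    also have "\<dots> = C * (R * inverse (2 * R)) ^ (i + j)"
      by (simp only: power_mult_distrib mult.assoc)
    also have "R * inverse (2 * R) = 1/2" using assms(1) by simp
    finally show "(case p of (i, j) \<Rightarrow> norm (fps_nth (fps_nth f j) i) * inverse (2 * R) ^ (i + j))
        \<le> (case p of (i, j) \<Rightarrow> C * (1/2) ^ i * (1/2) ^ j)"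
      by (simp only: p prod.case power_add mult.assoc)
    show "0 \<le> (case p of (i, j) \<Rightarrow> norm (fps_nth (fps_nth f j) i) * inverse (2 * R) ^ (i + j))"
      using assms(1) by (simp add: p)
  qed
qed

definition convergent_series :: "complex fps fps set" where
  "convergent_series = {f. \<exists>r>0. convergent_at r f}"

lemma convergent_series_iff: "f \<in> convergent_series \<longleftrightarrow> (\<exists>C>0. \<exists>R>0. coeff_bound C R f)"
proof
  assume "f \<in> convergent_series"
  then show "\<exists>C>0. \<exists>R>0. coeff_bound C R f"
    unfolding convergent_series_def using ex_coeff_bound by blast
next
  assume "\<exists>C>0. \<exists>R>0. coeff_bound C R f"
  then obtain C R where "R > 0" "coeff_bound C R f" by blast
  then have "convergent_at (inverse (2 * R)) f" "inverse (2 * R) > 0"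
    using convergent_at_coeff_bound by auto
  then show "f \<in> convergent_series" unfolding convergent_series_def by blast
qed

lemma coeff_bound_mono:
  assumes "coeff_bound C R f" "0 \<le> C" "C \<le> C'" "0 \<le> R" "R \<le> R'"
  shows "coeff_bound C' R' f"
  using assms unfolding coeff_bound_def
  by (meson mult_mono order_trans power_mono zero_le_power)

lemma convergent_series_bounds2:
  assumes "f \<in> convergent_series" "g \<in> convergent_series"
  obtains C R where "C > 0" "R > 0" "coeff_bound C R f" "coeff_bound C R g"
proof -
  obtain C1 R1 C2 R2 where *: "C1 > 0" "R1 > 0" "coeff_bound C1 R1 f"
     "C2 > 0" "R2 > 0" "coeff_bound C2 R2 g"
    using assms unfolding convergent_series_iff by blast
  show ?thesis
    by (rule that[of "max C1 C2" "max R1 R2"])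
       (use * in \<open>auto intro: coeff_bound_mono[of C1 R1] coeff_bound_mono[of C2 R2] simp: less_max_iff_disj\<close>)
qed

lemma convergent_series_0: "0 \<in> convergent_series"
  unfolding convergent_series_iff coeff_bound_def
  by (rule exI[of _ 1], rule conjI, simp, rule exI[of _ 1]) (auto simp: fps_one_nth)

lemma convergent_series_1: "1 \<in> convergent_series"
  unfolding convergent_series_iff coeff_bound_def
  by (rule exI[of _ 1], rule conjI, simp, rule exI[of _ 1]) (auto simp: fps_one_nth)

lemma convergent_series_uminus: "f \<in> convergent_series \<Longrightarrow> - f \<in> convergent_series"
  unfolding convergent_series_iff coeff_bound_def by simp

lemma convergent_series_add:
  assumes "f \<in> convergent_series" "g \<in> convergent_series"
  shows "f + g \<in> convergent_series"
proof -
  obtain C R where *: "C > 0" "R > 0" "coeff_bound C R f" "coeff_bound C R g"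
    using convergent_series_bounds2[OF assms] by blast
  have "coeff_bound (2 * C) R (f + g)" unfolding coeff_bound_def
  proof (intro allI)
    fix i j
    have "norm (fps_nth (fps_nth (f + g) j) i)
        \<le> norm (fps_nth (fps_nth f j) i) + norm (fps_nth (fps_nth g j) i)"
      by (simp add: norm_triangle_ineq)
    also have "\<dots> \<le> C * R ^ (i + j) + C * R ^ (i + j)"
      using * unfolding coeff_bound_def by (intro add_mono) auto
    finally show "norm (fps_nth (fps_nth (f + g) j) i) \<le> 2 * C * R ^ (i + j)" by simp
  qed
  then show ?thesis unfolding convergent_series_iff using * by (meson mult_pos_pos zero_less_numeral)
qed

lemma Suc_le_two_power: "real (Suc n) \<le> 2 ^ n"
proof -
  have "Suc n \<le> 2 ^ n" by (simp add: Suc_leI less_exp)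
  then show ?thesis by (metis of_nat_le_iff of_nat_numeral of_nat_power)
qed

lemma convergent_series_mult:
  assumes "f \<in> convergent_series" "g \<in> convergent_series"
  shows "f * g \<in> convergent_series"
proof -
  obtain C R where *: "C > 0" "R > 0" "coeff_bound C R f" "coeff_bound C R g"
    using convergent_series_bounds2[OF assms] by blast
  have "coeff_bound (C * C) (2 * R) (f * g)" unfolding coeff_bound_def
  proof (intro allI)
    fix i j
    have "norm (fps_nth (fps_nth (f * g) j) i) =
        norm (\<Sum>l=0..j. \<Sum>k=0..i. fps_nth (fps_nth f l) k * fps_nth (fps_nth g (j - l)) (i - k))"
      by (simp add: fps_mult_nth fps_sum_nth)
    also have "\<dots> \<le> (\<Sum>l=0..j. \<Sum>k=0..i. (C * C) * R ^ (i + j))"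
    proof (intro sum_norm_le)
      fix l k assume "l \<in> {0..j}" "k \<in> {0..i}"
      then have e: "i + j = (k + l) + ((i - k) + (j - l))" by auto
      have "norm (fps_nth (fps_nth f l) k * fps_nth (fps_nth g (j - l)) (i - k))
          \<le> (C * R ^ (k + l)) * (C * R ^ ((i - k) + (j - l)))"
        unfolding norm_mult using * unfolding coeff_bound_def by (intro mult_mono) auto
      also have "\<dots> = (C * C) * R ^ (i + j)"
        by (subst e, subst power_add) (simp only: mult_ac)
      finally show "norm (fps_nth (fps_nth f l) k * fps_nth (fps_nth g (j - l)) (i - k))
          \<le> (C * C) * R ^ (i + j)" .
    qed
    also have "\<dots> = (real (Suc i) * real (Suc j)) * ((C * C) * R ^ (i + j))" by simp
    also have "\<dots> \<le> (2 ^ i * 2 ^ j) * ((C * C) * R ^ (i + j))"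
      using * Suc_le_two_power[of i] Suc_le_two_power[of j] by (intro mult_right_mono mult_mono) auto
    also have "\<dots> = C * C * (2 * R) ^ (i + j)" by (simp add: power_add power_mult_distrib)
    finally show "norm (fps_nth (fps_nth (f * g) j) i) \<le> C * C * (2 * R) ^ (i + j)" .
  qed
  then show ?thesis unfolding convergent_series_iff using * by (meson mult_pos_pos zero_less_numeral)
qed

typedef germ = convergent_series
  using convergent_series_0 by blast

setup_lifting type_definition_germ

instantiation germ :: idom
begin
lift_definition zero_germ :: germ is 0 by (rule convergent_series_0)
lift_definition one_germ :: germ is 1 by (rule convergent_series_1)
lift_definition plus_germ :: "germ \<Rightarrow> germ \<Rightarrow> germ" is "(+)" by (rule convergent_series_add)
lift_definition times_germ :: "germ \<Rightarrow> germ \<Rightarrow> germ" is "(*)" by (rule convergent_series_mult)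
lift_definition uminus_germ :: "germ \<Rightarrow> germ" is uminus by (rule convergent_series_uminus)
definition minus_germ :: "germ \<Rightarrow> germ \<Rightarrow> germ" where "minus_germ a b = a + - b"
instance
proof
  fix a b c :: germ
  show "a * b * c = a * (b * c)" "a * b = b * a" "1 * a = a" "a + b + c = a + (b + c)"
    "a + b = b + a" "0 + a = a" "- a + a = 0" "(a + b) * c = a * c + b * c" "(0 :: germ) \<noteq> 1"
    "0 * a = 0" "a * 0 = 0" "a * (b + c) = a * b + a * c"
    by (transfer; simp add: algebra_simps)+
  show "a - b = a + - b" by (simp add: minus_germ_def)
  show "a \<noteq> 0 \<Longrightarrow> b \<noteq> 0 \<Longrightarrow> a * b \<noteq> 0" by (transfer; simp)
qed
end

instance germ :: ring_char_0
proof
  have "Rep_germ (of_nat n) = of_nat n" for n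
    by (induction n) (simp_all add: zero_germ.rep_eq one_germ.rep_eq plus_germ.rep_eq)
  then show "inj (of_nat :: nat \<Rightarrow> germ)"
    by (metis injI of_nat_eq_iff)
qed

text \<open>Division is exact division; it is only used where the quotient exists in the ring.\<close>

instantiation germ :: idom_divide
begin
definition divide_germ :: "germ \<Rightarrow> germ \<Rightarrow> germ" where
  "divide_germ a b = (if b \<noteq> 0 \<and> b dvd a then THE c. a = b * c else 0)"
instance
proof
  fix a b :: germ
  show "a div 0 = 0" by (simp add: divide_germ_def)
  assume b: "b \<noteq> 0"
  then have "(THE c. a * b = b * c) = a"
    by (intro the_equality) (auto simp: mult.commute)
  then show "a * b div b = a" using b by (simp add: divide_germ_def)
qed
end

lift_definition at0 :: "germ \<Rightarrow> complex" is "\<lambda>f. fps_nth (fps_nth f 0) 0" .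

lemma Suc_norm_le:
  assumes "norm z \<le> C * R ^ Suc n" "0 < C" "0 < R" "i \<le> n"
  shows "norm (of_nat (Suc i) * z :: complex) \<le> C * R * (2 * R) ^ n"
proof -
  have "norm (of_nat (Suc i) * z) = real (Suc i) * norm z" by (simp only: norm_mult norm_of_nat)
  also have "\<dots> \<le> real (Suc n) * (C * R ^ Suc n)" using assms by (intro mult_mono) auto
  also have "\<dots> \<le> 2 ^ n * (C * R ^ Suc n)"
    using assms Suc_le_two_power[of n] by (intro mult_right_mono) auto
  also have "\<dots> = C * R * (2 * R) ^ n" by (simp add: power_mult_distrib)
  finally show ?thesis .
qed

lift_definition ddx :: "germ \<Rightarrow> germ" is "\<lambda>f. Abs_fps (\<lambda>j. fps_deriv (fps_nth f j))"
proof -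
  fix f :: "complex fps fps" assume "f \<in> convergent_series"
  then obtain C R where *: "C > 0" "R > 0" "coeff_bound C R f" unfolding convergent_series_iff by blast
  have "coeff_bound (C * R) (2 * R) (Abs_fps (\<lambda>j. fps_deriv (fps_nth f j)))"
    unfolding coeff_bound_def
  proof (intro allI)
    fix i j
    have "norm (fps_nth (fps_nth f j) (Suc i)) \<le> C * R ^ Suc (i + j)"
      using *(3)[unfolded coeff_bound_def, rule_format, of j "Suc i"] by simp
    from Suc_norm_le[OF this *(1,2), of i]
    show "norm (fps_nth (fps_nth (Abs_fps (\<lambda>j. fps_deriv (fps_nth f j))) j) i)
        \<le> C * R * (2 * R) ^ (i + j)" by simp
  qed
  then show "Abs_fps (\<lambda>j. fps_deriv (fps_nth f j)) \<in> convergent_series"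
    unfolding convergent_series_iff using * by (meson mult_pos_pos zero_less_numeral)
qed

lift_definition ddy :: "germ \<Rightarrow> germ" is fps_deriv
proof -
  fix f :: "complex fps fps" assume "f \<in> convergent_series"
  then obtain C R where *: "C > 0" "R > 0" "coeff_bound C R f" unfolding convergent_series_iff by blast
  have "coeff_bound (C * R) (2 * R) (fps_deriv f)"
    unfolding coeff_bound_def
  proof (intro allI)
    fix i j
    have "norm (fps_nth (fps_nth f (Suc j)) i) \<le> C * R ^ Suc (i + j)"
      using *(3)[unfolded coeff_bound_def, rule_format, of "Suc j" i] by simp
    from Suc_norm_le[OF this *(1,2), of j]
    have "norm (of_nat (Suc j) * fps_nth (fps_nth f (Suc j)) i) \<le> C * R * (2 * R) ^ (i + j)" by simp
    moreover have "fps_nth (of_nat (Suc j) * h) i = of_nat (Suc j) * fps_nth h i" for h :: "complex fps"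
      by (metis fps_mult_left_const_nth fps_of_nat)
    ultimately show "norm (fps_nth (fps_nth (fps_deriv f) j) i) \<le> C * R * (2 * R) ^ (i + j)"
      by simp
  qed
  then show "fps_deriv f \<in> convergent_series"
    unfolding convergent_series_iff using * by (meson mult_pos_pos zero_less_numeral)
qed

section \<open>Differential forms\<close>

text \<open>
  The pair \<open>(a, b)\<close> stands for the 1-form \<open>a dx + b dy\<close>, and a germ \<open>w\<close> for the 2-form \<open>w dx \<and> dy\<close>.
\<close>

type_synonym form1 = "germ \<times> germ"
type_synonym form2 = germ

definition d0 :: "germ \<Rightarrow> form1" where
  "d0 f = (ddx f, ddy f)"

definition d1 :: "form1 \<Rightarrow> form2" where
  "d1 w = ddx (snd w) - ddy (fst w)"

definition wedge :: "form1 \<Rightarrow> form1 \<Rightarrow> form2" where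
  "wedge v w = fst v * snd w - snd v * fst w"

definition scale1 :: "germ \<Rightarrow> form1 \<Rightarrow> form1" where
  "scale1 c w = (c * fst w, c * snd w)"

section \<open>Webs\<close>

text \<open>
  A family of foliations is given by first integrals \<open>f i\<close>, with \<open>i\<close> in a finite index set \<open>I\<close>;
  a \<open>d\<close>-web has \<open>I = {..<d}\<close>, and its extracted 3-webs are the subsets of \<open>I\<close> with three elements.
\<close>

definition nonsingular_web :: "nat set \<Rightarrow> (nat \<Rightarrow> germ) \<Rightarrow> bool" where
  "nonsingular_web I f \<longleftrightarrow>
     finite I \<and> (\<forall>i\<in>I. at0 (f i) = 0) \<and>
     (\<forall>i\<in>I. \<forall>j\<in>I. i \<noteq> j \<longrightarrow> at0 (wedge (d0 (f i)) (d0 (f j))) \<noteq> 0)"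

definition slope :: "germ \<Rightarrow> germ" where
  "slope f = - (ddx f div ddy f)"

definition p_discriminant :: "germ poly \<Rightarrow> germ" where
  "p_discriminant F =
     (- 1) ^ (degree F * (degree F - 1) div 2) * (resultant F (pderiv F) div lead_coeff F)"

text \<open>
  Transversality of the leaves to the \<open>y\<close>-axis, which makes the slopes germs, is forced by
  \<open>a\<^sub>0(0) \<noteq> 0\<close>; without it the quotient in \<^const>\<open>slope\<close> would be meaningless.
\<close>

definition presents_web :: "germ poly \<Rightarrow> nat \<Rightarrow> (nat \<Rightarrow> germ) \<Rightarrow> bool" where
  "presents_web F d f \<longleftrightarrow>
     degree F = d \<and> at0 (lead_coeff F) \<noteq> 0 \<and> at0 (p_discriminant F) \<noteq> 0 \<and>
     (\<forall>i<d. at0 (ddy (f i)) \<noteq> 0) \<and>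
     {p. poly F p = 0} = (\<lambda>i. slope (f i)) ` {..<d}"

definition blaschke_curvature :: "nat set \<Rightarrow> (nat \<Rightarrow> germ) \<Rightarrow> form2" where
  "blaschke_curvature S f =
     (THE w. \<exists>\<rho> \<gamma>. (\<forall>i\<in>S. \<rho> i dvd 1) \<and>
        (\<Sum>i\<in>S. scale1 (\<rho> i) (d0 (f i))) = 0 \<and>
        (\<forall>i\<in>S. d1 (scale1 (\<rho> i) (d0 (f i))) = wedge \<gamma> (scale1 (\<rho> i) (d0 (f i)))) \<and>
        w = d1 \<gamma>)"

section \<open>The differential system\<close>

text \<open>
  Throughout, \<open>d = degree F\<close>, and the unknowns \<open>b\<^sub>3, \<dots>, b\<^sub>d\<close> are the values of a function \<open>b\<close>
  on \<open>{3..d}\<close>.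
\<close>

definition r_poly :: "germ poly \<Rightarrow> (nat \<Rightarrow> germ) \<Rightarrow> germ poly" where
  "r_poly F b = (\<Sum>j = 3..degree F. monom (b j) (degree F - j))"

definition Q_spec :: "germ poly \<Rightarrow> (nat \<Rightarrow> germ) \<Rightarrow> germ poly \<Rightarrow> bool" where
  "Q_spec F b q \<longleftrightarrow>
     degree q \<le> degree F - 2 \<and>
     (\<forall>p. poly F p = 0 \<longrightarrow>
        poly q p = poly (pderiv F) p *
          (ddx (poly (r_poly F b) p div poly (pderiv F) p) +
           ddy (p * poly (r_poly F b) p div poly (pderiv F) p)))"

definition Q_poly :: "germ poly \<Rightarrow> (nat \<Rightarrow> germ) \<Rightarrow> germ poly" where
  "Q_poly F b = (THE q. Q_spec F b q)"

text \<open>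
  A linear differential expression \<open>\<Sum> c a b l \<cdot> \<partial>\<^sub>x\<^sup>a \<partial>\<^sub>y\<^sup>b b\<^sub>l\<close> is the family \<open>c\<close> of its coefficients. The
  \<open>m\<close>-th equation of the system is the coefficient of \<open>p\<^sup>m\<close> in \<open>Q_b\<close>, which has the form
  \<open>\<partial>\<^sub>x b\<^bsub>d-m\<^esub> + \<partial>\<^sub>y b\<^bsub>d-m+1\<^esub> + \<Sum> A\<^sub>l b\<^sub>l\<close>, where the terms with index outside
  \<open>{3..d}\<close> are absent. Its zeroth order coefficient \<open>A\<^sub>l\<close> is found by inserting the constant \<open>l\<close>-th unit
  vector.
\<close>

type_synonym lin_expr = "nat \<Rightarrow> nat \<Rightarrow> nat \<Rightarrow> germ"

definition equation :: "germ poly \<Rightarrow> nat \<Rightarrow> lin_expr" where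
  "equation F m a b l =
     (if a = 0 \<and> b = 0 then coeff (Q_poly F (\<lambda>k. if k = l then 1 else 0)) m
      else if a = 1 \<and> b = 0 \<and> l + m = degree F then 1
      else if a = 0 \<and> b = 1 \<and> l + m = degree F + 1 then 1
      else 0)"

definition formal_ddx :: "lin_expr \<Rightarrow> lin_expr" where
  "formal_ddx c = (\<lambda>a b l. ddx (c a b l) + (if a = 0 then 0 else c (a - 1) b l))"

definition formal_ddy :: "lin_expr \<Rightarrow> lin_expr" where
  "formal_ddy c = (\<lambda>a b l. ddy (c a b l) + (if b = 0 then 0 else c a (b - 1) l))"

section \<open>Jets and the connection\<close>

text \<open>\<open>f a b l\<close> is the formal substitute for \<open>\<partial>\<^sub>x\<^sup>a \<partial>\<^sub>y\<^sup>b b\<^sub>l\<close>.\<close>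

type_synonym jet = "nat \<Rightarrow> nat \<Rightarrow> nat \<Rightarrow> germ"

definition jets :: "germ poly \<Rightarrow> nat \<Rightarrow> jet set" where
  "jets F m = {f. \<forall>a b l. f a b l \<noteq> 0 \<longrightarrow> a + b \<le> m \<and> l \<in> {3..degree F}}"

definition scale_jet :: "germ \<Rightarrow> jet \<Rightarrow> jet" where
  "scale_jet c f = (\<lambda>a b l. c * f a b l)"

interpretation jet: Modules.module scale_jet
  by standard (simp_all add: scale_jet_def fun_eq_iff distrib_left distrib_right mult.assoc)

definition apply_expr :: "germ poly \<Rightarrow> nat \<Rightarrow> lin_expr \<Rightarrow> jet \<Rightarrow> germ" where
  "apply_expr F n c f = (\<Sum>(a, b) | a + b \<le> n. \<Sum>l = 3..degree F. c a b l * f a b l)"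

text \<open>
  \<open>solution_jets F n\<close> is the submodule \<open>R\<^bsub>n-1\<^esub>\<close> of \<open>J\<^sub>n\<close>; in particular \<open>solution_jets F 0 = J\<^sub>0 = R\<^bsub>-1\<^esub>\<close>.
\<close>

definition solution_jets :: "germ poly \<Rightarrow> nat \<Rightarrow> jet set" where
  "solution_jets F n = {f \<in> jets F n. \<forall>m \<le> degree F - 2. \<forall>s t. s + t < n \<longrightarrow>
     apply_expr F n ((formal_ddx ^^ s) ((formal_ddy ^^ t) (equation F m))) f = 0}"

definition truncate_jet :: "nat \<Rightarrow> jet \<Rightarrow> jet" where
  "truncate_jet m f = (\<lambda>a b l. if a + b \<le> m then f a b l else 0)"

text \<open>The \<open>dx\<close>- and \<open>dy\<close>-components of the Spencer operator \<open>J\<^bsub>m+1\<^esub> \<rightarrow> \<Omega>\<^sup>1 \<otimes> J\<^sub>m\<close>.\<close>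

definition spencer_x :: "nat \<Rightarrow> jet \<Rightarrow> jet" where
  "spencer_x m f = (\<lambda>a b l. if a + b \<le> m then ddx (f a b l) - f (Suc a) b l else 0)"

definition spencer_y :: "nat \<Rightarrow> jet \<Rightarrow> jet" where
  "spencer_y m f = (\<lambda>a b l. if a + b \<le> m then ddy (f a b l) - f a (Suc b) l else 0)"

definition E_module :: "germ poly \<Rightarrow> jet set" where
  "E_module F = solution_jets F (degree F - 2)"

definition lift_to_E :: "germ poly \<Rightarrow> jet \<Rightarrow> jet" where
  "lift_to_E F = inv_into (E_module F) (truncate_jet (degree F - 3))"

text \<open>\<open>\<nabla> f = nabla_x F f dx + nabla_y F f dy\<close>.\<close>

definition nabla_x :: "germ poly \<Rightarrow> jet \<Rightarrow> jet" where
  "nabla_x F f = lift_to_E F (spencer_x (degree F - 3) f)"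

definition nabla_y :: "germ poly \<Rightarrow> jet \<Rightarrow> jet" where
  "nabla_y F f = lift_to_E F (spencer_y (degree F - 3) f)"

definition is_basis_of_E :: "germ poly \<Rightarrow> jet set \<Rightarrow> bool" where
  "is_basis_of_E F B \<longleftrightarrow> finite B \<and> jet.independent B \<and> jet.span B = E_module F"

text \<open>
  Matrices are indexed by the elements of a basis \<open>B\<close>. The column of index \<open>v\<close> of the connection
  matrix consists of the coordinates of \<open>\<nabla> v\<close>.
\<close>

definition connection_matrix :: "germ poly \<Rightarrow> jet set \<Rightarrow> jet \<Rightarrow> jet \<Rightarrow> form1" where
  "connection_matrix F B u v =
     (jet.representation B (nabla_x F v) u, jet.representation B (nabla_y F v) u)"

definition curvature_matrix :: "germ poly \<Rightarrow> jet set \<Rightarrow> jet \<Rightarrow> jet \<Rightarrow> form2" where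
  "curvature_matrix F B u v =
     d1 (connection_matrix F B u v) +
     (\<Sum>w\<in>B. wedge (connection_matrix F B u w) (connection_matrix F B w v))"

definition curvature_trace :: "germ poly \<Rightarrow> form2" where
  "curvature_trace F =
     (THE w. \<exists>B. is_basis_of_E F B \<and> w = (\<Sum>v\<in>B. curvature_matrix F B v v))"

end

theory Submission
  imports Defs
begin

text \<open>
  The jets of order \<open>d - 3\<close> of the unknowns form a free module \<open>J\<close>, in which \<open>E\<close> is the kernel of the
  equations of order at most \<open>d - 3\<close>. There are as many equations of order \<open>d - 2\<close> as jet coordinates of
  that order, and they determine these uniquely; so every element of \<open>J\<close> lifts to order \<open>d - 2\<close>, and the
  Spencer operator of the lift is a connection on \<open>J\<close>. It restricts to \<open>\<nabla>\<close> on \<open>E\<close>, and on the quotient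
  \<open>J / E\<close>, the values of the equations, it induces a nilpotent connection. Hence \<open>tr K\<close> is the
  differential of the trace of its matrix on \<open>J\<close>, which is linear in the zeroth order
  coefficients of the system. By Lagrange interpolation at the slopes \<open>p\<^sub>i\<close> it equals, up to a multiple of
  the logarithmic differential of the leading coefficient of \<open>F\<close>, a sum over triples of leaves, and the
  contribution of the triples in an extracted 3-web is its Blaschke connection form. The argument works
  for every \<open>d \<ge> 3\<close>.
\<close>

section \<open>Germs\<close>

text \<open>A direct computation on \<open>E\<close> meets an obstacle: expressing the dependent jet
  entries by the free ones uses the lower equations, and the result is polynomial in the
  coefficients of the system and their derivatives. On \<open>J\<close> the jet entries themselves
  are the coordinates, and a diagonal entry of the connection matrix can only come from the lift to
  order \<open>d - 2\<close>. The principal parts have constant coefficients, so in that order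
  nothing but an undifferentiated zeroth order coefficient reaches the diagonal. Nilpotency on
  \<open>J / E\<close> has this source: the Spencer operator links the value of an equation only to
  values of its derivatives, and the last link is cut because the lift satisfies the equations of
  order \<open>d - 2\<close>. The trace needs only the vanishing diagonal. The multiple of the
  logarithmic differential is \<open>(d - 1) (d - 2) / 2\<close>, the rank of \<open>E\<close>. The
  identities are stated with a factor 2 because a sum over ordered triples counts the two companions
  of a leaf in both orders; the factor is cancelled at the end, in characteristic 0.\<close>

lemma ddx_add [simp]: "ddx (a + b) = ddx a + ddx b"
  by transfer (simp add: fps_eq_iff)

lemma ddy_add [simp]: "ddy (a + b) = ddy a + ddy b"
  by transfer simp

lemma ddx_mult: "ddx (a * b) = ddx a * b + a * ddx b"
  by transfer (simp add: fps_eq_iff[where 'a="complex fps"] fps_mult_nth fps_deriv_sum sum.distrib add.commute)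

lemma ddy_mult: "ddy (a * b) = ddy a * b + a * ddy b"
  by transfer (simp add: algebra_simps)

lemma ddx_ddy: "ddx (ddy a) = ddy (ddx a)"
  by transfer (simp add: fps_eq_iff[where 'a="complex fps"] add.commute)

lemma ddx_0 [simp]: "ddx 0 = 0" and ddy_0 [simp]: "ddy 0 = 0"
  using ddx_add[of 0 0] ddy_add[of 0 0] by simp_all

lemma ddx_1 [simp]: "ddx 1 = 0" and ddy_1 [simp]: "ddy 1 = 0"
  using ddx_mult[of 1 1] ddy_mult[of 1 1] by simp_all

lemma ddx_uminus [simp]: "ddx (- a) = - ddx a" and ddy_uminus [simp]: "ddy (- a) = - ddy a"
  using ddx_add[of a "- a"] ddy_add[of a "- a"] by (simp_all add: eq_neg_iff_add_eq_0 add.commute)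

lemma ddx_diff [simp]: "ddx (a - b) = ddx a - ddx b" and ddy_diff [simp]: "ddy (a - b) = ddy a - ddy b"
  using ddx_add[of a "- b"] ddy_add[of a "- b"] by simp_all

lemma ddx_sum [simp]: "ddx (sum g A) = (\<Sum>a\<in>A. ddx (g a))"
  by (induction A rule: infinite_finite_induct) simp_all

lemma ddy_sum [simp]: "ddy (sum g A) = (\<Sum>a\<in>A. ddy (g a))"
  by (induction A rule: infinite_finite_induct) simp_all

lemma at0_add [simp]: "at0 (a + b) = at0 a + at0 b"
  by transfer simp

lemma at0_mult [simp]: "at0 (a * b) = at0 a * at0 b"
  by transfer (simp add: fps_mult_nth)

lemma at0_0 [simp]: "at0 0 = 0" and at0_1 [simp]: "at0 1 = 1"
  by (transfer; simp)+

lemma at0_uminus [simp]: "at0 (- a) = - at0 a"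
  by transfer simp

lemma at0_diff [simp]: "at0 (a - b) = at0 a - at0 b"
  using at0_add[of a "- b"] by simp

text \<open>The relation \<open>f * h = 1\<close> is a recursion for the coefficients of
  \<open>h\<close> in the total order \<open>i + j\<close>. The bound passes through it with the
  constant \<open>1 / norm (f(0))\<close> unchanged once the rate \<open>S\<close> is large
  enough.\<close>

lemma coeff_bound_right_inverse:
  fixes f h :: "complex fps fps"
  assumes fh: "f * h = 1" and c: "fps_nth (fps_nth f 0) 0 \<noteq> 0"
    and bd: "coeff_bound C R f" "C > 0" "R > 0"
  shows "\<exists>S>0. coeff_bound (1 / norm (fps_nth (fps_nth f 0) 0)) S h"
proof -
  define F where "F l k = fps_nth (fps_nth f l) k" for l k
  define H where "H l k = fps_nth (fps_nth h l) k" for l k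
  define c where "c = norm (F 0 0)"
  have cpos: "c > 0" using c by (simp add: c_def F_def)
  \<comment> \<open>The factor \<open>max 1 (C / c)\<close> moves the constant \<open>C / c\<close>
    into the rate, which is possible since only terms with \<open>k + l > 0\<close> occur. The 4 in
    \<open>S\<close> makes the recursion contract: the sum of \<open>(1/4) ^ (k + l)\<close> over
    \<open>(l, k)\<close> other than \<open>(0, 0)\<close> is at most
    \<open>(4/3) * (4/3) - 1 = 7/9\<close>.\<close>
  define R' where "R' = R * max 1 (C / c)"
  have R': "R' > 0" using bd by (simp add: R'_def)
  define S where "S = 4 * R'"
  have S: "S > 0" using R' by (simp add: S_def)
  have eq: "(\<Sum>l=0..j. \<Sum>k=0..i. F l k * H (j - l) (i - k)) = (if i = 0 \<and> j = 0 then 1 else 0)" for i j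
  proof -
    have "fps_nth (fps_nth (f * h) j) i = (\<Sum>l=0..j. \<Sum>k=0..i. F l k * H (j - l) (i - k))"
      by (simp add: fps_mult_nth fps_sum_nth F_def H_def)
    then show ?thesis by (simp add: fh fps_one_nth split: if_splits)
  qed
  have geo: "(\<Sum>k=0..n. (1/4::real) ^ k) \<le> 4/3" for n
    by (subst sum_gp) (simp add: field_simps)
  have Fb: "norm (F l k) / c \<le> R' ^ (k + l)" if "k + l > 0" for l k
  proof -
    have "norm (F l k) / c \<le> C * R ^ (k + l) / c"
      using bd cpos unfolding coeff_bound_def F_def by (intro divide_right_mono) auto
    also have "\<dots> = C / c * R ^ (k + l)" by simp
    also have "\<dots> \<le> max 1 (C / c) ^ (k + l) * R ^ (k + l)"
    proof (rule mult_right_mono)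
      have "C / c \<le> max 1 (C / c) ^ 1" by simp
      also have "\<dots> \<le> max 1 (C / c) ^ (k + l)"
        using that by (intro power_increasing) auto
      finally show "C / c \<le> max 1 (C / c) ^ (k + l)" .
    qed (use bd in simp)
    finally show ?thesis by (simp add: R'_def power_mult_distrib mult.commute)
  qed
  have "norm (H j i) \<le> 1 / c * S ^ (i + j)" for i j
  proof (induction "i + j" arbitrary: i j rule: less_induct)
    case less
    show ?case
    proof (cases "i = 0 \<and> j = 0")
      case True
      then have "F 0 0 * H 0 0 = 1" using eq[of 0 0] by simp
      then have "norm (F 0 0) * norm (H 0 0) = 1" by (metis norm_mult norm_one)
      then show ?thesis using True cpos by (simp add: c_def field_simps)
    next
      case False
      let ?X = "{0..j} \<times> {0..i}"
      have "(\<Sum>(l, k)\<in>?X. F l k * H (j - l) (i - k)) = 0"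
        using eq[of j i] False by (simp add: sum.cartesian_product)
      then have "F 0 0 * H j i = - (\<Sum>(l, k)\<in>?X - {(0, 0)}. F l k * H (j - l) (i - k))"
        by (subst (asm) sum.remove[of _ "(0, 0)"]) (auto simp: eq_neg_iff_add_eq_0)
      then have "norm (F 0 0 * H j i) = norm (\<Sum>(l, k)\<in>?X - {(0, 0)}. F l k * H (j - l) (i - k))"
        by simp
      then have "c * norm (H j i) \<le> (\<Sum>(l, k)\<in>?X - {(0, 0)}. norm (F l k * H (j - l) (i - k)))"
        unfolding c_def norm_mult[symmetric] by (simp add: case_prod_unfold norm_sum)
      also have "\<dots> \<le> (\<Sum>(l, k)\<in>?X - {(0, 0)}. (1/4) ^ l * (1/4) ^ k * S ^ (i + j))"
      proof (rule sum_mono)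
        fix x assume xX: "x \<in> ?X - {(0, 0)}"
        obtain l k where x: "x = (l, k)" by force
        have *: "l \<in> {0..j}" "k \<in> {0..i}" "\<not> (l = 0 \<and> k = 0)" using xX x by auto
        then have pos: "k + l > 0" by auto
        have sm: "(i - k) + (j - l) < i + j" and e: "i + j = (k + l) + ((i - k) + (j - l))"
          using * by auto
        have "norm (F l k * H (j - l) (i - k)) = norm (F l k) * norm (H (j - l) (i - k))"
          by (rule norm_mult)
        also have "\<dots> \<le> norm (F l k) * (1 / c * S ^ ((i - k) + (j - l)))"
          using less[OF sm] by (intro mult_left_mono) auto
        also have "\<dots> = (norm (F l k) / c) * S ^ ((i - k) + (j - l))" by simp
        also have "\<dots> \<le> R' ^ (k + l) * S ^ ((i - k) + (j - l))"
          using Fb[OF pos] S by (intro mult_right_mono) auto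
        also have "R' = (1/4) * S" by (simp add: S_def)
        also have "((1/4) * S) ^ (k + l) * S ^ ((i - k) + (j - l)) = (1/4) ^ (k + l) * S ^ (i + j)"
          unfolding power_mult_distrib by (subst e, subst (3) power_add) simp
        finally show "(case x of (l, k) \<Rightarrow> norm (F l k * H (j - l) (i - k))) \<le>
            (case x of (l, k) \<Rightarrow> (1/4) ^ l * (1/4) ^ k * S ^ (i + j))"
          by (simp add: x power_add mult_ac)
      qed
      also have "\<dots> = ((\<Sum>(l, k)\<in>?X - {(0, 0)}. (1/4) ^ l * (1/4) ^ k)) * S ^ (i + j)"
        by (simp add: sum_distrib_right case_prod_unfold)
      also have "(\<Sum>(l, k)\<in>?X - {(0, 0)}. (1/4::real) ^ l * (1/4) ^ k) =
          (\<Sum>(l, k)\<in>?X. (1/4) ^ l * (1/4) ^ k) - 1"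
        by (subst (2) sum.remove[of _ "(0, 0)"]) auto
      also have "(\<Sum>(l, k)\<in>?X. (1/4::real) ^ l * (1/4) ^ k) =
          (\<Sum>l=0..j. (1/4) ^ l) * (\<Sum>k=0..i. (1/4) ^ k)"
        by (simp add: sum_product sum.cartesian_product)
      also have "((\<Sum>l=0..j. (1/4::real) ^ l) * (\<Sum>k=0..i. (1/4) ^ k) - 1) * S ^ (i + j) \<le> 1 * S ^ (i + j)"
      proof (rule mult_right_mono)
        have "(\<Sum>l=0..j. (1/4::real) ^ l) * (\<Sum>k=0..i. (1/4) ^ k) \<le> 4/3 * (4/3)"
          by (intro mult_mono geo sum_nonneg) auto
        then show "(\<Sum>l=0..j. (1/4::real) ^ l) * (\<Sum>k=0..i. (1/4) ^ k) - 1 \<le> 1" by simp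
      qed (use S in simp)
      finally show ?thesis using cpos by (simp add: field_simps)
    qed
  qed
  then have "coeff_bound (1 / c) S h" by (simp add: coeff_bound_def H_def)
  then show ?thesis using S by (auto simp: c_def F_def)
qed

text \<open>The inverse exists as a formal series as soon as the constant term is non-zero; only its
  convergence is at stake.\<close>

lemma germ_unit_iff: "a dvd 1 \<longleftrightarrow> at0 a \<noteq> 0"
proof
  assume "a dvd 1"
  then obtain b where "1 = a * b" ..
  then have "at0 a * at0 b = 1" by (metis at0_mult at0_1)
  then show "at0 a \<noteq> 0" by auto
next
  assume nz: "at0 a \<noteq> 0"
  define f where "f = Rep_germ a"
  have f0: "fps_nth (fps_nth f 0) 0 \<noteq> 0" using nz by (simp add: at0.rep_eq f_def)
  define h where "h = fps_right_inverse f (inverse (fps_nth f 0))"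
  have fh: "f * h = 1" unfolding h_def
    by (rule fps_right_inverse) (use f0 in \<open>simp add: inverse_mult_eq_1'\<close>)
  obtain C R where CR: "C > 0" "R > 0" "coeff_bound C R f"
    using Rep_germ[of a] unfolding convergent_series_iff f_def by blast
  obtain S where "S > 0" "coeff_bound (1 / norm (fps_nth (fps_nth f 0) 0)) S h"
    using coeff_bound_right_inverse[OF fh f0 CR(3,1,2)] by blast
  then have h: "h \<in> convergent_series"
    unfolding convergent_series_iff using f0 by (meson zero_less_divide_1_iff zero_less_norm_iff)
  have "a * Abs_germ h = 1"
    using fh by (simp add: Rep_germ_inject[symmetric] times_germ.rep_eq one_germ.rep_eq Abs_germ_inverse[OF h] f_def)
  then show "a dvd 1" by (metis dvdI)
qed

section \<open>Traces of connection matrices\<close>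

text \<open>Exchanging the two indices changes the sign, as 1-forms anticommute. Hence the trace of
  the curvature is the differential of the trace of the connection matrix.\<close>

lemma trace_wedge_eq_0: "(\<Sum>v\<in>B. \<Sum>w\<in>B. wedge (\<omega> v w) (\<omega> w v)) = 0"
proof -
  have "(\<Sum>v\<in>B. \<Sum>w\<in>B. wedge (\<omega> v w) (\<omega> w v)) = 
      (\<Sum>v\<in>B. \<Sum>w\<in>B. fst (\<omega> v w) * snd (\<omega> w v)) - (\<Sum>v\<in>B. \<Sum>w\<in>B. fst (\<omega> w v) * snd (\<omega> v w))"
    by (simp add: wedge_def sum_subtractf mult.commute)
  also have "(\<Sum>v\<in>B. \<Sum>w\<in>B. fst (\<omega> w v) * snd (\<omega> v w)) = (\<Sum>v\<in>B. \<Sum>w\<in>B. fst (\<omega> v w) * snd (\<omega> w v))"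
    by (rule sum.swap)
  finally show ?thesis by simp
qed

lemma additive_sum:
  fixes D :: "germ \<Rightarrow> germ"
  assumes "\<And>a b. D (a + b) = D a + D b"
  shows "D (sum g A) = (\<Sum>a\<in>A. D (g a))"
proof -
  have "D 0 = 0" using assms[of 0 0] by simp
  then show ?thesis by (induction A rule: infinite_finite_induct) (simp_all add: assms)
qed

text \<open>Differentiating \<open>N M = 1\<close> gives \<open>dN = - N dM N\<close>.\<close>

lemma deriv_inverse_matrix:
  fixes M :: "'i \<Rightarrow> 'k \<Rightarrow> germ" and N :: "'k \<Rightarrow> 'i \<Rightarrow> germ" and D :: "germ \<Rightarrow> germ"
  assumes fin: "finite I" "finite K"
    and NM: "\<And>\<alpha> \<beta>. \<alpha> \<in> K \<Longrightarrow> \<beta> \<in> K \<Longrightarrow> (\<Sum>i\<in>I. N \<alpha> i * M i \<beta>) = (if \<alpha> = \<beta> then 1 else 0)"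
    and MN: "\<And>i j. i \<in> I \<Longrightarrow> j \<in> I \<Longrightarrow> (\<Sum>\<alpha>\<in>K. M i \<alpha> * N \<alpha> j) = (if i = j then 1 else 0)"
    and D_add: "\<And>a b. D (a + b) = D a + D b"
    and D_mult: "\<And>a b. D (a * b) = D a * b + a * D b"
    and \<alpha>: "\<alpha> \<in> K" and i: "i \<in> I"
  shows "D (N \<alpha> i) = - (\<Sum>\<beta>\<in>K. \<Sum>j\<in>I. N \<alpha> j * D (M j \<beta>) * N \<beta> i)"
proof -
  have D0: "D 0 = 0" using D_add[of 0 0] by simp
  have D1: "D 1 = 0" using D_mult[of 1 1] by simp
  have *: "(\<Sum>j\<in>I. D (N \<alpha> j) * M j \<beta>) = - (\<Sum>j\<in>I. N \<alpha> j * D (M j \<beta>))" if "\<beta> \<in> K" for \<beta>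
  proof -
    have "D (\<Sum>j\<in>I. N \<alpha> j * M j \<beta>) = 0" by (simp add: NM[OF \<alpha> that] D0 D1)
    then have "(\<Sum>j\<in>I. D (N \<alpha> j) * M j \<beta>) + (\<Sum>j\<in>I. N \<alpha> j * D (M j \<beta>)) = 0"
      by (simp add: additive_sum[of D, OF D_add] D_mult sum.distrib)
    then show ?thesis by (simp add: eq_neg_iff_add_eq_0)
  qed
  have "D (N \<alpha> i) = (\<Sum>j\<in>I. D (N \<alpha> j) * (if j = i then 1 else 0))"
    using fin i by (simp add: if_distrib[of "\<lambda>x. _ * x"] cong: if_cong)
  also have "\<dots> = (\<Sum>j\<in>I. D (N \<alpha> j) * (\<Sum>\<beta>\<in>K. M j \<beta> * N \<beta> i))"
    using i by (intro sum.cong) (simp_all add: MN)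
  also have "\<dots> = (\<Sum>\<beta>\<in>K. (\<Sum>j\<in>I. D (N \<alpha> j) * M j \<beta>) * N \<beta> i)"
    by (simp only: sum_distrib_left sum_distrib_right mult.assoc) (rule sum.swap)
  also have "\<dots> = - (\<Sum>\<beta>\<in>K. \<Sum>j\<in>I. N \<alpha> j * D (M j \<beta>) * N \<beta> i)"
    by (simp add: * sum_distrib_right sum_negf)
  finally show ?thesis .
qed

text \<open>The 1-form \<open>tr (N dM)\<close> is the logarithmic differential of
  \<open>det M\<close>. Determinants are avoided, as rows and columns are indexed by different
  types: by \<open>dN = - N dM N\<close> its exterior derivative is minus the trace of the square of
  the matrix \<open>N dM\<close> of 1-forms, which vanishes by cyclicity.\<close>

lemma trace_gauge_closed:
  fixes M :: "'i \<Rightarrow> 'k \<Rightarrow> germ" and N :: "'k \<Rightarrow> 'i \<Rightarrow> germ"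
  assumes fin: "finite I" "finite K"
    and NM: "\<And>\<alpha> \<beta>. \<alpha> \<in> K \<Longrightarrow> \<beta> \<in> K \<Longrightarrow> (\<Sum>i\<in>I. N \<alpha> i * M i \<beta>) = (if \<alpha> = \<beta> then 1 else 0)"
    and MN: "\<And>i j. i \<in> I \<Longrightarrow> j \<in> I \<Longrightarrow> (\<Sum>\<alpha>\<in>K. M i \<alpha> * N \<alpha> j) = (if i = j then 1 else 0)"
  shows "ddx (\<Sum>\<alpha>\<in>K. \<Sum>i\<in>I. N \<alpha> i * ddy (M i \<alpha>)) = ddy (\<Sum>\<alpha>\<in>K. \<Sum>i\<in>I. N \<alpha> i * ddx (M i \<alpha>))"
proof -
  have dx: "ddx (N \<alpha> i) = - (\<Sum>\<beta>\<in>K. \<Sum>j\<in>I. N \<alpha> j * ddx (M j \<beta>) * N \<beta> i)"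
    if "\<alpha> \<in> K" "i \<in> I" for \<alpha> i
    by (rule deriv_inverse_matrix[OF fin NM MN _ _ that]) (simp_all add: ddx_mult)
  have dy: "ddy (N \<alpha> i) = - (\<Sum>\<beta>\<in>K. \<Sum>j\<in>I. N \<alpha> j * ddy (M j \<beta>) * N \<beta> i)"
    if "\<alpha> \<in> K" "i \<in> I" for \<alpha> i
    by (rule deriv_inverse_matrix[OF fin NM MN _ _ that]) (simp_all add: ddy_mult)
  let ?P = "K \<times> I"
  have "(\<Sum>\<alpha>\<in>K. \<Sum>i\<in>I. ddx (N \<alpha> i) * ddy (M i \<alpha>)) = (\<Sum>(\<alpha>, i)\<in>?P. ddx (N \<alpha> i) * ddy (M i \<alpha>))"
    by (simp add: sum.cartesian_product)
  also have "\<dots> = (\<Sum>(\<alpha>, i)\<in>?P. - (\<Sum>(\<beta>, j)\<in>?P. N \<alpha> j * ddx (M j \<beta>) * N \<beta> i * ddy (M i \<alpha>)))"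
    by (intro sum.cong refl) (auto simp: dx sum_distrib_right sum.cartesian_product[symmetric])
  also have "\<dots> = - (\<Sum>(\<alpha>, i)\<in>?P. \<Sum>(\<beta>, j)\<in>?P. N \<alpha> j * ddx (M j \<beta>) * N \<beta> i * ddy (M i \<alpha>))"
    by (simp add: case_prod_unfold sum_negf)
  also have "(\<Sum>(\<alpha>, i)\<in>?P. \<Sum>(\<beta>, j)\<in>?P. N \<alpha> j * ddx (M j \<beta>) * N \<beta> i * ddy (M i \<alpha>)) =
      (\<Sum>(\<beta>, j)\<in>?P. \<Sum>(\<alpha>, i)\<in>?P. N \<alpha> j * ddx (M j \<beta>) * N \<beta> i * ddy (M i \<alpha>))"
    unfolding case_prod_unfold by (rule sum.swap)
  also have "\<dots> = (\<Sum>(\<beta>, j)\<in>?P. \<Sum>(\<alpha>, i)\<in>?P. N \<beta> i * ddy (M i \<alpha>) * N \<alpha> j * ddx (M j \<beta>))"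
    by (simp add: mult_ac)
  also have "- \<dots> = (\<Sum>(\<alpha>, i)\<in>?P. - (\<Sum>(\<beta>, j)\<in>?P. N \<alpha> j * ddy (M j \<beta>) * N \<beta> i * ddx (M i \<alpha>)))"
    by (simp add: case_prod_unfold sum_negf)
  also have "\<dots> = (\<Sum>(\<alpha>, i)\<in>?P. ddy (N \<alpha> i) * ddx (M i \<alpha>))"
    by (intro sum.cong refl) (auto simp: dy sum_distrib_right sum.cartesian_product[symmetric])
  also have "\<dots> = (\<Sum>\<alpha>\<in>K. \<Sum>i\<in>I. ddy (N \<alpha> i) * ddx (M i \<alpha>))"
    by (simp add: sum.cartesian_product)
  finally show ?thesis
    by (simp add: ddx_mult ddy_mult sum.distrib ddx_ddy)
qed

text \<open>
  The columns of \<open>M\<close> form a new basis and \<open>N\<close> is the inverse of \<open>M\<close>; the matrix of \<open>d + \<theta>\<close> in the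
  new basis is \<open>N dM + N \<theta> M\<close>.
\<close>

lemma d1_trace_change_of_basis:
  fixes M :: "'i \<Rightarrow> 'k \<Rightarrow> germ" and N :: "'k \<Rightarrow> 'i \<Rightarrow> germ"
  assumes fin: "finite I" "finite K"
    and NM: "\<And>\<alpha> \<beta>. \<alpha> \<in> K \<Longrightarrow> \<beta> \<in> K \<Longrightarrow> (\<Sum>i\<in>I. N \<alpha> i * M i \<beta>) = (if \<alpha> = \<beta> then 1 else 0)"
    and MN: "\<And>i j. i \<in> I \<Longrightarrow> j \<in> I \<Longrightarrow> (\<Sum>\<alpha>\<in>K. M i \<alpha> * N \<alpha> j) = (if i = j then 1 else 0)"
  shows "d1 (\<Sum>\<alpha>\<in>K. \<Sum>i\<in>I. N \<alpha> i * (ddx (M i \<alpha>) + (\<Sum>j\<in>I. \<theta>x i j * M j \<alpha>)),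
             \<Sum>\<alpha>\<in>K. \<Sum>i\<in>I. N \<alpha> i * (ddy (M i \<alpha>) + (\<Sum>j\<in>I. \<theta>y i j * M j \<alpha>))) =
         d1 (\<Sum>i\<in>I. \<theta>x i i, \<Sum>i\<in>I. \<theta>y i i)"
proof -
  have tr: "(\<Sum>\<alpha>\<in>K. \<Sum>i\<in>I. N \<alpha> i * (\<Sum>j\<in>I. \<theta> i j * M j \<alpha>)) = (\<Sum>i\<in>I. \<theta> i i)" for \<theta>
  proof -
    have "(\<Sum>\<alpha>\<in>K. \<Sum>i\<in>I. N \<alpha> i * (\<Sum>j\<in>I. \<theta> i j * M j \<alpha>)) =
        (\<Sum>i\<in>I. \<Sum>\<alpha>\<in>K. \<Sum>j\<in>I. \<theta> i j * (M j \<alpha> * N \<alpha> i))"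
      by (subst sum.swap) (simp add: sum_distrib_left mult_ac)
    also have "\<dots> = (\<Sum>i\<in>I. \<Sum>j\<in>I. \<theta> i j * (\<Sum>\<alpha>\<in>K. M j \<alpha> * N \<alpha> i))"
      by (subst sum.swap) (simp add: sum_distrib_left)
    also have "\<dots> = (\<Sum>i\<in>I. \<Sum>j\<in>I. if j = i then \<theta> i i else 0)"
      by (intro sum.cong refl) (simp add: MN)
    also have "\<dots> = (\<Sum>i\<in>I. \<theta> i i)" using fin by simp
    finally show ?thesis .
  qed
  show ?thesis
    using trace_gauge_closed[OF fin NM MN]
    by (simp add: d1_def distrib_left sum.distrib tr del: ddx_sum ddy_sum)
qed

section \<open>Prolongation of the differential system\<close>

definition prolonged_eq :: "germ poly \<Rightarrow> nat \<Rightarrow> nat \<Rightarrow> nat \<Rightarrow> lin_expr" where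
  "prolonged_eq F s t m = (formal_ddx ^^ s) ((formal_ddy ^^ t) (equation F m))"

lemma formal_ddx_ddy: "formal_ddy (formal_ddx c) = formal_ddx (formal_ddy c)"
  by (simp add: fun_eq_iff formal_ddx_def formal_ddy_def ddx_ddy add_ac)

lemma formal_ddx_prolonged_eq: "formal_ddx (prolonged_eq F s t m) = prolonged_eq F (Suc s) t m"
  by (simp add: prolonged_eq_def)

lemma formal_ddy_prolonged_eq: "formal_ddy (prolonged_eq F s t m) = prolonged_eq F s (Suc t) m"
proof -
  have "formal_ddy ((formal_ddx ^^ s) c) = (formal_ddx ^^ s) (formal_ddy c)" for c
    by (induction s) (simp_all add: formal_ddx_ddy)
  then show ?thesis by (simp add: prolonged_eq_def)
qed

text \<open>The principal coefficients are the constants 0 and 1. A further formal derivative only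
  shifts them and adds nothing in the order below, where the zeroth order coefficient therefore
  survives undifferentiated. Each order of the derived equation draws on the next higher order of
  the old one, so the three claims share one induction.\<close>

lemma prolonged_eq_structure:
  "(\<forall>a b l. s + t + 1 < a + b \<longrightarrow> prolonged_eq F s t m a b l = 0) \<and>
   (\<forall>a b l. a + b = s + t + 1 \<longrightarrow> prolonged_eq F s t m a b l =
      (if a = Suc s \<and> l + m = degree F then 1 else if a = s \<and> l + m = degree F + 1 then 1 else 0)) \<and>
   (\<forall>a b l. a + b = s + t \<longrightarrow> prolonged_eq F s t m a b l = (if a = s then equation F m 0 0 l else 0))"
  (is "?P s t")
proof -
  have 0: "?P 0 0"
    by (auto simp: prolonged_eq_def equation_def)
  have t: "?P 0 t" for t
  proof (induction t)
    case (Suc t)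
    then show ?case unfolding formal_ddy_prolonged_eq[symmetric]
      by (auto simp: formal_ddy_def)
  qed (rule 0)
  show ?thesis
  proof (induction s)
    case (Suc s)
    then show ?case unfolding formal_ddx_prolonged_eq[symmetric]
      by (auto simp: formal_ddx_def)
  qed (rule t)
qed

lemma prolonged_eq_zero: "s + t + 1 < a + b \<Longrightarrow> prolonged_eq F s t m a b l = 0"
  using prolonged_eq_structure[of s t F m] by blast

lemma prolonged_eq_principal:
  "a + b = s + t + 1 \<Longrightarrow> prolonged_eq F s t m a b l =
      (if a = Suc s \<and> l + m = degree F then 1 else if a = s \<and> l + m = degree F + 1 then 1 else 0)"
  using prolonged_eq_structure[of s t F m] by blast

lemma prolonged_eq_subprincipal:
  "a + b = s + t \<Longrightarrow> prolonged_eq F s t m a b l = (if a = s then equation F m 0 0 l else 0)"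
  using prolonged_eq_structure[of s t F m] by blast

subsection \<open>Jets\<close>

lemma jetsD: "f \<in> jets F n \<Longrightarrow> n < a + b \<or> l \<notin> {3..degree F} \<Longrightarrow> f a b l = 0"
  unfolding jets_def mem_Collect_eq using linorder_not_le by blast

lemma finite_order_le: "finite {(a, b). a + b \<le> (n::nat)}"
  by (rule finite_subset[of _ "{..n} \<times> {..n}"]) auto

lemma apply_expr_add: "apply_expr F n c (f + g) = apply_expr F n c f + apply_expr F n c g"
  by (simp add: apply_expr_def case_prod_unfold distrib_left sum.distrib)

lemma apply_expr_scale: "apply_expr F n c (scale_jet r f) = r * apply_expr F n c f"
  by (simp add: apply_expr_def case_prod_unfold scale_jet_def sum_distrib_left mult_ac)

lemma apply_expr_0 [simp]: "apply_expr F n c 0 = 0"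
  by (simp add: apply_expr_def)

lemma apply_expr_cong:
  assumes "\<And>a b l. a + b \<le> n \<Longrightarrow> l \<in> {3..degree F} \<Longrightarrow> f a b l = g a b l"
  shows "apply_expr F n c f = apply_expr F n c g"
  unfolding apply_expr_def by (intro sum.cong refl) (use assms in auto)

lemma apply_expr_order:
  assumes "n \<le> n'" "\<And>a b l. n < a + b \<Longrightarrow> a + b \<le> n' \<Longrightarrow> l \<in> {3..degree F} \<Longrightarrow> c a b l * f a b l = 0"
  shows "apply_expr F n' c f = apply_expr F n c f"
  unfolding apply_expr_def
  by (rule sum.mono_neutral_right[OF finite_order_le]) (use assms in \<open>auto intro!: sum.neutral\<close>, metis linorder_not_le)

lemma apply_expr_Suc:
  "apply_expr F (Suc n) c f = apply_expr F n c f +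
     (\<Sum>(a, b) | a + b = Suc n. \<Sum>l = 3..degree F. c a b l * f a b l)"
proof -
  have "{(a, b). a + b \<le> Suc n} = {(a, b). a + b \<le> n} \<union> {(a, b). a + b = Suc n}" by auto
  moreover have "finite {(a, b). a + b = Suc n}"
    by (rule finite_subset[OF _ finite_order_le[of "Suc n"]]) auto
  ultimately show ?thesis unfolding apply_expr_def
    by (subst sum.union_disjoint[symmetric]) (auto simp: finite_order_le)
qed

lemma sum_order_eq: "(\<Sum>(a, b) | a + b = (k::nat). h a b) = (\<Sum>a\<le>k. h a (k - a))"
  by (rule sum.reindex_bij_witness[of _ "\<lambda>a. (a, k - a)" fst]) auto

lemma apply_prolonged_eq_order:
  "s + t < n \<Longrightarrow> apply_expr F n (prolonged_eq F s t m) f = apply_expr F (Suc (s + t)) (prolonged_eq F s t m) f"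
  by (rule apply_expr_order) (auto simp: prolonged_eq_zero)

text \<open>The equations \<open>m = 0\<close> and \<open>m = d - 2\<close> have one principal term
  only. They need no separate treatment, since a jet vanishes at the indices \<open>d + 1\<close>
  and \<open>2\<close>.\<close>

lemma apply_prolonged_eq:
  assumes f: "f \<in> jets F n" and st: "s + t < n" and m: "m \<le> degree F - 2" and d: "degree F \<ge> 3"
  shows "apply_expr F n (prolonged_eq F s t m) f =
     f (Suc s) t (degree F - m) + f s (Suc t) (degree F + 1 - m) + apply_expr F (s + t) (prolonged_eq F s t m) f"
proof -
  let ?k = "Suc (s + t)" and ?d = "degree F"
  have ind: "(\<Sum>l = 3..?d. (if l + m = e then 1 else 0) * f a b l) = f a b (e - m)"
    if "e \<ge> ?d" for a b e
  proof -
    have *: "l + m = e \<longleftrightarrow> l = e - m" for l using that m d by auto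
    show ?thesis
    proof (cases "e - m \<in> {3..?d}")
      case True
      then show ?thesis unfolding * by (simp add: if_distrib[of "\<lambda>x. x * _"] cong: if_cong)
    next
      case False
      then show ?thesis unfolding * using jetsD[OF f, of a b "e - m"] by (auto intro!: sum.neutral)
    qed
  qed
  have "(\<Sum>(a, b) | a + b = ?k. \<Sum>l = 3..?d. prolonged_eq F s t m a b l * f a b l) =
      (\<Sum>a\<le>?k. \<Sum>l = 3..?d. prolonged_eq F s t m a (?k - a) l * f a (?k - a) l)"
    by (rule sum_order_eq)
  also have "\<dots> = (\<Sum>a\<le>?k. (if a = Suc s then f (Suc s) t (?d - m) else 0) +
      (if a = s then f s (Suc t) (?d + 1 - m) else 0))"
  proof (intro sum.cong refl)
    fix a assume "a \<in> {..?k}"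
    then have a: "a + (?k - a) = s + t + 1" by auto
    show "(\<Sum>l = 3..?d. prolonged_eq F s t m a (?k - a) l * f a (?k - a) l) =
       (if a = Suc s then f (Suc s) t (?d - m) else 0) + (if a = s then f s (Suc t) (?d + 1 - m) else 0)"
    proof -
      consider "a = Suc s" | "a = s" | "a \<noteq> Suc s" "a \<noteq> s" by blast
      then show ?thesis
      proof cases
        case 1
        then show ?thesis using ind[of ?d "Suc s" t] by (simp add: prolonged_eq_principal[of "Suc s" t s t] cong: if_cong)
      next
        case 2
        then show ?thesis using ind[of "?d + 1" s "Suc t"]
          by (simp add: prolonged_eq_principal[of s "Suc t" s t] Suc_diff_le)
      qed (simp add: prolonged_eq_principal[OF a])
    qed
  qed
  also have "\<dots> = f (Suc s) t (?d - m) + f s (Suc t) (?d + 1 - m)"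
    by (simp add: sum.distrib)
  finally show ?thesis
    by (simp add: apply_prolonged_eq_order[OF st] apply_expr_Suc)
qed

lemma apply_prolonged_eq_subprincipal:
  assumes "\<And>a b l. a + b < s + t \<Longrightarrow> f a b l = 0"
  shows "apply_expr F (s + t) (prolonged_eq F s t m) f = (\<Sum>l = 3..degree F. equation F m 0 0 l * f s t l)"
proof -
  have "apply_expr F (s + t) (prolonged_eq F s t m) f =
      (\<Sum>(a, b) | a + b = s + t. \<Sum>l = 3..degree F. prolonged_eq F s t m a b l * f a b l)"
    unfolding apply_expr_def
    by (rule sum.mono_neutral_right[OF finite_order_le]) (use assms in \<open>auto intro!: sum.neutral\<close>, metis le_neq_implies_less)
  also have "\<dots> = (\<Sum>a\<le>s + t. \<Sum>l = 3..degree F. prolonged_eq F s t m a (s + t - a) l * f a (s + t - a) l)"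
    by (rule sum_order_eq)
  also have "\<dots> = (\<Sum>a\<le>s + t. if a = s then \<Sum>l = 3..degree F. equation F m 0 0 l * f s t l else 0)"
    by (intro sum.cong refl) (auto simp: prolonged_eq_subprincipal)
  finally show ?thesis by simp
qed

text \<open>A product rule: \<open>formal_ddx\<close> replaces the derivative of a jet entry by the
  next entry, and the Spencer operator collects exactly the error of this replacement.\<close>

lemma ddx_apply_expr:
  assumes c: "\<And>a b l. n < a + b \<Longrightarrow> c a b l = 0"
  shows "ddx (apply_expr F n c f) = apply_expr F n c (spencer_x n f) + apply_expr F (Suc n) (formal_ddx c) f"
proof -
  let ?S = "\<lambda>n. {(a, b). a + b \<le> (n::nat)}" and ?L = "{3..degree F}"
  have 1: "ddx (apply_expr F n c f) = (\<Sum>(a, b)\<in>?S n. \<Sum>l\<in>?L. ddx (c a b l) * f a b l) +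
      (\<Sum>(a, b)\<in>?S n. \<Sum>l\<in>?L. c a b l * ddx (f a b l))"
    by (simp add: apply_expr_def case_prod_unfold ddx_mult sum.distrib)
  have 2: "(\<Sum>(a, b)\<in>?S n. \<Sum>l\<in>?L. c a b l * ddx (f a b l)) =
      apply_expr F n c (spencer_x n f) + (\<Sum>(a, b)\<in>?S n. \<Sum>l\<in>?L. c a b l * f (Suc a) b l)"
    unfolding apply_expr_def sum.distrib[symmetric]
    by (intro sum.cong refl) (auto simp: spencer_x_def sum.distrib[symmetric] algebra_simps intro!: sum.cong)
  have 3: "(\<Sum>(a, b)\<in>?S (Suc n). \<Sum>l\<in>?L. ddx (c a b l) * f a b l) = (\<Sum>(a, b)\<in>?S n. \<Sum>l\<in>?L. ddx (c a b l) * f a b l)"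
    by (rule sum.mono_neutral_right[OF finite_order_le]) (auto intro!: sum.neutral simp: c, metis c ddx_0 linorder_not_le)
  have 4: "(\<Sum>(a, b)\<in>?S (Suc n). \<Sum>l\<in>?L. (if a = 0 then 0 else c (a - 1) b l) * f a b l) =
      (\<Sum>(a, b)\<in>?S n. \<Sum>l\<in>?L. c a b l * f (Suc a) b l)"
  proof -
    have "(\<Sum>(a, b)\<in>?S (Suc n). \<Sum>l\<in>?L. (if a = 0 then 0 else c (a - 1) b l) * f a b l) =
       (\<Sum>(a, b)\<in>(\<lambda>(a, b). (Suc a, b)) ` ?S n. \<Sum>l\<in>?L. (if a = 0 then 0 else c (a - 1) b l) * f a b l)"
    proof (rule sum.mono_neutral_right[OF finite_order_le])
      show "\<forall>x\<in>?S (Suc n) - (\<lambda>(a, b). (Suc a, b)) ` ?S n.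
        (case x of (a, b) \<Rightarrow> \<Sum>l\<in>?L. (if a = 0 then 0 else c (a - 1) b l) * f a b l) = 0"
      proof
        fix x assume "x \<in> ?S (Suc n) - (\<lambda>(a, b). (Suc a, b)) ` ?S n"
        moreover obtain a b where x: "x = (a, b)" by force
        ultimately have "a = 0"
          by (cases a) (auto simp: image_iff)
        then show "(case x of (a, b) \<Rightarrow> \<Sum>l\<in>?L. (if a = 0 then 0 else c (a - 1) b l) * f a b l) = 0"
          by (simp add: x)
      qed
    qed auto
    also have "\<dots> = (\<Sum>(a, b)\<in>?S n. \<Sum>l\<in>?L. c a b l * f (Suc a) b l)"
      by (subst sum.reindex) (auto simp: inj_on_def case_prod_unfold)
    finally show ?thesis .
  qed
  have 5: "apply_expr F (Suc n) (formal_ddx c) f =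
      (\<Sum>(a, b)\<in>?S (Suc n). \<Sum>l\<in>?L. ddx (c a b l) * f a b l) +
      (\<Sum>(a, b)\<in>?S (Suc n). \<Sum>l\<in>?L. (if a = 0 then 0 else c (a - 1) b l) * f a b l)"
    by (simp only: apply_expr_def formal_ddx_def case_prod_unfold distrib_right sum.distrib)
  show ?thesis unfolding 1 2 5 3 4 by simp
qed

lemma ddy_apply_expr:
  assumes c: "\<And>a b l. n < a + b \<Longrightarrow> c a b l = 0"
  shows "ddy (apply_expr F n c f) = apply_expr F n c (spencer_y n f) + apply_expr F (Suc n) (formal_ddy c) f"
proof -
  let ?S = "\<lambda>n. {(a, b). a + b \<le> (n::nat)}" and ?L = "{3..degree F}"
  have 1: "ddy (apply_expr F n c f) = (\<Sum>(a, b)\<in>?S n. \<Sum>l\<in>?L. ddy (c a b l) * f a b l) +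
      (\<Sum>(a, b)\<in>?S n. \<Sum>l\<in>?L. c a b l * ddy (f a b l))"
    by (simp add: apply_expr_def case_prod_unfold ddy_mult sum.distrib)
  have 2: "(\<Sum>(a, b)\<in>?S n. \<Sum>l\<in>?L. c a b l * ddy (f a b l)) =
      apply_expr F n c (spencer_y n f) + (\<Sum>(a, b)\<in>?S n. \<Sum>l\<in>?L. c a b l * f a (Suc b) l)"
    unfolding apply_expr_def sum.distrib[symmetric]
    by (intro sum.cong refl) (auto simp: spencer_y_def sum.distrib[symmetric] algebra_simps intro!: sum.cong)
  have 3: "(\<Sum>(a, b)\<in>?S (Suc n). \<Sum>l\<in>?L. ddy (c a b l) * f a b l) = (\<Sum>(a, b)\<in>?S n. \<Sum>l\<in>?L. ddy (c a b l) * f a b l)"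
    by (rule sum.mono_neutral_right[OF finite_order_le]) (auto intro!: sum.neutral simp: c, metis c ddy_0 linorder_not_le)
  have 4: "(\<Sum>(a, b)\<in>?S (Suc n). \<Sum>l\<in>?L. (if b = 0 then 0 else c a (b - 1) l) * f a b l) =
      (\<Sum>(a, b)\<in>?S n. \<Sum>l\<in>?L. c a b l * f a (Suc b) l)"
  proof -
    have "(\<Sum>(a, b)\<in>?S (Suc n). \<Sum>l\<in>?L. (if b = 0 then 0 else c a (b - 1) l) * f a b l) =
       (\<Sum>(a, b)\<in>(\<lambda>(a, b). (a, Suc b)) ` ?S n. \<Sum>l\<in>?L. (if b = 0 then 0 else c a (b - 1) l) * f a b l)"
    proof (rule sum.mono_neutral_right[OF finite_order_le])
      show "\<forall>x\<in>?S (Suc n) - (\<lambda>(a, b). (a, Suc b)) ` ?S n.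
        (case x of (a, b) \<Rightarrow> \<Sum>l\<in>?L. (if b = 0 then 0 else c a (b - 1) l) * f a b l) = 0"
      proof
        fix x assume "x \<in> ?S (Suc n) - (\<lambda>(a, b). (a, Suc b)) ` ?S n"
        moreover obtain a b where x: "x = (a, b)" by force
        ultimately have "b = 0"
          by (cases b) (auto simp: image_iff)
        then show "(case x of (a, b) \<Rightarrow> \<Sum>l\<in>?L. (if b = 0 then 0 else c a (b - 1) l) * f a b l) = 0"
          by (simp add: x)
      qed
    qed auto
    also have "\<dots> = (\<Sum>(a, b)\<in>?S n. \<Sum>l\<in>?L. c a b l * f a (Suc b) l)"
      by (subst sum.reindex) (auto simp: inj_on_def case_prod_unfold)
    finally show ?thesis .
  qed
  have 5: "apply_expr F (Suc n) (formal_ddy c) f =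
      (\<Sum>(a, b)\<in>?S (Suc n). \<Sum>l\<in>?L. ddy (c a b l) * f a b l) +
      (\<Sum>(a, b)\<in>?S (Suc n). \<Sum>l\<in>?L. (if b = 0 then 0 else c a (b - 1) l) * f a b l)"
    by (simp only: apply_expr_def formal_ddy_def case_prod_unfold distrib_right sum.distrib)
  show ?thesis unfolding 1 2 5 3 4 by simp
qed

subsection \<open>Solving for the jets\<close>

text \<open>
  In order \<open>k\<close>, with \<open>x a l\<close> in the role of \<open>f a (k - a) l\<close>, the principal parts are
  \<open>x (s + 1) l + x s (l + 1)\<close>. They only link entries with the same value of \<open>a + l\<close>: the system splits
  into chains, each of which is solved by recursion from the end where it leaves the range
  \<open>3 \<le> l \<le> d\<close>. The chains with \<open>k + 3 \<le> a + l \<le> d\<close> have no such end and carry one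
  free parameter, their entry at \<open>a = 0\<close>.
\<close>

lemma chain_upper_zero:
  fixes x :: "nat \<Rightarrow> nat \<Rightarrow> germ"
  assumes range: "\<And>a l. l \<notin> {3..d} \<Longrightarrow> x a l = 0"
    and eq: "\<And>s l. s < k \<Longrightarrow> s < n \<Longrightarrow> 2 \<le> l \<Longrightarrow> l \<le> d \<Longrightarrow> x (Suc s) l + x s (Suc l) = 0"
    and free: "\<And>l. k + 3 \<le> l \<Longrightarrow> l \<le> d \<Longrightarrow> x 0 l = 0"
  shows "a \<le> k \<Longrightarrow> a \<le> n \<Longrightarrow> k + 3 \<le> a + l \<Longrightarrow> x a l = 0"
proof (induction a arbitrary: l)
  case 0
  then show ?case using free[of l] range[of l 0] by (cases "l \<le> d") auto
next
  case (Suc a)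
  show ?case
  proof (cases "l \<in> {3..d}")
    case True
    then have "x (Suc a) l + x a (Suc l) = 0" using Suc.prems by (intro eq) auto
    moreover have "x a (Suc l) = 0" using Suc.prems by (intro Suc.IH) auto
    ultimately show ?thesis by simp
  qed (simp add: range)
qed

text \<open>Recursion towards the end \<open>l = 2\<close>, which is reached before \<open>a\<close>
  exceeds \<open>k\<close> because \<open>a + l \<le> k + 2\<close>. Only the rows from
  \<open>n\<close> on have to be homogeneous; this serves \<open>lift_unit_jet\<close>, where a
  single inhomogeneous row cuts the chain in two.\<close>

lemma chain_lower_zero:
  fixes x :: "nat \<Rightarrow> nat \<Rightarrow> germ"
  assumes range: "\<And>a l. l \<notin> {3..d} \<Longrightarrow> x a l = 0"
    and eq: "\<And>s l. n \<le> s \<Longrightarrow> s < k \<Longrightarrow> 2 \<le> l \<Longrightarrow> l \<le> d \<Longrightarrow> x (Suc s) l + x s (Suc l) = 0"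
  shows "n \<le> a \<Longrightarrow> a \<le> k \<Longrightarrow> a + l \<le> k + 2 \<Longrightarrow> x a l = 0"
proof (induction l arbitrary: a)
  case 0
  then show ?case by (simp add: range)
next
  case (Suc l)
  show ?case
  proof (cases "Suc l \<in> {3..d}")
    case True
    then have "x (Suc a) l + x a (Suc l) = 0" using Suc.prems by (intro eq) auto
    moreover have "x (Suc a) l = 0" using Suc.prems True by (intro Suc.IH) auto
    ultimately show ?thesis by simp
  qed (simp add: range)
qed

lemma chain_unique:
  fixes x :: "nat \<Rightarrow> nat \<Rightarrow> germ"
  assumes "\<And>a l. l \<notin> {3..d} \<Longrightarrow> x a l = 0"
    and "\<And>s l. s < k \<Longrightarrow> 2 \<le> l \<Longrightarrow> l \<le> d \<Longrightarrow> x (Suc s) l + x s (Suc l) = 0"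
    and "\<And>l. k + 3 \<le> l \<Longrightarrow> l \<le> d \<Longrightarrow> x 0 l = 0"
    and "a \<le> k"
  shows "x a l = 0"
  using chain_upper_zero[of d x k k a l] chain_lower_zero[of d x 0 k a l] assms
  by (cases "k + 3 \<le> a + l") auto

text \<open>Here \<open>\<rho>\<close> holds the right-hand sides. \<open>upper_chain\<close>
  recurses towards \<open>a = 0\<close>, where \<open>\<phi>\<close> is prescribed, or leaves the
  range at \<open>l = d + 1\<close>; \<open>lower_chain\<close> recurses towards
  \<open>l = 2\<close>, so its argument \<open>l\<close> comes first.\<close>

fun upper_chain :: "nat \<Rightarrow> (nat \<Rightarrow> germ) \<Rightarrow> (nat \<Rightarrow> nat \<Rightarrow> germ) \<Rightarrow> nat \<Rightarrow> nat \<Rightarrow> germ" where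
  "upper_chain d \<phi> \<rho> 0 l = (if l \<in> {3..d} then \<phi> l else 0)"
| "upper_chain d \<phi> \<rho> (Suc a) l = (if l \<in> {3..d} then \<rho> a l - upper_chain d \<phi> \<rho> a (Suc l) else 0)"

fun lower_chain :: "nat \<Rightarrow> (nat \<Rightarrow> nat \<Rightarrow> germ) \<Rightarrow> nat \<Rightarrow> nat \<Rightarrow> germ" where
  "lower_chain d \<rho> 0 a = 0"
| "lower_chain d \<rho> (Suc l) a = (if Suc l \<in> {3..d} then \<rho> a l - lower_chain d \<rho> l (Suc a) else 0)"

text \<open>A chain that leaves the range at both ends would be overdetermined. It would have
  \<open>d + 1 \<le> a + l \<le> k + 2\<close>, which is excluded by
  \<open>k + 2 \<le> d\<close>.\<close>

lemma chain_exists: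
  fixes \<rho> :: "nat \<Rightarrow> nat \<Rightarrow> germ"
  assumes k: "k + 2 \<le> d"
  obtains x :: "nat \<Rightarrow> nat \<Rightarrow> germ" where
    "\<And>a l. l \<notin> {3..d} \<Longrightarrow> x a l = 0"
    "\<And>s l. s < k \<Longrightarrow> 2 \<le> l \<Longrightarrow> l \<le> d \<Longrightarrow> x (Suc s) l + x s (Suc l) = \<rho> s l"
    "\<And>l. k + 3 \<le> l \<Longrightarrow> l \<le> d \<Longrightarrow> x 0 l = \<phi> l"
proof -
  define x where "x a l = (if k + 3 \<le> a + l then upper_chain d \<phi> \<rho> a l else lower_chain d \<rho> l a)" for a l
  have u: "upper_chain d \<phi> \<rho> a l = 0" if "l \<notin> {3..d}" for a l
    using that by (cases a) auto
  have v: "lower_chain d \<rho> l a = 0" if "l \<notin> {3..d}" for a l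
    using that by (cases l) auto
  show ?thesis
  proof (rule that[of x])
    show "x a l = 0" if "l \<notin> {3..d}" for a l using that by (simp add: x_def u v)
    show "x (Suc s) l + x s (Suc l) = \<rho> s l" if "s < k" "2 \<le> l" "l \<le> d" for s l
      using that k by (auto simp: x_def)
    show "x 0 l = \<phi> l" if "k + 3 \<le> l" "l \<le> d" for l using that by (simp add: x_def)
  qed
qed

text \<open>Induction on the order: when the lower orders vanish, an equation reduces to its
  principal part, and \<open>chain_unique\<close> applies.\<close>

lemma jet_eq_0I:
  assumes d: "degree F \<ge> 3" and f: "f \<in> jets F n"
    and eqs: "\<And>s t m. s + t < n \<Longrightarrow> m \<le> degree F - 2 \<Longrightarrow> apply_expr F n (prolonged_eq F s t m) f = 0"
    and free: "\<And>k l. k \<le> n \<Longrightarrow> k + 3 \<le> l \<Longrightarrow> l \<le> degree F \<Longrightarrow> f 0 k l = 0"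
  shows "f = 0"
proof -
  have "f a b l = 0" for a b l
  proof (induction "a + b" arbitrary: a b l rule: less_induct)
    case less
    show ?case
    proof (cases "a + b \<le> n")
      case True
      define k where "k = a + b"
      define x where "x a l = f a (k - a) l" for a l
      have "x a l = 0"
      proof (rule chain_unique[of "degree F" x k])
        show "x a l = 0" if "l \<notin> {3..degree F}" for a l
          using jetsD[OF f] that by (simp add: x_def)
        show "x 0 l = 0" if "k + 3 \<le> l" "l \<le> degree F" for l
          using free[of k l] that True by (simp add: x_def k_def)
        show "a \<le> k" by (simp add: k_def)
        fix s l assume s: "s < k" "2 \<le> l" "l \<le> degree F"
        define t where "t = k - Suc s"
        have t: "s + t < n" "k - Suc s = t" "k - s = Suc t" "Suc (s + t) = k"
          using s True by (auto simp: t_def k_def)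
        have "apply_expr F (s + t) (prolonged_eq F s t (degree F - l)) f = apply_expr F (s + t) (prolonged_eq F s t (degree F - l)) 0"
          using t by (intro apply_expr_cong) (auto simp: less k_def)
        then show "x (Suc s) l + x s (Suc l) = 0"
          using apply_prolonged_eq[OF f t(1), of "degree F - l"] eqs[OF t(1), of "degree F - l"] s d
          by (simp add: x_def t Suc_diff_le)
      qed
      then show ?thesis by (simp add: x_def k_def)
    qed (use jetsD[OF f, of a b l] in auto)
  qed
  then show ?thesis by (simp add: fun_eq_iff)
qed

text \<open>Together with \<open>jet_eqI\<close> this shows that the values \<open>\<psi>\<close> of
  the equations and the free entries \<open>\<phi>\<close> are coordinates on the jets of order
  \<open>n\<close>. In order \<open>d - 2\<close> there is no free entry left.\<close>

lemma jet_exists: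
  assumes d: "degree F \<ge> 3" and n: "n \<le> degree F - 2"
  shows "\<exists>f \<in> jets F n.
    (\<forall>s t m. s + t < n \<longrightarrow> m \<le> degree F - 2 \<longrightarrow> apply_expr F n (prolonged_eq F s t m) f = \<psi> s t m) \<and>
    (\<forall>k l. k \<le> n \<longrightarrow> k + 3 \<le> l \<longrightarrow> l \<le> degree F \<longrightarrow> f 0 k l = \<phi> k l)"
  using n
proof (induction n)
  case 0
  have "(\<lambda>a b l. if a = 0 \<and> b = 0 \<and> l \<in> {3..degree F} then \<phi> 0 l else 0) \<in> jets F 0"
    by (auto simp: jets_def)
  then show ?case by (rule bexI[rotated]) auto
next
  case (Suc n)
  then obtain f where f: "f \<in> jets F n"
    and eqs: "\<And>s t m. s + t < n \<Longrightarrow> m \<le> degree F - 2 \<Longrightarrow> apply_expr F n (prolonged_eq F s t m) f = \<psi> s t m"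
    and free: "\<And>k l. k \<le> n \<Longrightarrow> k + 3 \<le> l \<Longrightarrow> l \<le> degree F \<Longrightarrow> f 0 k l = \<phi> k l" by auto
  let ?d = "degree F" and ?k = "Suc n"
  \<comment> \<open>The part of the prescribed value that the lower orders, already fixed, leave for
    the principal part.\<close>
  define \<rho> where "\<rho> s l = \<psi> s (n - s) (?d - l) - apply_expr F n (prolonged_eq F s (n - s) (?d - l)) f" for s l
  obtain x :: "nat \<Rightarrow> nat \<Rightarrow> germ" where
    x: "\<And>a l. l \<notin> {3..?d} \<Longrightarrow> x a l = 0"
    "\<And>s l. s < ?k \<Longrightarrow> 2 \<le> l \<Longrightarrow> l \<le> ?d \<Longrightarrow> x (Suc s) l + x s (Suc l) = \<rho> s l"
    "\<And>l. ?k + 3 \<le> l \<Longrightarrow> l \<le> ?d \<Longrightarrow> x 0 l = \<phi> ?k l"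
  proof -
    have "?k + 2 \<le> ?d" using Suc.prems d by simp
    then show thesis using that by (rule chain_exists[of ?k ?d \<rho> "\<phi> ?k"])
  qed
  define g where "g a b l = (if a + b = ?k then x a l else f a b l)" for a b l
  have g: "g \<in> jets F ?k"
    using f x(1) by (fastforce simp: jets_def g_def)
  have low: "apply_expr F j c g = apply_expr F j c f" if "j \<le> n" for j c
    using that by (intro apply_expr_cong) (auto simp: g_def)
  have "apply_expr F ?k (prolonged_eq F s t m) g = \<psi> s t m" if st: "s + t < ?k" and m: "m \<le> ?d - 2" for s t m
  proof (cases "s + t < n")
    case True
    then show ?thesis
      using eqs[OF True m] low[of "Suc (s + t)"]
      by (simp add: apply_prolonged_eq_order[OF st] apply_prolonged_eq_order[OF True])
  next
    case False
    then have t: "s + t = n" "t = n - s" using st by auto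
    have l: "?d - (?d - m) = m" "Suc (?d - m) = Suc ?d - m" "2 \<le> ?d - m" using m d by auto
    have "x (Suc s) (?d - m) + x s (Suc (?d - m)) = \<rho> s (?d - m)"
      using st l by (intro x(2)) auto
    then show ?thesis
      using low[of n] by (simp add: apply_prolonged_eq[OF g st m d] t(1) g_def \<rho>_def l flip: t(2))
  qed
  moreover have "g 0 k l = \<phi> k l" if "k \<le> ?k" "k + 3 \<le> l" "l \<le> ?d" for k l
    using that x(3) free by (auto simp: g_def le_Suc_eq)
  ultimately show ?case using g by blast
qed

text \<open>The jet with coordinates \<open>\<phi>\<close> and \<open>\<psi>\<close>. Only
  \<open>\<phi> k l\<close> with \<open>k + 3 \<le> l \<le> d\<close> and
  \<open>\<psi> s t m\<close> with \<open>s + t < n\<close> and \<open>m \<le> d - 2\<close>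
  matter.\<close>

definition solved_jet :: "germ poly \<Rightarrow> nat \<Rightarrow> (nat \<Rightarrow> nat \<Rightarrow> germ) \<Rightarrow> (nat \<Rightarrow> nat \<Rightarrow> nat \<Rightarrow> germ) \<Rightarrow> jet" where
  "solved_jet F n \<phi> \<psi> = (SOME f. f \<in> jets F n \<and>
    (\<forall>s t m. s + t < n \<longrightarrow> m \<le> degree F - 2 \<longrightarrow> apply_expr F n (prolonged_eq F s t m) f = \<psi> s t m) \<and>
    (\<forall>k l. k \<le> n \<longrightarrow> k + 3 \<le> l \<longrightarrow> l \<le> degree F \<longrightarrow> f 0 k l = \<phi> k l))"

lemma solved_jet:
  assumes "degree F \<ge> 3" "n \<le> degree F - 2"
  shows "solved_jet F n \<phi> \<psi> \<in> jets F n"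
    and "s + t < n \<Longrightarrow> m \<le> degree F - 2 \<Longrightarrow>
      apply_expr F n (prolonged_eq F s t m) (solved_jet F n \<phi> \<psi>) = \<psi> s t m"
    and "k \<le> n \<Longrightarrow> k + 3 \<le> l \<Longrightarrow> l \<le> degree F \<Longrightarrow> solved_jet F n \<phi> \<psi> 0 k l = \<phi> k l"
proof -
  from jet_exists[OF assms, of \<psi> \<phi>] obtain f where "f \<in> jets F n \<and>
    (\<forall>s t m. s + t < n \<longrightarrow> m \<le> degree F - 2 \<longrightarrow> apply_expr F n (prolonged_eq F s t m) f = \<psi> s t m) \<and>
    (\<forall>k l. k \<le> n \<longrightarrow> k + 3 \<le> l \<longrightarrow> l \<le> degree F \<longrightarrow> f 0 k l = \<phi> k l)" by blast
  from someI[of "\<lambda>f. f \<in> jets F n \<and>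
    (\<forall>s t m. s + t < n \<longrightarrow> m \<le> degree F - 2 \<longrightarrow> apply_expr F n (prolonged_eq F s t m) f = \<psi> s t m) \<and>
    (\<forall>k l. k \<le> n \<longrightarrow> k + 3 \<le> l \<longrightarrow> l \<le> degree F \<longrightarrow> f 0 k l = \<phi> k l)", OF this]
  show "solved_jet F n \<phi> \<psi> \<in> jets F n"
    and "s + t < n \<Longrightarrow> m \<le> degree F - 2 \<Longrightarrow>
      apply_expr F n (prolonged_eq F s t m) (solved_jet F n \<phi> \<psi>) = \<psi> s t m"
    and "k \<le> n \<Longrightarrow> k + 3 \<le> l \<Longrightarrow> l \<le> degree F \<Longrightarrow> solved_jet F n \<phi> \<psi> 0 k l = \<phi> k l"
    unfolding solved_jet_def by blast+
qed

lemma jets_add: "f \<in> jets F n \<Longrightarrow> g \<in> jets F n \<Longrightarrow> f + g \<in> jets F n"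
  unfolding jets_def mem_Collect_eq plus_fun_apply by (metis add.right_neutral)

lemma jets_scale: "f \<in> jets F n \<Longrightarrow> scale_jet c f \<in> jets F n"
  unfolding jets_def scale_jet_def by fastforce

lemma jets_0: "0 \<in> jets F n"
  by (simp add: jets_def)

lemma jets_uminus: "f \<in> jets F n \<Longrightarrow> - f \<in> jets F n"
  unfolding jets_def by fastforce

lemma apply_expr_uminus: "apply_expr F n c (- f) = - apply_expr F n c f"
  by (simp add: apply_expr_def case_prod_unfold sum_negf)

lemma jet_eqI:
  assumes d: "degree F \<ge> 3" and f: "f \<in> jets F n" and g: "g \<in> jets F n"
    and eqs: "\<And>s t m. s + t < n \<Longrightarrow> m \<le> degree F - 2 \<Longrightarrow>
      apply_expr F n (prolonged_eq F s t m) f = apply_expr F n (prolonged_eq F s t m) g"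
    and free: "\<And>k l. k \<le> n \<Longrightarrow> k + 3 \<le> l \<Longrightarrow> l \<le> degree F \<Longrightarrow> f 0 k l = g 0 k l"
  shows "f = g"
proof -
  have "f + - g = 0"
    by (rule jet_eq_0I[OF d jets_add[OF f jets_uminus[OF g]]])
      (simp_all add: apply_expr_add apply_expr_uminus eqs free del: add_uminus_conv_diff)
  then show ?thesis by (simp add: eq_neg_iff_add_eq_0[symmetric])
qed

section \<open>The trace of the connection\<close>

lemma solved_jet_eqI:
  assumes "degree F \<ge> 3" "n \<le> degree F - 2" "f \<in> jets F n"
    and "\<And>s t m. s + t < n \<Longrightarrow> m \<le> degree F - 2 \<Longrightarrow> apply_expr F n (prolonged_eq F s t m) f = \<psi> s t m"
    and "\<And>k l. k \<le> n \<Longrightarrow> k + 3 \<le> l \<Longrightarrow> l \<le> degree F \<Longrightarrow> f 0 k l = \<phi> k l"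
  shows "solved_jet F n \<phi> \<psi> = f"
  by (rule jet_eqI[OF assms(1) solved_jet(1)[OF assms(1,2)] assms(3)])
    (simp_all add: solved_jet[OF assms(1,2)] assms(4,5))

lemma solved_jet_add:
  assumes "degree F \<ge> 3" "n \<le> degree F - 2"
  shows "solved_jet F n (\<lambda>k l. \<phi> k l + \<phi>' k l) (\<lambda>s t m. \<psi> s t m + \<psi>' s t m) =
    solved_jet F n \<phi> \<psi> + solved_jet F n \<phi>' \<psi>'"
  by (rule solved_jet_eqI[OF assms])
    (simp_all add: solved_jet[OF assms] jets_add apply_expr_add)

lemma solved_jet_scale:
  assumes "degree F \<ge> 3" "n \<le> degree F - 2"
  shows "solved_jet F n (\<lambda>k l. c * \<phi> k l) (\<lambda>s t m. c * \<psi> s t m) = scale_jet c (solved_jet F n \<phi> \<psi>)"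
  by (rule solved_jet_eqI[OF assms])
    (simp_all add: solved_jet[OF assms] jets_scale apply_expr_scale, simp add: scale_jet_def solved_jet[OF assms])

definition unit_jet :: "nat \<times> nat \<times> nat \<Rightarrow> jet" where
  "unit_jet i = (\<lambda>a b l. if (a, b, l) = i then 1 else 0)"

definition jet_index :: "germ poly \<Rightarrow> nat \<Rightarrow> (nat \<times> nat \<times> nat) set" where
  "jet_index F n = {(a, b, l). a + b \<le> n \<and> l \<in> {3..degree F}}"

definition jet_coord :: "jet \<Rightarrow> nat \<times> nat \<times> nat \<Rightarrow> germ" where
  "jet_coord f = (\<lambda>(a, b, l). f a b l)"

lemma finite_jet_index [simp]: "finite (jet_index F n)"
  by (rule finite_subset[of _ "{..n} \<times> {..n} \<times> {3..degree F}"]) (auto simp: jet_index_def)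

lemma unit_jet_in_jets: "i \<in> jet_index F n \<Longrightarrow> unit_jet i \<in> jets F n"
  by (auto simp: unit_jet_def jet_index_def jets_def)

lemma unit_jet_apply: "unit_jet i a b l = (if (a, b, l) = i then 1 else 0)"
  by (simp add: unit_jet_def)

lemma jet_coord_unit: "jet_coord (unit_jet j) i = (if i = j then 1 else 0)"
  by (cases i) (simp add: jet_coord_def unit_jet_def)

lemma jet_expand:
  assumes f: "f \<in> jets F n"
  shows "f = (\<Sum>i\<in>jet_index F n. scale_jet (jet_coord f i) (unit_jet i))"
proof -
  have sum_apply: "(\<Sum>i\<in>A. h i) a b l = (\<Sum>i\<in>A. h i a b l)" for A a b l and h :: "nat \<times> nat \<times> nat \<Rightarrow> jet"
    by (induction A rule: infinite_finite_induct) simp_all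
  have "f a b l = (\<Sum>i\<in>jet_index F n. scale_jet (jet_coord f i) (unit_jet i)) a b l" for a b l
  proof -
    have "(\<Sum>i\<in>jet_index F n. scale_jet (jet_coord f i) (unit_jet i)) a b l =
        (\<Sum>i\<in>jet_index F n. if i = (a, b, l) then f a b l else 0)"
      unfolding sum_apply by (intro sum.cong refl) (auto simp: scale_jet_def unit_jet_def jet_coord_def)
    also have "\<dots> = f a b l"
      using jetsD[OF f, of a b l]
      by (cases "(a, b, l) \<in> jet_index F n") (simp_all, auto simp: jet_index_def)
    finally show ?thesis by simp
  qed
  then show ?thesis by (simp add: fun_eq_iff)
qed

lemma linear_functional_expand:
  fixes L :: "jet \<Rightarrow> germ"
  assumes add: "\<And>f g. L (f + g) = L f + L g" and scale: "\<And>c f. L (scale_jet c f) = c * L f"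
    and f: "f \<in> jets F n"
  shows "(\<Sum>i\<in>jet_index F n. L (unit_jet i) * jet_coord f i) = L f"
proof -
  have L0: "L 0 = 0" using add[of 0 0] by simp
  have L_sum: "L (sum h A) = (\<Sum>i\<in>A. L (h i))" for h and A :: "(nat \<times> nat \<times> nat) set"
    by (induction A rule: infinite_finite_induct) (simp_all only: sum.infinite sum.empty sum.insert add L0 not_False_eq_True)
  show ?thesis
    by (subst (2) jet_expand[OF f]) (simp add: L_sum scale mult.commute)
qed

section \<open>Lifting jets to order d - 2 and projecting them onto E\<close>

context
  fixes F :: "germ poly"
  assumes d3: "degree F \<ge> 3"
begin

text \<open>The equations with \<open>s + t = d - 3\<close> are made to hold, while those of lower
  order keep their values, zero or not; therefore truncation gives \<open>f\<close> back.\<close>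

definition lift_jet :: "jet \<Rightarrow> jet" where
  "lift_jet f = solved_jet F (degree F - 2) (\<lambda>k l. f 0 k l)
     (\<lambda>s t m. if s + t < degree F - 3 then apply_expr F (degree F - 3) (prolonged_eq F s t m) f else 0)"

text \<open>Keeps the free entries and sets the values of all equations to zero.\<close>

definition proj_E :: "jet \<Rightarrow> jet" where
  "proj_E f = solved_jet F (degree F - 2) (\<lambda>k l. f 0 k l) (\<lambda>s t m. 0)"

text \<open>The basis vectors dual to the values of the equations; they span a complement of the
  truncation of \<open>E\<close>.\<close>

definition eq_jet :: "nat \<times> nat \<times> nat \<Rightarrow> jet" where
  "eq_jet e = solved_jet F (degree F - 3) (\<lambda>k l. 0) (\<lambda>s t m. if (s, t, m) = e then 1 else 0)"

lemma lift_jet_add: "lift_jet (f + g) = lift_jet f + lift_jet g"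
  unfolding lift_jet_def
  by (subst solved_jet_add[OF d3 order_refl, symmetric])
    (intro arg_cong2[where f = "solved_jet F (degree F - 2)"] ext, simp_all add: apply_expr_add)

lemma lift_jet_scale: "lift_jet (scale_jet c f) = scale_jet c (lift_jet f)"
  unfolding lift_jet_def
  by (subst solved_jet_scale[OF d3 order_refl, symmetric])
    (intro arg_cong2[where f = "solved_jet F (degree F - 2)"] ext, simp_all add: apply_expr_scale, simp_all add: scale_jet_def)

lemma proj_E_add: "proj_E (f + g) = proj_E f + proj_E g"
  unfolding proj_E_def
  by (subst solved_jet_add[OF d3 order_refl, symmetric])
    (intro arg_cong2[where f = "solved_jet F (degree F - 2)"] ext, simp_all)

lemma proj_E_scale: "proj_E (scale_jet c f) = scale_jet c (proj_E f)"
  unfolding proj_E_def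
  by (subst solved_jet_scale[OF d3 order_refl, symmetric])
    (intro arg_cong2[where f = "solved_jet F (degree F - 2)"] ext, simp_all add: scale_jet_def)

lemma truncate_jets: "truncate_jet n f \<in> jets F n" if "f \<in> jets F n'"
  using that unfolding jets_def truncate_jet_def by auto

lemma E_module_iff:
  "f \<in> E_module F \<longleftrightarrow> f \<in> jets F (degree F - 2) \<and>
    (\<forall>s t m. s + t < degree F - 2 \<longrightarrow> m \<le> degree F - 2 \<longrightarrow>
      apply_expr F (degree F - 2) (prolonged_eq F s t m) f = 0)"
  by (auto simp: E_module_def solution_jets_def prolonged_eq_def)

lemma E_module_jets: "f \<in> E_module F \<Longrightarrow> f \<in> jets F (degree F - 2)"
  by (simp add: E_module_iff)

lemma proj_E_in_E: "proj_E f \<in> E_module F"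
  by (simp add: E_module_iff proj_E_def solved_jet[OF d3])

lemma apply_prolonged_eq_truncate:
  assumes "s + t < degree F - 3"
  shows "apply_expr F (degree F - 3) (prolonged_eq F s t m) (truncate_jet (degree F - 3) f) =
    apply_expr F (degree F - 2) (prolonged_eq F s t m) f"
proof -
  have "apply_expr F (degree F - 3) (prolonged_eq F s t m) (truncate_jet (degree F - 3) f) =
      apply_expr F (degree F - 3) (prolonged_eq F s t m) f"
    by (rule apply_expr_cong) (simp add: truncate_jet_def)
  then show ?thesis
    using apply_prolonged_eq_order[OF assms, of F m f] apply_prolonged_eq_order[of s t "degree F - 2" F m f] assms
    by simp
qed

lemma truncate_0: "truncate_jet n f 0 k l = (if k \<le> n then f 0 k l else 0)"
  by (simp add: truncate_jet_def)

lemma truncate_lift: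
  assumes f: "f \<in> jets F (degree F - 3)"
  shows "truncate_jet (degree F - 3) (lift_jet f) = f"
proof (rule jet_eqI[OF d3 _ f])
  show "truncate_jet (degree F - 3) (lift_jet f) \<in> jets F (degree F - 3)"
    unfolding lift_jet_def by (rule truncate_jets[OF solved_jet(1)[OF d3 order_refl]])
  show "apply_expr F (degree F - 3) (prolonged_eq F s t m) (truncate_jet (degree F - 3) (lift_jet f)) =
      apply_expr F (degree F - 3) (prolonged_eq F s t m) f"
    if "s + t < degree F - 3" "m \<le> degree F - 2" for s t m
    unfolding apply_prolonged_eq_truncate[OF that(1)]
    using that by (simp add: lift_jet_def solved_jet(2)[OF d3])
  show "truncate_jet (degree F - 3) (lift_jet f) 0 k l = f 0 k l"
    if "k \<le> degree F - 3" "k + 3 \<le> l" "l \<le> degree F" for k l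
    using that by (simp add: truncate_0 lift_jet_def solved_jet(3)[OF d3])
qed

lemma lift_truncate:
  assumes h: "h \<in> E_module F"
  shows "lift_jet (truncate_jet (degree F - 3) h) = h"
  unfolding lift_jet_def
  by (rule solved_jet_eqI[OF d3 order_refl])
    (use h d3 in \<open>auto simp: E_module_iff apply_prolonged_eq_truncate truncate_0\<close>)

lemma proj_E_truncate:
  assumes h: "h \<in> E_module F"
  shows "proj_E (truncate_jet (degree F - 3) h) = h"
  unfolding proj_E_def
  by (rule solved_jet_eqI[OF d3 order_refl])
    (use h d3 in \<open>auto simp: E_module_iff truncate_0\<close>)

lemma truncate_proj_E:
  assumes f: "f \<in> jets F (degree F - 3)"
    and eqs: "\<And>s t m. s + t < degree F - 3 \<Longrightarrow> m \<le> degree F - 2 \<Longrightarrow>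
      apply_expr F (degree F - 3) (prolonged_eq F s t m) f = 0"
  shows "truncate_jet (degree F - 3) (proj_E f) = f"
proof (rule jet_eqI[OF d3 _ f])
  show "truncate_jet (degree F - 3) (proj_E f) \<in> jets F (degree F - 3)"
    unfolding proj_E_def by (rule truncate_jets[OF solved_jet(1)[OF d3 order_refl]])
  show "apply_expr F (degree F - 3) (prolonged_eq F s t m) (truncate_jet (degree F - 3) (proj_E f)) =
      apply_expr F (degree F - 3) (prolonged_eq F s t m) f"
    if "s + t < degree F - 3" "m \<le> degree F - 2" for s t m
    unfolding apply_prolonged_eq_truncate[OF that(1)] eqs[OF that]
    using that by (simp add: proj_E_def solved_jet(2)[OF d3])
  show "truncate_jet (degree F - 3) (proj_E f) 0 k l = f 0 k l"
    if "k \<le> degree F - 3" "k + 3 \<le> l" "l \<le> degree F" for k l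
    using that by (simp add: truncate_0 proj_E_def solved_jet(3)[OF d3])
qed

text \<open>On \<open>E\<close>, \<open>proj_E\<close> is a left inverse of the truncation, which is
  thus injective. The lower equations put \<open>f\<close> into the image, so the chosen preimage is
  \<open>proj_E f\<close>.\<close>

lemma lift_to_E_eq:
  assumes "f \<in> jets F (degree F - 3)"
    and "\<And>s t m. s + t < degree F - 3 \<Longrightarrow> m \<le> degree F - 2 \<Longrightarrow>
      apply_expr F (degree F - 3) (prolonged_eq F s t m) f = 0"
  shows "lift_to_E F f = proj_E f"
proof -
  have "inj_on (truncate_jet (degree F - 3)) (E_module F)"
    by (rule inj_on_inverseI[of _ proj_E]) (rule proj_E_truncate)
  from inv_into_f_f[OF this proj_E_in_E, of f] show ?thesis
    by (simp add: lift_to_E_def truncate_proj_E[OF assms])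
qed

lemma spencer_x_jets: "f \<in> jets F (Suc n) \<Longrightarrow> spencer_x n f \<in> jets F n"
proof -
  assume f: "f \<in> jets F (Suc n)"
  have "f a b l = 0" if "l \<notin> {3..degree F}" for a b l using jetsD[OF f] that by blast
  then have "spencer_x n f a b l = 0" if "n < a + b \<or> l \<notin> {3..degree F}" for a b l
    using that unfolding spencer_x_def by (metis ddx_0 diff_zero linorder_not_le)
  then show ?thesis unfolding jets_def mem_Collect_eq using linorder_not_le by blast
qed

lemma spencer_y_jets: "f \<in> jets F (Suc n) \<Longrightarrow> spencer_y n f \<in> jets F n"
proof -
  assume f: "f \<in> jets F (Suc n)"
  have "f a b l = 0" if "l \<notin> {3..degree F}" for a b l using jetsD[OF f] that by blast
  then have "spencer_y n f a b l = 0" if "n < a + b \<or> l \<notin> {3..degree F}" for a b l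
    using that unfolding spencer_y_def by (metis ddy_0 diff_zero linorder_not_le)
  then show ?thesis unfolding jets_def mem_Collect_eq using linorder_not_le by blast
qed

lemma Suc_d: "Suc (degree F - 3) = degree F - 2"
  using d3 by simp

text \<open>The term with \<open>Suc s\<close> is the only link between different equations. If all
  equations vanish on \<open>h\<close>, the lower ones vanish on its Spencer image; on
  \<open>J / E\<close> the same term is a shift, and the connection becomes nilpotent.\<close>

lemma apply_spencer_x:
  assumes "s + t < degree F - 3"
  shows "apply_expr F (degree F - 3) (prolonged_eq F s t m) (spencer_x (degree F - 3) h) =
    ddx (apply_expr F (degree F - 2) (prolonged_eq F s t m) h) -
    apply_expr F (degree F - 2) (prolonged_eq F (Suc s) t m) h"
proof -
  have "apply_expr F (degree F - 2) (prolonged_eq F s t m) h = apply_expr F (degree F - 3) (prolonged_eq F s t m) h"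
    using apply_prolonged_eq_order[OF assms, of F m h] apply_prolonged_eq_order[of s t "degree F - 2" F m h] assms
    by simp
  then show ?thesis
    using ddx_apply_expr[of "degree F - 3" "prolonged_eq F s t m" F h] assms
    by (simp add: formal_ddx_prolonged_eq Suc_d prolonged_eq_zero)
qed

lemma apply_spencer_y:
  assumes "s + t < degree F - 3"
  shows "apply_expr F (degree F - 3) (prolonged_eq F s t m) (spencer_y (degree F - 3) h) =
    ddy (apply_expr F (degree F - 2) (prolonged_eq F s t m) h) -
    apply_expr F (degree F - 2) (prolonged_eq F s (Suc t) m) h"
proof -
  have "apply_expr F (degree F - 2) (prolonged_eq F s t m) h = apply_expr F (degree F - 3) (prolonged_eq F s t m) h"
    using apply_prolonged_eq_order[OF assms, of F m h] apply_prolonged_eq_order[of s t "degree F - 2" F m h] assms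
    by simp
  then show ?thesis
    using ddy_apply_expr[of "degree F - 3" "prolonged_eq F s t m" F h] assms
    by (simp add: formal_ddy_prolonged_eq Suc_d prolonged_eq_zero)
qed

lemma nabla_eq:
  assumes "v \<in> E_module F"
  shows "nabla_x F v = proj_E (spencer_x (degree F - 3) v)"
    and "nabla_y F v = proj_E (spencer_y (degree F - 3) v)"
proof -
  have v: "v \<in> jets F (Suc (degree F - 3))"
    using assms by (simp only: E_module_iff Suc_d)
  have eqs: "apply_expr F (degree F - 2) (prolonged_eq F s t m) v = 0"
    if "s + t < degree F - 2" "m \<le> degree F - 2" for s t m
    using assms that by (simp only: E_module_iff)
  show "nabla_x F v = proj_E (spencer_x (degree F - 3) v)" unfolding nabla_x_def
  proof (rule lift_to_E_eq[OF spencer_x_jets[OF v]])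
    fix s t m assume "s + t < degree F - 3" "m \<le> degree F - 2"
    then show "apply_expr F (degree F - 3) (prolonged_eq F s t m) (spencer_x (degree F - 3) v) = 0"
      using eqs[of s t m] eqs[of "Suc s" t m] by (subst apply_spencer_x) auto
  qed
  show "nabla_y F v = proj_E (spencer_y (degree F - 3) v)" unfolding nabla_y_def
  proof (rule lift_to_E_eq[OF spencer_y_jets[OF v]])
    fix s t m assume "s + t < degree F - 3" "m \<le> degree F - 2"
    then show "apply_expr F (degree F - 3) (prolonged_eq F s t m) (spencer_y (degree F - 3) v) = 0"
      using eqs[of s t m] eqs[of s "Suc t" m] by (subst apply_spencer_y) auto
  qed
qed

text \<open>These are the entries on the diagonal of the connection matrix of \<open>J\<close>.
  Below order \<open>d - 3\<close> the lift agrees at the shifted position with the unit jet, which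
  is 0 there. In order \<open>d - 3\<close> the chains of order \<open>d - 2\<close> are homogeneous
  except in row \<open>s = a\<close>, where the unit jet contributes minus a zeroth order
  coefficient. The shifted entry is this value if it lies behind that row, seen from the end where
  its chain leaves the range, and 0 if it lies before it.\<close>

lemma lift_unit_jet:
  assumes j: "(a, b, l) \<in> jet_index F (degree F - 3)"
  shows "lift_jet (unit_jet (a, b, l)) (Suc a) b l =
      - (if a + b = degree F - 3 \<and> degree F \<le> a + l then equation F (degree F - l) 0 0 l else 0)"
    and "lift_jet (unit_jet (a, b, l)) a (Suc b) l =
      - (if a + b = degree F - 3 \<and> a + l \<le> degree F then equation F (degree F + 1 - l) 0 0 l else 0)"
proof -
  let ?h = "lift_jet (unit_jet (a, b, l))" and ?d = "degree F"
  define k where "k = ?d - 2"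
  define x where "x a l = ?h a (k - a) l" for a l
  have h: "?h \<in> jets F k" by (simp add: lift_jet_def solved_jet(1)[OF d3] k_def)
  have l: "3 \<le> l" "l \<le> ?d" using j by (auto simp: jet_index_def)
  have low: "?h a' b' l' = unit_jet (a, b, l) a' b' l'" if "a' + b' \<le> ?d - 3" for a' b' l'
    using fun_cong[OF fun_cong[OF fun_cong[OF truncate_lift[OF unit_jet_in_jets[OF j]]]], of a' b' l'] that
    by (simp add: truncate_jet_def)
  show "?h (Suc a) b l = - (if a + b = ?d - 3 \<and> ?d \<le> a + l then equation F (?d - l) 0 0 l else 0)"
    and "?h a (Suc b) l = - (if a + b = ?d - 3 \<and> a + l \<le> ?d then equation F (?d + 1 - l) 0 0 l else 0)"
  proof -
    have "?h (Suc a) b l = - (if ?d \<le> a + l then equation F (?d - l) 0 0 l else 0) \<and>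
          ?h a (Suc b) l = - (if a + l \<le> ?d then equation F (?d + 1 - l) 0 0 l else 0)"
      if ab: "a + b = ?d - 3"
    proof -
      have range: "x a' l' = 0" if "l' \<notin> {3..?d}" for a' l'
        using jetsD[OF h] that by (simp add: x_def)
      have eq: "x (Suc s) l' + x s (Suc l') = - (if s = a then equation F (?d - l') 0 0 l else 0)"
        if s: "s < k" "2 \<le> l'" "l' \<le> ?d" for s l'
      proof -
        define t where "t = k - Suc s"
        have t: "s + t < k" "s + t = ?d - 3" "k - Suc s = t" "k - s = Suc t"
          using s d3 by (auto simp: t_def k_def)
        have m: "?d - l' \<le> ?d - 2" "?d - (?d - l') = l'" "?d + 1 - (?d - l') = Suc l'" "Suc ?d - (?d - l') = Suc l'"
          using s by auto
        have "apply_expr F k (prolonged_eq F s t (?d - l')) ?h = 0"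
          using t(1,2) m(1) by (simp add: lift_jet_def k_def solved_jet(2)[OF d3])
        then have "x (Suc s) l' + x s (Suc l') = - apply_expr F (s + t) (prolonged_eq F s t (?d - l')) ?h"
          unfolding apply_prolonged_eq[OF h t(1) m(1) d3]
          by (simp add: x_def t m eq_neg_iff_add_eq_0)
        also have "apply_expr F (s + t) (prolonged_eq F s t (?d - l')) ?h =
            (\<Sum>i = 3..?d. equation F (?d - l') 0 0 i * ?h s t i)"
          by (rule apply_prolonged_eq_subprincipal) (use t ab in \<open>auto simp: low unit_jet_apply\<close>)
        also have "\<dots> = (\<Sum>i = 3..?d. if i = l then (if s = a then equation F (?d - l') 0 0 l else 0) else 0)"
          using t ab by (intro sum.cong refl) (auto simp: low unit_jet_apply)
        also have "\<dots> = (if s = a then equation F (?d - l') 0 0 l else 0)" using l by simp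
        finally show ?thesis .
      qed
      have kk: "k - Suc a = b" "k - a = Suc b" "k + 2 = ?d" "a < k" using ab d3 by (auto simp: k_def)
      \<comment> \<open>Both vanishing statements use only rows on one side of the inhomogeneous row
        \<open>a\<close>. As \<open>k + 2 = d\<close>, every chain has an end and no free parameter
        is left.\<close>
      have up: "x a' l' = 0" if "a' \<le> a" "k + 3 \<le> a' + l'" for a' l'
        by (rule chain_upper_zero[of ?d x k a])
          (use that kk in \<open>auto simp: range eq\<close>)
      have lo: "x a' l' = 0" if "Suc a \<le> a'" "a' \<le> k" "a' + l' \<le> k + 2" for a' l'
        by (rule chain_lower_zero[of ?d x "Suc a" k]) (use that in \<open>auto simp: range eq\<close>)
      have 1: "?h (Suc a) b l = x (Suc a) l" "?h a (Suc b) l = x a l" by (simp_all add: x_def kk)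
      have "x (Suc a) l = - (if ?d \<le> a + l then equation F (?d - l) 0 0 l else 0)"
      proof (cases "?d \<le> a + l")
        case True
        then have "x a (Suc l) = 0" using kk by (intro up) auto
        then show ?thesis using eq[of a l] l kk True by simp
      next
        case False
        then show ?thesis using lo[of "Suc a" l] kk by simp
      qed
      moreover have "x a l = - (if a + l \<le> ?d then equation F (?d + 1 - l) 0 0 l else 0)"
      proof (cases "a + l \<le> ?d")
        case True
        then have "x (Suc a) (l - 1) = 0" using kk l by (intro lo) auto
        moreover have "Suc (l - 1) = l" "?d - (l - 1) = ?d + 1 - l" using l by auto
        ultimately show ?thesis using eq[of a "l - 1"] l kk True by simp
      next
        case False
        then show ?thesis using up[of a l] kk by simp
      qed
      ultimately show ?thesis using 1 by simp
    qed
    moreover have "?h (Suc a) b l = 0 \<and> ?h a (Suc b) l = 0" if "a + b \<noteq> ?d - 3"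
      using that j by (auto simp: low unit_jet_apply jet_index_def)
    ultimately show "?h (Suc a) b l = - (if a + b = ?d - 3 \<and> ?d \<le> a + l then equation F (?d - l) 0 0 l else 0)"
      and "?h a (Suc b) l = - (if a + b = ?d - 3 \<and> a + l \<le> ?d then equation F (?d + 1 - l) 0 0 l else 0)"
      by (cases "a + b = ?d - 3"; simp)+
  qed
qed

lemma sum_top_index:
  fixes g :: "nat \<Rightarrow> germ"
  shows "(\<Sum>(a, b, l)\<in>jet_index F n. if a + b = n \<and> P a l then g l else 0) =
    (\<Sum>l = 3..degree F. of_nat (card {a. a \<le> n \<and> P a l}) * g l)"
proof -
  have "(\<Sum>(a, b, l)\<in>jet_index F n. if a + b = n \<and> P a l then g l else 0) =
      (\<Sum>(a, b, l)\<in>{(a, b, l). a + b = n \<and> l \<in> {3..degree F} \<and> P a l}. g l)"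
    by (rule sum.mono_neutral_cong_right[OF finite_jet_index]) (auto simp: jet_index_def split: if_splits)
  also have "\<dots> = (\<Sum>(l, a)\<in>(SIGMA l:{3..degree F}. {a. a \<le> n \<and> P a l}). g l)"
    by (rule sum.reindex_bij_witness[of _ "\<lambda>(l, a). (a, n - a, l)" "\<lambda>(a, b, l). (l, a)"]) auto
  also have "\<dots> = (\<Sum>l = 3..degree F. of_nat (card {a. a \<le> n \<and> P a l}) * g l)"
    by (subst sum.Sigma[symmetric]) auto
  finally show ?thesis .
qed

text \<open>The \<open>dx\<close>-part of the trace on \<open>J\<close>; the sign is that of the
  Spencer operator, which subtracts the shifted entry. The factor \<open>l - 2\<close> counts the
  \<open>a\<close> with \<open>d - l \<le> a \<le> d - 3\<close>, the positions at which the
  diagonal entry is non-trivial.\<close>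

lemma trace_lift_x:
  "(\<Sum>(a, b, l)\<in>jet_index F (degree F - 3). - lift_jet (unit_jet (a, b, l)) (Suc a) b l) =
    (\<Sum>l = 3..degree F. of_nat (l - 2) * equation F (degree F - l) 0 0 l)"
proof -
  have "(\<Sum>(a, b, l)\<in>jet_index F (degree F - 3). - lift_jet (unit_jet (a, b, l)) (Suc a) b l) =
    (\<Sum>(a, b, l)\<in>jet_index F (degree F - 3).
       if a + b = degree F - 3 \<and> degree F \<le> a + l then equation F (degree F - l) 0 0 l else 0)"
    by (rule sum.cong[OF refl]) (auto simp: lift_unit_jet)
  also have "\<dots> = (\<Sum>l = 3..degree F. of_nat (card {a. a \<le> degree F - 3 \<and> degree F \<le> a + l}) *
      equation F (degree F - l) 0 0 l)"
    by (rule sum_top_index[of "degree F - 3" "\<lambda>a l. degree F \<le> a + l" "\<lambda>l. equation F (degree F - l) 0 0 l"])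
  also have "\<dots> = (\<Sum>l = 3..degree F. of_nat (l - 2) * equation F (degree F - l) 0 0 l)"
  proof (rule sum.cong[OF refl])
    fix l assume l: "l \<in> {3..degree F}"
    then have "{a. a \<le> degree F - 3 \<and> degree F \<le> a + l} = {degree F - l..degree F - 3}" by auto
    then have "card {a. a \<le> degree F - 3 \<and> degree F \<le> a + l} = l - 2" using l by auto
    then show "of_nat (card {a. a \<le> degree F - 3 \<and> degree F \<le> a + l}) * equation F (degree F - l) 0 0 l =
      of_nat (l - 2) * equation F (degree F - l) 0 0 l" by simp
  qed
  finally show ?thesis .
qed

lemma trace_lift_y:
  "(\<Sum>(a, b, l)\<in>jet_index F (degree F - 3). - lift_jet (unit_jet (a, b, l)) a (Suc b) l) =
    (\<Sum>l = 3..degree F. of_nat (degree F + 1 - l) * equation F (degree F + 1 - l) 0 0 l)"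
proof -
  have "(\<Sum>(a, b, l)\<in>jet_index F (degree F - 3). - lift_jet (unit_jet (a, b, l)) a (Suc b) l) =
    (\<Sum>(a, b, l)\<in>jet_index F (degree F - 3).
       if a + b = degree F - 3 \<and> a + l \<le> degree F then equation F (degree F + 1 - l) 0 0 l else 0)"
    by (rule sum.cong[OF refl]) (auto simp: lift_unit_jet)
  also have "\<dots> = (\<Sum>l = 3..degree F. of_nat (card {a. a \<le> degree F - 3 \<and> a + l \<le> degree F}) *
      equation F (degree F + 1 - l) 0 0 l)"
    by (rule sum_top_index[of "degree F - 3" "\<lambda>a l. a + l \<le> degree F" "\<lambda>l. equation F (degree F + 1 - l) 0 0 l"])
  also have "\<dots> = (\<Sum>l = 3..degree F. of_nat (degree F + 1 - l) * equation F (degree F + 1 - l) 0 0 l)"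
  proof (rule sum.cong[OF refl])
    fix l assume l: "l \<in> {3..degree F}"
    then have "{a. a \<le> degree F - 3 \<and> a + l \<le> degree F} = {0..degree F - l}" by auto
    then have "card {a. a \<le> degree F - 3 \<and> a + l \<le> degree F} = degree F + 1 - l" using l by auto
    then show "of_nat (card {a. a \<le> degree F - 3 \<and> a + l \<le> degree F}) * equation F (degree F + 1 - l) 0 0 l =
      of_nat (degree F + 1 - l) * equation F (degree F + 1 - l) 0 0 l" by simp
  qed
  finally show ?thesis .
qed


section \<open>The values of the equations as a complement of E\<close>

lemma eq_jet:
  shows "eq_jet e \<in> jets F (degree F - 3)"
    and "s + t < degree F - 3 \<Longrightarrow> m \<le> degree F - 2 \<Longrightarrow>
      apply_expr F (degree F - 3) (prolonged_eq F s t m) (eq_jet e) = (if (s, t, m) = e then 1 else 0)"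
    and "k \<le> degree F - 3 \<Longrightarrow> k + 3 \<le> l \<Longrightarrow> l \<le> degree F \<Longrightarrow> eq_jet e 0 k l = 0"
  using solved_jet[OF d3, of "degree F - 3"] unfolding eq_jet_def by simp_all

lemma proj_E_eq_jet: "proj_E (eq_jet e) = 0"
  unfolding proj_E_def
  by (rule solved_jet_eqI[OF d3 order_refl jets_0]) (use d3 in \<open>auto simp: eq_jet(3)\<close>)

definition eq_index :: "(nat \<times> nat \<times> nat) set" where
  "eq_index = {(s, t, m). s + t < degree F - 3 \<and> m \<le> degree F - 2}"

lemma finite_eq_index [simp]: "finite eq_index"
  by (rule finite_subset[of _ "{..<degree F - 3} \<times> {..<degree F - 3} \<times> {..degree F - 2}"])
    (auto simp: eq_index_def)

definition eq_value :: "nat \<times> nat \<times> nat \<Rightarrow> jet \<Rightarrow> germ" where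
  "eq_value = (\<lambda>(s, t, m) f. apply_expr F (degree F - 3) (prolonged_eq F s t m) f)"

lemma eq_value_eq_jet: "e' \<in> eq_index \<Longrightarrow> eq_value e' (eq_jet e) = (if e' = e then 1 else 0)"
  by (auto simp: eq_index_def eq_value_def eq_jet(2))

lemma eq_value_truncate_E: "e \<in> eq_index \<Longrightarrow> h \<in> E_module F \<Longrightarrow>
    eq_value e (truncate_jet (degree F - 3) h) = 0"
  by (auto simp: eq_index_def eq_value_def apply_prolonged_eq_truncate E_module_iff)

text \<open>The diagonal on \<open>J / E\<close>. The value of the equation itself is the constant
  1, with derivative 0, and its derived equation is either another coordinate of
  \<open>eq_jet e\<close> or of order \<open>d - 2\<close>, where the lift makes it vanish.\<close>

lemma eq_value_spencer_eq_jet: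
  assumes e: "e \<in> eq_index"
  shows "eq_value e (spencer_x (degree F - 3) (lift_jet (eq_jet e))) = 0"
    and "eq_value e (spencer_y (degree F - 3) (lift_jet (eq_jet e))) = 0"
proof -
  obtain s t m where stm: "e = (s, t, m)" "s + t < degree F - 3" "m \<le> degree F - 2"
    using e by (auto simp: eq_index_def)
  have lift: "apply_expr F (degree F - 2) (prolonged_eq F s' t' m) (lift_jet (eq_jet e)) =
      (if s' = s \<and> t' = t then 1 else 0)" if "s' + t' < degree F - 2" for s' t'
    using that stm by (auto simp: lift_jet_def solved_jet(2)[OF d3] eq_jet(2))
  have "apply_expr F (degree F - 2) (prolonged_eq F s t m) (lift_jet (eq_jet e)) = 1"
    "apply_expr F (degree F - 2) (prolonged_eq F (Suc s) t m) (lift_jet (eq_jet e)) = 0"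
    "apply_expr F (degree F - 2) (prolonged_eq F s (Suc t) m) (lift_jet (eq_jet e)) = 0"
    using stm by (subst lift; auto)+
  then show "eq_value e (spencer_x (degree F - 3) (lift_jet (eq_jet e))) = 0"
    and "eq_value e (spencer_y (degree F - 3) (lift_jet (eq_jet e))) = 0"
    using stm by (simp_all add: eq_value_def apply_spencer_x apply_spencer_y)
qed

text \<open>The two summands split the coordinates: the first has the free entries of
  \<open>f\<close> and no equation values, the second the equation values of \<open>f\<close> and no
  free entries.\<close>

lemma jet_decomposition:
  assumes f: "f \<in> jets F (degree F - 3)"
  shows "f = truncate_jet (degree F - 3) (proj_E f) + (\<Sum>e\<in>eq_index. scale_jet (eq_value e f) (eq_jet e))"
    (is "f = ?g + ?s")
proof (rule jet_eqI[OF d3 f])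
  have apply_0: "apply_expr F (degree F - 3) c 0 = 0" for c by (rule apply_expr_0)
  have apply_s: "apply_expr F (degree F - 3) c (\<Sum>e\<in>A. scale_jet (eq_value e f) (eq_jet e)) =
      (\<Sum>e\<in>A. eq_value e f * apply_expr F (degree F - 3) c (eq_jet e))" for c A
    by (induction A rule: infinite_finite_induct)
      (simp_all only: sum.infinite sum.empty sum.insert apply_0 apply_expr_add apply_expr_scale not_False_eq_True)
  have "(\<Sum>e\<in>A. scale_jet (eq_value e f) (eq_jet e)) \<in> jets F (degree F - 3)" for A
    by (induction A rule: infinite_finite_induct)
      (simp_all only: sum.infinite sum.empty sum.insert jets_0 jets_add jets_scale eq_jet(1) not_False_eq_True)
  then have "?s \<in> jets F (degree F - 3)" .
  moreover have "?g \<in> jets F (degree F - 3)"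
    unfolding proj_E_def by (rule truncate_jets[OF solved_jet(1)[OF d3 order_refl]])
  ultimately show "?g + ?s \<in> jets F (degree F - 3)" by (rule jets_add[rotated])
  fix s t m assume *: "s + t < degree F - 3" "m \<le> degree F - 2"
  have "apply_expr F (degree F - 3) (prolonged_eq F s t m) ?s =
      (\<Sum>e\<in>eq_index. if e = (s, t, m) then eq_value e f else 0)"
    unfolding apply_s by (intro sum.cong refl) (auto simp: eq_jet(2)[OF *])
  also have "\<dots> = eq_value (s, t, m) f" using * by (simp add: eq_index_def[symmetric]) (simp add: eq_index_def)
  finally show "apply_expr F (degree F - 3) (prolonged_eq F s t m) f =
      apply_expr F (degree F - 3) (prolonged_eq F s t m) (?g + ?s)"
    using * eq_value_truncate_E[OF _ proj_E_in_E, of "(s, t, m)" f]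
    by (simp add: apply_expr_add eq_value_def eq_index_def)
next
  have s_apply: "(\<Sum>e\<in>A. scale_jet (eq_value e f) (eq_jet e)) a b l = (\<Sum>e\<in>A. eq_value e f * eq_jet e a b l)" for A a b l
    by (induction A rule: infinite_finite_induct) (simp_all add: scale_jet_def)
  fix k l assume "k \<le> degree F - 3" "k + 3 \<le> l" "l \<le> degree F"
  then show "f 0 k l = (?g + ?s) 0 k l"
    using d3 by (simp add: s_apply eq_jet(3) truncate_0 proj_E_def solved_jet(3)[OF d3])
qed

text \<open>
  The jets of order \<open>d - 3\<close> carry the connection \<open>f \<mapsto> D (lift_jet f)\<close>, which restricts to \<open>\<nabla>\<close>
  on \<open>E\<close> and induces a nilpotent connection on the values of the equations.
\<close>

lemma curvature_trace_of_basis: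
  assumes B: "is_basis_of_E F B"
  shows "(\<Sum>v\<in>B. curvature_matrix F B v v) =
    d1 (\<Sum>l = 3..degree F. of_nat (l - 2) * equation F (degree F - l) 0 0 l,
        \<Sum>l = 3..degree F. of_nat (degree F + 1 - l) * equation F (degree F + 1 - l) 0 0 l)"
proof -
  let ?n = "degree F - 3" and ?rep = "jet.representation B"
  let ?I = "jet_index F ?n" and ?K = "B <+> eq_index"
  have fB: "finite B" and ind: "jet.independent B" and span: "jet.span B = E_module F"
    using B by (auto simp: is_basis_of_E_def)
  have BE: "v \<in> E_module F" if "v \<in> B" for v
    using jet.span_base[OF that] span by simp
  \<comment> \<open>\<open>c\<close> is a basis of \<open>J\<close> adapted to \<open>E\<close>:
    truncated elements of \<open>B\<close>, then the jets dual to the equations. \<open>L\<close>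
    lists the coordinate functionals, so \<open>M\<close> and \<open>N\<close> below are inverse
    matrices.\<close>
  define L where "L \<alpha> f = (case \<alpha> of Inl v \<Rightarrow> ?rep (proj_E f) v | Inr e \<Rightarrow> eq_value e f)" for \<alpha> f
  define c where "c \<alpha> = (case \<alpha> of Inl v \<Rightarrow> truncate_jet ?n v | Inr e \<Rightarrow> eq_jet e)" for \<alpha>
  define M where "M i \<alpha> = jet_coord (c \<alpha>) i" for i \<alpha>
  define N where "N \<alpha> i = L \<alpha> (unit_jet i)" for i \<alpha>
  \<comment> \<open>The matrix, in the unit jets, of the connection given by the Spencer operator of
    the lift.\<close>
  define \<theta>x where "\<theta>x = (\<lambda>(a, b, l) j. - lift_jet (unit_jet j) (Suc a) b l)"
  define \<theta>y where "\<theta>y = (\<lambda>(a, b, l) j. - lift_jet (unit_jet j) a (Suc b) l)"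
  have L_add: "L \<alpha> (f + g) = L \<alpha> f + L \<alpha> g" for \<alpha> f g
    by (cases \<alpha>) (simp_all add: L_def proj_E_add jet.representation_add[OF ind] span proj_E_in_E
      eq_value_def case_prod_unfold apply_expr_add)
  have L_scale: "L \<alpha> (scale_jet r f) = r * L \<alpha> f" for \<alpha> f r
    by (cases \<alpha>) (simp_all add: L_def proj_E_scale jet.representation_scale[OF ind] span proj_E_in_E
      eq_value_def case_prod_unfold apply_expr_scale)
  have L_expand: "(\<Sum>i\<in>?I. N \<alpha> i * jet_coord f i) = L \<alpha> f" if "f \<in> jets F ?n" for \<alpha> f
    unfolding N_def by (rule linear_functional_expand[OF L_add L_scale that])
  have c_jets: "c \<alpha> \<in> jets F ?n" if "\<alpha> \<in> ?K" for \<alpha>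
    using that truncate_jets[OF E_module_jets[OF BE]] by (auto simp: c_def eq_jet(1))
  have NM: "(\<Sum>i\<in>?I. N \<alpha> i * M i \<beta>) = (if \<alpha> = \<beta> then 1 else 0)" if "\<alpha> \<in> ?K" "\<beta> \<in> ?K" for \<alpha> \<beta>
  proof -
    have "(\<Sum>i\<in>?I. N \<alpha> i * M i \<beta>) = L \<alpha> (c \<beta>)"
      unfolding M_def by (rule L_expand[OF c_jets[OF that(2)]])
    also have "\<dots> = (if \<alpha> = \<beta> then 1 else 0)"
      using that by (auto simp: L_def c_def proj_E_truncate BE jet.representation_basis[OF ind]
        proj_E_eq_jet jet.representation_zero eq_value_truncate_E eq_value_eq_jet split: if_splits)
    finally show ?thesis .
  qed
  have MN: "(\<Sum>\<alpha>\<in>?K. M i \<alpha> * N \<alpha> j) = (if i = j then 1 else 0)" if i: "i \<in> ?I" and j: "j \<in> ?I" for i j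
  proof -
    obtain a b l where abl: "i = (a, b, l)" "a + b \<le> ?n" using i by (auto simp: jet_index_def)
    let ?e = "unit_jet j"
    have "jet_coord ?e i = jet_coord (truncate_jet ?n (proj_E ?e) +
        (\<Sum>e\<in>eq_index. scale_jet (eq_value e ?e) (eq_jet e))) i"
      using jet_decomposition[OF unit_jet_in_jets[OF j]] by simp
    also have "\<dots> = proj_E ?e a b l + (\<Sum>e\<in>eq_index. eq_value e ?e * eq_jet e a b l)"
    proof -
      have "(\<Sum>e\<in>A. scale_jet (eq_value e f) (eq_jet e)) a b l = (\<Sum>e\<in>A. eq_value e f * eq_jet e a b l)" for A f
        by (induction A rule: infinite_finite_induct) (simp_all add: scale_jet_def)
      then show ?thesis using abl(2) by (simp add: jet_coord_def abl(1) truncate_jet_def)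
    qed
    also have "proj_E ?e = (\<Sum>v\<in>B. scale_jet (?rep (proj_E ?e) v) v)"
      by (rule jet.sum_representation_eq[symmetric, OF ind _ fB order_refl]) (simp add: span proj_E_in_E)
    also have "(\<Sum>v\<in>B. scale_jet (?rep (proj_E ?e) v) v) a b l = (\<Sum>v\<in>B. ?rep (proj_E ?e) v * v a b l)"
    proof -
      have "(\<Sum>v\<in>A. scale_jet (r v) v) a b l = (\<Sum>v\<in>A. r v * v a b l)" for A and r :: "jet \<Rightarrow> germ"
        by (induction A rule: infinite_finite_induct) (simp_all add: scale_jet_def)
      then show ?thesis .
    qed
    finally show ?thesis
      using fB abl(2)
      by (simp add: sum.Plus M_def N_def L_def c_def jet_coord_unit mult.commute)
        (simp add: jet_coord_def abl(1) truncate_jet_def mult.commute)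
  qed
  have dx: "(\<Sum>i\<in>?I. N \<alpha> i * (ddx (M i \<alpha>) + (\<Sum>j\<in>?I. \<theta>x i j * M j \<alpha>))) = L \<alpha> (spencer_x ?n (lift_jet (c \<alpha>)))"
    and dy: "(\<Sum>i\<in>?I. N \<alpha> i * (ddy (M i \<alpha>) + (\<Sum>j\<in>?I. \<theta>y i j * M j \<alpha>))) = L \<alpha> (spencer_y ?n (lift_jet (c \<alpha>)))"
    if \<alpha>: "\<alpha> \<in> ?K" for \<alpha>
  proof -
    have cj: "lift_jet (c \<alpha>) \<in> jets F (Suc ?n)"
      unfolding lift_jet_def Suc_d by (rule solved_jet(1)[OF d3 order_refl])
    have lin: "(\<Sum>j\<in>?I. lift_jet (unit_jet j) a b l * M j \<alpha>) = lift_jet (c \<alpha>) a b l" for a b l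
      unfolding M_def
    proof (rule linear_functional_expand[OF _ _ c_jets[OF \<alpha>]])
      show "lift_jet (f + g) a b l = lift_jet f a b l + lift_jet g a b l" for f g
        unfolding lift_jet_add by simp
      show "lift_jet (scale_jet r f) a b l = r * lift_jet f a b l" for r f
        unfolding lift_jet_scale by (simp add: scale_jet_def)
    qed
    have tr: "lift_jet (c \<alpha>) a b l = c \<alpha> a b l" if "a + b \<le> ?n" for a b l
      using fun_cong[OF fun_cong[OF fun_cong[OF truncate_lift[OF c_jets[OF \<alpha>]]]], of a b l] that
      by (simp add: truncate_jet_def)
    have x: "ddx (M i \<alpha>) + (\<Sum>j\<in>?I. \<theta>x i j * M j \<alpha>) = jet_coord (spencer_x ?n (lift_jet (c \<alpha>))) i"
      and y: "ddy (M i \<alpha>) + (\<Sum>j\<in>?I. \<theta>y i j * M j \<alpha>) = jet_coord (spencer_y ?n (lift_jet (c \<alpha>))) i"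
      if "i \<in> ?I" for i
    proof -
      obtain a b l where abl: "i = (a, b, l)" "a + b \<le> ?n" using \<open>i \<in> ?I\<close> by (auto simp: jet_index_def)
      show "ddx (M i \<alpha>) + (\<Sum>j\<in>?I. \<theta>x i j * M j \<alpha>) = jet_coord (spencer_x ?n (lift_jet (c \<alpha>))) i"
        and "ddy (M i \<alpha>) + (\<Sum>j\<in>?I. \<theta>y i j * M j \<alpha>) = jet_coord (spencer_y ?n (lift_jet (c \<alpha>))) i"
        using abl(2) by (simp_all add: abl(1) \<theta>x_def \<theta>y_def sum_negf lin)
          (simp_all add: jet_coord_def M_def spencer_x_def spencer_y_def tr)
    qed
    show "(\<Sum>i\<in>?I. N \<alpha> i * (ddx (M i \<alpha>) + (\<Sum>j\<in>?I. \<theta>x i j * M j \<alpha>))) = L \<alpha> (spencer_x ?n (lift_jet (c \<alpha>)))"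
      unfolding L_expand[OF spencer_x_jets[OF cj], symmetric] by (intro sum.cong refl) (simp add: x)
    show "(\<Sum>i\<in>?I. N \<alpha> i * (ddy (M i \<alpha>) + (\<Sum>j\<in>?I. \<theta>y i j * M j \<alpha>))) = L \<alpha> (spencer_y ?n (lift_jet (c \<alpha>)))"
      unfolding L_expand[OF spencer_y_jets[OF cj], symmetric] by (intro sum.cong refl) (simp add: y)
  qed
  have tx: "(\<Sum>\<alpha>\<in>?K. \<Sum>i\<in>?I. N \<alpha> i * (ddx (M i \<alpha>) + (\<Sum>j\<in>?I. \<theta>x i j * M j \<alpha>))) =
      (\<Sum>v\<in>B. fst (connection_matrix F B v v))"
  proof -
    have "(\<Sum>\<alpha>\<in>?K. \<Sum>i\<in>?I. N \<alpha> i * (ddx (M i \<alpha>) + (\<Sum>j\<in>?I. \<theta>x i j * M j \<alpha>))) =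
        (\<Sum>\<alpha>\<in>?K. L \<alpha> (spencer_x ?n (lift_jet (c \<alpha>))))" by (intro sum.cong refl dx)
    also have "\<dots> = (\<Sum>v\<in>B. L (Inl v) (spencer_x ?n (lift_jet (c (Inl v))))) +
        (\<Sum>e\<in>eq_index. L (Inr e) (spencer_x ?n (lift_jet (c (Inr e)))))"
      using fB by (simp add: sum.Plus)
    \<comment> \<open>On \<open>B\<close> the lift of a truncated element is the element itself,
      which yields the diagonal of \<open>\<nabla>\<close>; the equations contribute
      nothing.\<close>
    also have "\<dots> = (\<Sum>v\<in>B. fst (connection_matrix F B v v))"
      by (simp add: L_def c_def eq_value_spencer_eq_jet connection_matrix_def lift_truncate BE nabla_eq)
    finally show ?thesis .
  qed
  have ty: "(\<Sum>\<alpha>\<in>?K. \<Sum>i\<in>?I. N \<alpha> i * (ddy (M i \<alpha>) + (\<Sum>j\<in>?I. \<theta>y i j * M j \<alpha>))) =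
      (\<Sum>v\<in>B. snd (connection_matrix F B v v))"
  proof -
    have "(\<Sum>\<alpha>\<in>?K. \<Sum>i\<in>?I. N \<alpha> i * (ddy (M i \<alpha>) + (\<Sum>j\<in>?I. \<theta>y i j * M j \<alpha>))) =
        (\<Sum>\<alpha>\<in>?K. L \<alpha> (spencer_y ?n (lift_jet (c \<alpha>))))" by (intro sum.cong refl dy)
    also have "\<dots> = (\<Sum>v\<in>B. L (Inl v) (spencer_y ?n (lift_jet (c (Inl v))))) +
        (\<Sum>e\<in>eq_index. L (Inr e) (spencer_y ?n (lift_jet (c (Inr e)))))"
      using fB by (simp add: sum.Plus)
    also have "\<dots> = (\<Sum>v\<in>B. snd (connection_matrix F B v v))"
      by (simp add: L_def c_def eq_value_spencer_eq_jet connection_matrix_def lift_truncate BE nabla_eq)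
    finally show ?thesis .
  qed
  have "(\<Sum>v\<in>B. curvature_matrix F B v v) = (\<Sum>v\<in>B. d1 (connection_matrix F B v v))"
    by (simp add: curvature_matrix_def sum.distrib trace_wedge_eq_0)
  also have "\<dots> = d1 (\<Sum>v\<in>B. fst (connection_matrix F B v v), \<Sum>v\<in>B. snd (connection_matrix F B v v))"
    by (simp add: d1_def sum_subtractf)
  also have "\<dots> = d1 (\<Sum>i\<in>?I. \<theta>x i i, \<Sum>i\<in>?I. \<theta>y i i)"
    unfolding tx[symmetric] ty[symmetric]
    by (rule d1_trace_change_of_basis[OF _ _ NM MN]) (use fB in simp_all)
  also have "(\<Sum>i\<in>?I. \<theta>x i i) = (\<Sum>(a, b, l)\<in>?I. - lift_jet (unit_jet (a, b, l)) (Suc a) b l)"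
    by (simp add: \<theta>x_def case_prod_unfold)
  also have "(\<Sum>i\<in>?I. \<theta>y i i) = (\<Sum>(a, b, l)\<in>?I. - lift_jet (unit_jet (a, b, l)) a (Suc b) l)"
    by (simp add: \<theta>y_def case_prod_unfold)
  finally show ?thesis unfolding trace_lift_x trace_lift_y .
qed

text \<open>On \<open>E\<close> the equation values vanish and the free entries, indexed by
  \<open>P\<close>, are coordinates; \<open>g\<close> is the dual basis.\<close>

lemma basis_of_E_exists: "\<exists>B. is_basis_of_E F B"
proof -
  let ?d = "degree F"
  define P where "P = {(k, l). k \<le> ?d - 2 \<and> k + 3 \<le> l \<and> l \<le> ?d}"
  have P: "finite P" by (rule finite_subset[of _ "{..?d} \<times> {..?d}"]) (auto simp: P_def)
  define g where "g = (\<lambda>p. solved_jet F (?d - 2) (\<lambda>k l. if (k, l) = p then 1 else 0) (\<lambda>s t m. 0))"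
  have gE: "g p \<in> E_module F" for p by (simp add: E_module_iff g_def solved_jet[OF d3])
  have g0: "g p 0 k l = (if (k, l) = p then 1 else 0)" if "(k, l) \<in> P" for p k l
    using that by (simp add: g_def P_def solved_jet(3)[OF d3])
  have inj: "inj_on g P"
  proof (rule inj_onI)
    fix p q assume "p \<in> P" "q \<in> P" "g p = g q"
    then show "p = q" using g0[of "fst p" "snd p" p] g0[of "fst p" "snd p" q] by (auto split: if_splits)
  qed
  have sum_apply: "(\<Sum>p\<in>A. scale_jet (r p) (g p)) a b l = (\<Sum>p\<in>A. r p * g p a b l)" for A r a b l
    by (induction A rule: infinite_finite_induct) (simp_all add: scale_jet_def)
  have coord: "(\<Sum>p\<in>P. scale_jet (r p) (g p)) 0 k l = r (k, l)" if "(k, l) \<in> P" for r k l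
  proof -
    have "(\<Sum>p\<in>P. scale_jet (r p) (g p)) 0 k l = (\<Sum>p\<in>P. if p = (k, l) then r p else 0)"
      unfolding sum_apply by (intro sum.cong refl) (auto simp: g0[OF that])
    then show ?thesis using that P by simp
  qed
  have E_sub: "jet.subspace (E_module F)"
    unfolding jet.subspace_def
    by (auto simp: E_module_iff jets_0 jets_add jets_scale apply_expr_add apply_expr_scale)
  have "jet.independent (g ` P)"
    unfolding jet.dependent_finite[OF finite_imageI[OF P]]
  proof safe
    fix u p assume *: "(\<Sum>v\<in>g ` P. scale_jet (u v) v) = 0" and p: "p \<in> P" and nz: "u (g p) \<noteq> 0"
    have "(\<Sum>q\<in>P. scale_jet (u (g q)) (g q)) = 0"
      using * by (simp add: sum.reindex[OF inj])
    then have "(\<Sum>q\<in>P. scale_jet (u (g q)) (g q)) 0 (fst p) (snd p) = 0" by simp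
    then show False using coord[of "fst p" "snd p" "\<lambda>q. u (g q)"] p nz by simp
  qed
  moreover have "jet.span (g ` P) = E_module F"
  proof
    show "jet.span (g ` P) \<subseteq> E_module F" by (rule jet.span_minimal[OF _ E_sub]) (use gE in auto)
    show "E_module F \<subseteq> jet.span (g ` P)"
    proof
      fix f assume f: "f \<in> E_module F"
      define h where "h = (\<Sum>p\<in>P. scale_jet (f 0 (fst p) (snd p)) (g p))"
      have h: "h \<in> jet.span (g ` P)" unfolding h_def
        by (intro jet.span_sum jet.span_scale jet.span_base imageI)
      have hE: "h \<in> E_module F" unfolding h_def
        by (intro jet.subspace_sum[OF E_sub] jet.subspace_scale[OF E_sub] gE)
      have "f = h"
        by (rule jet_eqI[OF d3, of _ "?d - 2"])
          (use f hE coord[of _ _ "\<lambda>p. f 0 (fst p) (snd p)"] in \<open>auto simp: E_module_iff h_def P_def\<close>)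
      then show "f \<in> jet.span (g ` P)" using h by simp
    qed
  qed
  ultimately show ?thesis using P unfolding is_basis_of_E_def by blast
qed

text \<open>The formula of \<open>curvature_trace_of_basis\<close> does not involve
  \<open>B\<close>, so the definite description is justified.\<close>

lemma curvature_trace_eq:
  "curvature_trace F =
    d1 (\<Sum>l = 3..degree F. of_nat (l - 2) * equation F (degree F - l) 0 0 l,
        \<Sum>l = 3..degree F. of_nat (degree F + 1 - l) * equation F (degree F + 1 - l) 0 0 l)"
  unfolding curvature_trace_def
  using basis_of_E_exists curvature_trace_of_basis by (intro the_equality) auto

end

section \<open>Lagrange interpolation at the slopes\<close>

lemma unit_div_cancel:
  fixes a b :: germ
  assumes "b dvd 1"
  shows "b * (a div b) = a"
proof -
  obtain c where c: "1 = b * c" using assms ..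
  then have "a = b * (c * a)" by (metis mult.assoc mult_1)
  moreover have "b \<noteq> 0" using c by auto
  ultimately have "a div b = c * a" by (metis nonzero_mult_div_cancel_left)
  then show ?thesis using \<open>a = b * (c * a)\<close> by simp
qed

lemma unit_eq_divI:
  fixes a b c :: germ
  assumes "b dvd 1" "b * c = a"
  shows "a div b = c"
proof -
  have "b \<noteq> 0" using assms(1) by auto
  then show ?thesis using assms(2) by (metis nonzero_mult_div_cancel_left)
qed

text \<open>Here \<open>b = 1 / a\<close>, and the form is the logarithmic differential of
  \<open>a\<close>.\<close>

lemma d1_dlog:
  assumes "a * b = 1"
  shows "d1 (b * ddx a, b * ddy a) = 0"
proof -
  have x: "ddx b = - b * b * ddx a" and y: "ddy b = - b * b * ddy a"
  proof -
    have "b * (ddx a * b + a * ddx b) = 0" using arg_cong[OF assms, of ddx] by (simp add: ddx_mult)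
    then have "b * b * ddx a + (a * b) * ddx b = 0" by (simp only: algebra_simps)
    then show "ddx b = - b * b * ddx a" using assms by (simp add: eq_neg_iff_add_eq_0 add.commute)
    have "b * (ddy a * b + a * ddy b) = 0" using arg_cong[OF assms, of ddy] by (simp add: ddy_mult)
    then have "b * b * ddy a + (a * b) * ddy b = 0" by (simp only: algebra_simps)
    then show "ddy b = - b * b * ddy a" using assms by (simp add: eq_neg_iff_add_eq_0 add.commute)
  qed
  show ?thesis by (simp add: d1_def ddx_mult ddy_mult ddx_ddy x y)
qed

lemma poly_as_coeff_sums:
  fixes q :: "germ poly"
  assumes "degree q \<le> n"
  shows "poly q x = (\<Sum>k\<le>n. coeff q k * x ^ k)"
    and "poly (pderiv q) x = (\<Sum>k\<le>n. coeff q k * (of_nat k * x ^ (k - 1)))"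
    and "poly (pderiv (pderiv q)) x = (\<Sum>k\<le>n. coeff q k * (of_nat k * (of_nat (k - 1) * x ^ (k - 2))))"
proof -
  have q: "(\<Sum>k\<le>n. monom (coeff q k) k) = q" by (rule poly_as_sum_of_monoms'[OF assms])
  show "poly q x = (\<Sum>k\<le>n. coeff q k * x ^ k)"
    by (subst q[symmetric]) (simp add: poly_sum poly_monom)
  show "poly (pderiv q) x = (\<Sum>k\<le>n. coeff q k * (of_nat k * x ^ (k - 1)))"
    by (subst q[symmetric]) (simp add: poly_sum poly_monom pderiv_sum pderiv_monom mult_ac)
  show "poly (pderiv (pderiv q)) x = (\<Sum>k\<le>n. coeff q k * (of_nat k * (of_nat (k - 1) * x ^ (k - 2))))"
    by (subst q[symmetric]) (simp add: poly_sum poly_monom pderiv_sum pderiv_monom mult_ac numeral_2_eq_2)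
qed

lemma prod_linear:
  fixes p :: "nat \<Rightarrow> germ"
  assumes "finite J"
  shows "degree (\<Prod>j\<in>J. [:- p j, 1:]) = card J" and "coeff (\<Prod>j\<in>J. [:- p j, 1:]) (card J) = 1"
proof -
  have "degree (\<Prod>j\<in>J. [:- p j, 1:]) = card J \<and> coeff (\<Prod>j\<in>J. [:- p j, 1:]) (card J) = 1"
    using assms
  proof induction
    case (insert x J)
    then have "(\<Prod>j\<in>J. [:- p j, 1:]) \<noteq> 0" by auto
    then have "degree (\<Prod>j\<in>insert x J. [:- p j, 1:]) = Suc (card J)"
      using insert by (simp add: degree_mult_eq del: mult_pCons_left)
    then show ?case using insert
      by (simp add: coeff_eq_0)
  qed simp
  then show "degree (\<Prod>j\<in>J. [:- p j, 1:]) = card J" "coeff (\<Prod>j\<in>J. [:- p j, 1:]) (card J) = 1" by auto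
qed

lemma coeff_prod_linear_second:
  fixes p :: "nat \<Rightarrow> germ"
  assumes "finite J" "card J = Suc n"
  shows "coeff (\<Prod>j\<in>J. [:- p j, 1:]) n = - (\<Sum>j\<in>J. p j)"
  using assms
proof (induction J arbitrary: n)
  case (insert x J)
  show ?case
  proof (cases n)
    case 0
    then show ?thesis using insert by simp
  next
    case (Suc m)
    then have "card J = Suc m" using insert by simp
    then show ?thesis using insert.IH[of m] insert.hyps prod_linear(2)[of J p] Suc by simp
  qed
qed simp

text \<open>
  \<open>recip p i j\<close> is \<open>1 / (p\<^sub>i - p\<^sub>j)\<close>. In terms of the Lagrange polynomial \<open>\<ell>\<^sub>i\<close>,
  \<open>lagr_weight\<close> is its leading coefficient, \<open>lagr_d1\<close> is \<open>\<ell>\<^sub>i'(p\<^sub>i)\<close>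
  and \<open>lagr_d2\<close> is \<open>\<ell>\<^sub>i''(p\<^sub>i)\<close>.
\<close>

definition recip :: "(nat \<Rightarrow> germ) \<Rightarrow> nat \<Rightarrow> nat \<Rightarrow> germ" where
  "recip p i j = 1 div (p i - p j)"

definition lagr_weight :: "nat set \<Rightarrow> (nat \<Rightarrow> germ) \<Rightarrow> nat \<Rightarrow> germ" where
  "lagr_weight I p i = (\<Prod>j\<in>I - {i}. recip p i j)"

definition lagr_d1 :: "nat set \<Rightarrow> (nat \<Rightarrow> germ) \<Rightarrow> nat \<Rightarrow> germ" where
  "lagr_d1 I p i = (\<Sum>j\<in>I - {i}. recip p i j)"

definition lagr_d2 :: "nat set \<Rightarrow> (nat \<Rightarrow> germ) \<Rightarrow> nat \<Rightarrow> germ" where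
  "lagr_d2 I p i = (\<Sum>j\<in>I - {i}. \<Sum>k\<in>I - {i} - {j}. recip p i j * recip p i k)"

definition lagr_poly :: "nat set \<Rightarrow> (nat \<Rightarrow> germ) \<Rightarrow> nat \<Rightarrow> germ poly" where
  "lagr_poly I p i = smult (lagr_weight I p i) (\<Prod>j\<in>I - {i}. [:- p j, 1:])"

text \<open>The derivative along the leaves \<open>dy = c dx\<close>.\<close>

definition dleaf :: "germ \<Rightarrow> germ \<Rightarrow> germ" where
  "dleaf c a = ddx a + c * ddy a"

lemma dleaf_mult: "dleaf c (a * b) = dleaf c a * b + a * dleaf c b"
  by (simp add: dleaf_def ddx_mult ddy_mult algebra_simps)

lemma dleaf_1 [simp]: "dleaf c 1 = 0"
  by (simp add: dleaf_def)

lemma dleaf_inverse: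
  assumes "a * b = 1"
  shows "dleaf c b = - (dleaf c a * b) * b"
proof -
  have "b * (dleaf c a * b + a * dleaf c b) = 0" using arg_cong[OF assms, of "dleaf c"] by (simp add: dleaf_mult)
  then have "dleaf c a * b * b + (a * b) * dleaf c b = 0" by (simp only: algebra_simps)
  then show ?thesis using assms by (simp add: eq_neg_iff_add_eq_0 add.commute)
qed

text \<open>The index set is a parameter because the results are applied to all leaves, to three of
  them, and to all but one.\<close>

locale distinct_slopes =
  fixes I :: "nat set" and p :: "nat \<Rightarrow> germ"
  assumes fin [simp]: "finite I"
    and unit: "i \<in> I \<Longrightarrow> j \<in> I \<Longrightarrow> i \<noteq> j \<Longrightarrow> p i - p j dvd 1"
begin

lemma recip: "i \<in> I \<Longrightarrow> j \<in> I \<Longrightarrow> i \<noteq> j \<Longrightarrow> (p i - p j) * recip p i j = 1"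
  by (simp add: recip_def unit_div_cancel unit)

lemma recip_swap:
  assumes "i \<in> I" "j \<in> I" "i \<noteq> j"
  shows "recip p j i = - recip p i j"
proof -
  have "recip p j i = recip p j i * ((p i - p j) * recip p i j)" using recip[OF assms] by simp
  also have "\<dots> = - (((p j - p i) * recip p j i) * recip p i j)" by (simp add: algebra_simps)
  also have "\<dots> = - recip p i j" using recip[of j i] assms by simp
  finally show ?thesis .
qed

lemma recip_eq: "i \<in> I \<Longrightarrow> j \<in> I \<Longrightarrow> i \<noteq> j \<Longrightarrow> p i * recip p i j = 1 + p j * recip p i j"
  using recip[of i j] by (simp add: algebra_simps)

text \<open>The Lagrange weights of three nodes add up to 0, the leading coefficient of the
  interpolation of the constant 1.\<close>

lemma recip_three:
  assumes "i \<in> I" "j \<in> I" "k \<in> I" "i \<noteq> j" "i \<noteq> k" "j \<noteq> k"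
  shows "recip p j i * recip p j k + recip p k i * recip p k j = - (recip p i j * recip p i k)"
proof -
  let ?a = "recip p i j" and ?b = "recip p i k" and ?c = "recip p j k"
  have ab: "(p i - p j) * ?a = 1" "(p i - p k) * ?b = 1" "(p j - p k) * ?c = 1"
    using recip assms by auto
  have "?c * ?b - ?c * ?a = ?c * ?b * ((p i - p j) * ?a) - ?c * ?a * ((p i - p k) * ?b)"
    by (simp add: ab)
  also have "\<dots> = - (?a * ?b * ((p j - p k) * ?c))" by (simp add: algebra_simps)
  also have "\<dots> = - (?a * ?b)" by (simp add: ab)
  finally show ?thesis
    using assms by (simp add: recip_swap[of i j] recip_swap[of i k] recip_swap[of j k] algebra_simps)
qed

lemma weight_prod:
  assumes "J \<subseteq> I - {i}" "i \<in> I"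
  shows "(\<Prod>j\<in>J. recip p i j) * (\<Prod>j\<in>J. p i - p j) = 1"
proof -
  have "(\<Prod>j\<in>J. recip p i j * (p i - p j)) = 1"
    by (rule prod.neutral) (use assms recip in \<open>auto simp: mult.commute\<close>)
  then show ?thesis by (simp add: prod.distrib)
qed

lemma lagr_poly_eval:
  assumes "i \<in> I" "j \<in> I"
  shows "poly (lagr_poly I p i) (p j) = (if i = j then 1 else 0)"
proof (cases "i = j")
  case True
  then show ?thesis using weight_prod[of "I - {i}" i] assms
    by (simp add: lagr_poly_def poly_prod lagr_weight_def)
next
  case False
  then show ?thesis using assms by (auto simp: lagr_poly_def poly_prod)
qed

lemma degree_lagr_poly: "i \<in> I \<Longrightarrow> degree (lagr_poly I p i) \<le> card I - 1"
  unfolding lagr_poly_def using degree_smult_le[of "lagr_weight I p i" "\<Prod>j\<in>I - {i}. [:- p j, 1:]"]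
  by (simp add: prod_linear)

lemma coeff_lagr_poly: "i \<in> I \<Longrightarrow> coeff (lagr_poly I p i) (card I - 1) = lagr_weight I p i"
  unfolding lagr_poly_def using prod_linear(2)[of "I - {i}" p] by simp

lemma weight_prod_minus:
  assumes "a \<in> I - {i}" "i \<in> I" "J \<subseteq> I - {i}" "a \<in> J"
  shows "(\<Prod>j\<in>J. recip p i j) * (\<Prod>j\<in>J - {a}. p i - p j) = recip p i a"
proof -
  have "finite J" using assms(3) finite_subset by fastforce
  then have "(\<Prod>j\<in>J. recip p i j) = recip p i a * (\<Prod>j\<in>J - {a}. recip p i j)"
    using assms by (subst prod.remove[of J a]) auto
  moreover have "(\<Prod>j\<in>J - {a}. recip p i j) * (\<Prod>j\<in>J - {a}. p i - p j) = 1"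
    using assms by (intro weight_prod) auto
  ultimately show ?thesis by (simp add: mult.assoc)
qed

lemma poly_pderiv_lagr_poly:
  assumes i: "i \<in> I"
  shows "poly (pderiv (lagr_poly I p i)) (p i) = lagr_d1 I p i"
proof -
  let ?J = "I - {i}"
  have "pderiv (lagr_poly I p i) = smult (lagr_weight I p i) (\<Sum>a\<in>?J. \<Prod>j\<in>?J - {a}. [:- p j, 1:])"
    by (simp add: lagr_poly_def pderiv_smult pderiv_prod pderiv_pCons)
  then have "poly (pderiv (lagr_poly I p i)) (p i) = (\<Sum>a\<in>?J. lagr_weight I p i * (\<Prod>j\<in>?J - {a}. p i - p j))"
    by (simp add: poly_sum poly_prod sum_distrib_left)
  also have "\<dots> = lagr_d1 I p i"
    unfolding lagr_d1_def lagr_weight_def using i by (intro sum.cong refl weight_prod_minus) auto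
  finally show ?thesis .
qed

lemma poly_pderiv2_lagr_poly:
  assumes i: "i \<in> I"
  shows "poly (pderiv (pderiv (lagr_poly I p i))) (p i) = lagr_d2 I p i"
proof -
  let ?J = "I - {i}"
  have "pderiv (pderiv (lagr_poly I p i)) =
      smult (lagr_weight I p i) (\<Sum>a\<in>?J. \<Sum>b\<in>?J - {a}. \<Prod>j\<in>?J - {a} - {b}. [:- p j, 1:])"
    by (simp add: lagr_poly_def pderiv_smult pderiv_prod pderiv_pCons pderiv_sum)
  then have "poly (pderiv (pderiv (lagr_poly I p i))) (p i) =
      (\<Sum>a\<in>?J. \<Sum>b\<in>?J - {a}. lagr_weight I p i * (\<Prod>j\<in>?J - {a} - {b}. p i - p j))"
    by (simp add: poly_sum poly_prod sum_distrib_left)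
  also have "\<dots> = lagr_d2 I p i"
    unfolding lagr_d2_def
  proof (intro sum.cong refl)
    fix a b assume ab: "a \<in> ?J" "b \<in> ?J - {a}"
    have "lagr_weight I p i = recip p i a * (\<Prod>j\<in>?J - {a}. recip p i j)"
      unfolding lagr_weight_def using ab by (subst prod.remove[of ?J a]) auto
    moreover have "(\<Prod>j\<in>?J - {a}. recip p i j) * (\<Prod>j\<in>?J - {a} - {b}. p i - p j) = recip p i b"
      by (rule weight_prod_minus) (use ab i in auto)
    ultimately show "lagr_weight I p i * (\<Prod>j\<in>?J - {a} - {b}. p i - p j) = recip p i a * recip p i b"
      by (simp add: mult.assoc)
  qed
  finally show ?thesis .
qed

lemma inj_slopes: "inj_on p I"
  by (rule inj_onI) (use unit in fastforce)

lemma poly_eq_on_slopes: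
  fixes q r :: "germ poly"
  assumes "degree q < card I" "degree r < card I" "\<And>i. i \<in> I \<Longrightarrow> poly q (p i) = poly r (p i)"
  shows "q = r"
proof (rule ccontr)
  assume "q \<noteq> r"
  then have "q - r \<noteq> 0" by simp
  then have "card {x. poly (q - r) x = 0} \<le> degree (q - r)" and fin': "finite {x. poly (q - r) x = 0}"
    using card_poly_roots_bound poly_roots_finite by blast+
  moreover have "card (p ` I) \<le> card {x. poly (q - r) x = 0}"
    using assms(3) by (intro card_mono fin') auto
  ultimately have "card I \<le> degree (q - r)" using card_image[OF inj_slopes] by simp
  then show False using degree_diff_less[OF assms(1,2)] by simp
qed

section \<open>Interpolation and Euler's identities\<close>

definition interp :: "(nat \<Rightarrow> germ) \<Rightarrow> germ poly" where
  "interp v = (\<Sum>i\<in>I. smult (v i) (lagr_poly I p i))"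

lemma interp_eval: "j \<in> I \<Longrightarrow> poly (interp v) (p j) = v j"
  by (simp add: interp_def poly_sum lagr_poly_eval if_distrib[of "\<lambda>x. _ * x"] cong: if_cong)

lemma degree_interp: "degree (interp v) \<le> card I - 1"
  unfolding interp_def
  by (rule degree_sum_le[OF fin]) (meson degree_smult_le degree_lagr_poly order_trans)

lemma coeff_interp: "coeff (interp v) m = (\<Sum>i\<in>I. v i * coeff (lagr_poly I p i) m)"
  by (simp add: interp_def coeff_sum)

lemma coeff_interp_top: "coeff (interp v) (card I - 1) = (\<Sum>i\<in>I. v i * lagr_weight I p i)"
  unfolding coeff_interp by (intro sum.cong refl) (simp only: coeff_lagr_poly)

lemma interp_unique:
  assumes "degree q < card I" "\<And>i. i \<in> I \<Longrightarrow> poly q (p i) = v i"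
  shows "interp v = q"
proof (rule poly_eq_on_slopes[OF _ assms(1)])
  show "degree (interp v) < card I"
    using degree_interp[of v] assms(1) by linarith
qed (simp add: interp_eval assms(2))

text \<open>The sum is the leading coefficient of the interpolation of \<open>x ^ k\<close>, which
  for \<open>k < card I\<close> is \<open>x ^ k\<close> itself.\<close>

lemma sum_weight_power:
  assumes "k < card I"
  shows "(\<Sum>i\<in>I. p i ^ k * lagr_weight I p i) = (if k = card I - 1 then 1 else 0)"
proof -
  have "interp (\<lambda>i. p i ^ k) = monom 1 k"
    using assms by (intro interp_unique) (auto simp: poly_monom degree_monom_eq)
  then show ?thesis using coeff_interp_top[of "\<lambda>i. p i ^ k"] by (metis coeff_monom)
qed

text \<open>At the nodes \<open>x ^ d\<close> agrees with \<open>x ^ d\<close> minus the product of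
  the \<open>x - p j\<close>, a polynomial of degree below \<open>d\<close> with second coefficient
  known from that product.\<close>

lemma sum_weight_power_card:
  assumes "I \<noteq> {}"
  shows "(\<Sum>i\<in>I. p i ^ card I * lagr_weight I p i) = (\<Sum>i\<in>I. p i)"
proof -
  let ?P = "\<Prod>j\<in>I. [:- p j, 1:]" and ?d = "card I"
  obtain n where n: "?d = Suc n" using assms fin by (metis card_gt_0_iff gr0_implies_Suc)
  let ?q = "monom 1 ?d - ?P"
  have "degree ?q \<le> ?d"
    by (rule degree_diff_le) (simp_all add: degree_monom_eq prod_linear)
  moreover have "coeff ?q ?d = 0" using prod_linear(2)[of I p] by simp
  ultimately have deg: "degree ?q < ?d"
    using eq_zero_or_degree_less[of ?q ?d] n by auto
  have "interp (\<lambda>i. p i ^ ?d) = ?q"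
    by (rule interp_unique[OF deg]) (auto simp: poly_monom poly_prod)
  then have "(\<Sum>i\<in>I. p i ^ ?d * lagr_weight I p i) = coeff ?q (?d - 1)"
    by (metis coeff_interp_top)
  also have "\<dots> = (\<Sum>i\<in>I. p i)"
    using coeff_prod_linear_second[OF fin n, of p] n by simp
  finally show ?thesis .
qed

subsection \<open>Symmetric sums\<close>

lemma sum_pairs_swap: "(\<Sum>i\<in>I. \<Sum>j\<in>I - {i}. h i j) = (\<Sum>i\<in>I. \<Sum>j\<in>I - {i}. h j i)"
  for h :: "nat \<Rightarrow> nat \<Rightarrow> germ"
proof -
  have *: "(\<Sum>i\<in>I. \<Sum>j\<in>I - {i}. h i j) = (\<Sum>i\<in>I. \<Sum>j\<in>I. if i \<noteq> j then h i j else 0)" for h :: "nat \<Rightarrow> nat \<Rightarrow> germ"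
    by (intro sum.cong refl sum.mono_neutral_cong_left) auto
  show ?thesis unfolding * by (subst sum.swap) (intro sum.cong refl, auto)
qed

lemma sum_lagr_d1: "(\<Sum>i\<in>I. lagr_d1 I p i) = 0"
proof -
  let ?s = "\<Sum>i\<in>I. \<Sum>j\<in>I - {i}. recip p i j"
  have "?s = (\<Sum>i\<in>I. \<Sum>j\<in>I - {i}. recip p j i)" by (rule sum_pairs_swap)
  also have "\<dots> = - ?s" unfolding sum_negf[symmetric]
    by (intro sum.cong refl recip_swap) auto
  finally have "?s + ?s = 0" by (metis eq_neg_iff_add_eq_0)
  then have "2 * ?s = 0" by (simp only: mult_2)
  then show ?thesis by (simp add: lagr_d1_def)
qed

text \<open>Adding the sum with \<open>i\<close> and \<open>j\<close> exchanged pairs the terms, and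
  \<open>p i / (p i - p j) + p j / (p j - p i) = 1\<close>. In \<open>sum_slope2_lagr_d1\<close>,
  with squares in the numerators, a pair gives \<open>p i + p j\<close>.\<close>

lemma sum_slope_lagr_d1: "2 * (\<Sum>i\<in>I. p i * lagr_d1 I p i) = of_nat (card I * (card I - 1))"
proof -
  let ?s = "\<Sum>i\<in>I. \<Sum>j\<in>I - {i}. p i * recip p i j"
  let ?t = "(\<Sum>i\<in>I. \<Sum>j\<in>I - {i}. p j * recip p j i)"
  have "2 * ?s = ?s + ?t"
    unfolding mult_2 by (rule arg_cong2[where f = "(+)", OF refl sum_pairs_swap])
  also have "\<dots> = (\<Sum>i\<in>I. \<Sum>j\<in>I - {i}. p i * recip p i j + p j * recip p j i)"
    by (simp only: sum.distrib)
  also have "\<dots> = (\<Sum>i\<in>I. \<Sum>j\<in>I - {i}. 1)"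
  proof (intro sum.cong refl)
    fix i j assume "i \<in> I" "j \<in> I - {i}"
    then show "p i * recip p i j + p j * recip p j i = 1"
      using recip[of i j] recip_swap[of i j] by (simp add: algebra_simps)
  qed
  also have "\<dots> = of_nat (card I * (card I - 1))" by simp
  finally show ?thesis by (simp add: lagr_d1_def sum_distrib_left)
qed

lemma sum_slope2_lagr_d1: "(\<Sum>i\<in>I. p i * p i * lagr_d1 I p i) = of_nat (card I - 1) * (\<Sum>i\<in>I. p i)"
proof -
  let ?s = "\<Sum>i\<in>I. \<Sum>j\<in>I - {i}. p i * p i * recip p i j"
  let ?t = "(\<Sum>i\<in>I. \<Sum>j\<in>I - {i}. p j * p j * recip p j i)"
  have "2 * ?s = ?s + ?t"
    unfolding mult_2 by (rule arg_cong2[where f = "(+)", OF refl sum_pairs_swap])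
  also have "\<dots> = (\<Sum>i\<in>I. \<Sum>j\<in>I - {i}. p i * p i * recip p i j + p j * p j * recip p j i)"
    by (simp only: sum.distrib)
  also have "\<dots> = (\<Sum>i\<in>I. \<Sum>j\<in>I - {i}. p i + p j)"
  proof (intro sum.cong refl)
    fix i j assume *: "i \<in> I" "j \<in> I - {i}"
    have "p i * p i * recip p i j + p j * p j * recip p j i = (p i + p j) * ((p i - p j) * recip p i j)"
      using * recip_swap[of i j] by (simp add: algebra_simps)
    then show "p i * p i * recip p i j + p j * p j * recip p j i = p i + p j"
      using * recip[of i j] by simp
  qed
  also have "\<dots> = (\<Sum>i\<in>I. \<Sum>j\<in>I - {i}. p i) + (\<Sum>i\<in>I. \<Sum>j\<in>I - {i}. p j)"
    by (simp add: sum.distrib)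
  also have "(\<Sum>i\<in>I. \<Sum>j\<in>I - {i}. p j) = (\<Sum>i\<in>I. \<Sum>j\<in>I - {i}. p i)" by (rule sum_pairs_swap)
  also have "(\<Sum>i\<in>I. \<Sum>j\<in>I - {i}. p i) = of_nat (card I - 1) * (\<Sum>i\<in>I. p i)"
    by (simp add: sum_distrib_left)
  finally have "2 * ?s = 2 * (of_nat (card I - 1) * (\<Sum>i\<in>I. p i))" by (simp only: mult_2)
  then have "?s = of_nat (card I - 1) * (\<Sum>i\<in>I. p i)"
    by (rule mult_left_cancel[THEN iffD1, rotated]) simp
  then show ?thesis by (simp add: lagr_d1_def sum_distrib_left)
qed

lemma lagr_d1_squared:
  assumes "i \<in> I"
  shows "lagr_d1 I p i * lagr_d1 I p i = (\<Sum>j\<in>I - {i}. recip p i j * recip p i j) + lagr_d2 I p i"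
proof -
  have "lagr_d1 I p i * lagr_d1 I p i = (\<Sum>j\<in>I - {i}. \<Sum>k\<in>I - {i}. recip p i j * recip p i k)"
    by (simp add: lagr_d1_def sum_product)
  also have "\<dots> = (\<Sum>j\<in>I - {i}. recip p i j * recip p i j + (\<Sum>k\<in>I - {i} - {j}. recip p i j * recip p i k))"
    by (intro sum.cong refl sum.remove) auto
  finally show ?thesis by (simp add: sum.distrib lagr_d2_def)
qed

text \<open>The term of index \<open>i\<close> in \<open>lagr_d1 I p j\<close> yields a square. The
  others form a sum over pairs \<open>j\<close>, \<open>k\<close>, which after symmetrisation is
  evaluated by \<open>recip_three\<close>.\<close>

lemma sum_lagr_d1_recip:
  assumes i: "i \<in> I"
  shows "2 * (\<Sum>j\<in>I - {i}. lagr_d1 I p j * recip p j i) =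
    2 * (\<Sum>j\<in>I - {i}. recip p i j * recip p i j) - lagr_d2 I p i"
proof -
  interpret J: distinct_slopes "I - {i}" p by standard (auto intro: unit)
  let ?J = "I - {i}"
  let ?s = "\<Sum>j\<in>?J. \<Sum>k\<in>?J - {j}. recip p j i * recip p j k"
  have "(\<Sum>j\<in>?J. lagr_d1 I p j * recip p j i) =
      (\<Sum>j\<in>?J. recip p i j * recip p i j + (\<Sum>k\<in>?J - {j}. recip p j i * recip p j k))"
  proof (intro sum.cong refl)
    fix j assume j: "j \<in> ?J"
    have "lagr_d1 I p j = recip p j i + (\<Sum>k\<in>I - {j} - {i}. recip p j k)"
      unfolding lagr_d1_def using i j by (intro sum.remove) auto
    moreover have "I - {j} - {i} = ?J - {j}" by auto
    moreover have "recip p j i * recip p j i = recip p i j * recip p i j"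
      using i j recip_swap[of i j] by simp
    ultimately show "lagr_d1 I p j * recip p j i =
        recip p i j * recip p i j + (\<Sum>k\<in>?J - {j}. recip p j i * recip p j k)"
      by (simp add: distrib_left distrib_right sum_distrib_left sum_distrib_right mult.commute)
  qed
  then have 1: "(\<Sum>j\<in>?J. lagr_d1 I p j * recip p j i) = (\<Sum>j\<in>?J. recip p i j * recip p i j) + ?s"
    by (simp add: sum.distrib)
  let ?t = "(\<Sum>j\<in>?J. \<Sum>k\<in>?J - {j}. recip p k i * recip p k j)"
  have "2 * ?s = ?s + ?t"
    unfolding mult_2 by (rule arg_cong2[where f = "(+)", OF refl J.sum_pairs_swap])
  also have "\<dots> = (\<Sum>j\<in>?J. \<Sum>k\<in>?J - {j}. recip p j i * recip p j k + recip p k i * recip p k j)"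
    by (simp only: sum.distrib)
  also have "\<dots> = (\<Sum>j\<in>?J. \<Sum>k\<in>?J - {j}. - (recip p i j * recip p i k))"
    using i by (intro sum.cong refl recip_three) auto
  also have "\<dots> = - lagr_d2 I p i" by (simp add: lagr_d2_def sum_negf)
  finally show ?thesis unfolding 1 by (simp add: distrib_left)
qed

text \<open>Uses \<open>p j / (p j - p i) = 1 + p i / (p j - p i)\<close> and the vanishing of the
  total sum of \<open>lagr_d1\<close>.\<close>

lemma sum_slope_lagr_d1_recip:
  assumes i: "i \<in> I"
  shows "(\<Sum>j\<in>I - {i}. p j * lagr_d1 I p j * recip p j i) =
    p i * (\<Sum>j\<in>I - {i}. lagr_d1 I p j * recip p j i) - lagr_d1 I p i"
proof -
  have "(\<Sum>j\<in>I - {i}. p j * lagr_d1 I p j * recip p j i) =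
      (\<Sum>j\<in>I - {i}. p i * (lagr_d1 I p j * recip p j i) + lagr_d1 I p j)"
  proof (intro sum.cong refl)
    fix j assume j: "j \<in> I - {i}"
    have "p j * lagr_d1 I p j * recip p j i = lagr_d1 I p j * (p j * recip p j i)" by (simp add: mult_ac)
    also have "p j * recip p j i = 1 + p i * recip p j i" using i j by (intro recip_eq) auto
    finally show "p j * lagr_d1 I p j * recip p j i = p i * (lagr_d1 I p j * recip p j i) + lagr_d1 I p j"
      by (simp add: algebra_simps)
  qed
  also have "\<dots> = p i * (\<Sum>j\<in>I - {i}. lagr_d1 I p j * recip p j i) + (\<Sum>j\<in>I - {i}. lagr_d1 I p j)"
    by (simp add: sum.distrib sum_distrib_left)
  also have "(\<Sum>j\<in>I - {i}. lagr_d1 I p j) = - lagr_d1 I p i"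
    using sum_lagr_d1 sum.remove[OF fin i, of "lagr_d1 I p"] by (simp add: eq_neg_iff_add_eq_0 add.commute)
  finally show ?thesis by simp
qed

end

section \<open>Webs\<close>

text \<open>The second derivative \<open>y''\<close> along the leaf.\<close>

definition slope_accel :: "(nat \<Rightarrow> germ) \<Rightarrow> nat \<Rightarrow> germ" where
  "slope_accel p i = dleaf (p i) (p i)"

text \<open>
  Twice a 1-form whose differential turns out to be the trace of the curvature of the web with slopes
  \<open>p i\<close>. As a sum over ordered triples of distinct leaves it is additive over the extracted 3-webs.
\<close>

definition web_form_x :: "nat set \<Rightarrow> (nat \<Rightarrow> germ) \<Rightarrow> germ" where
  "web_form_x I p = (\<Sum>i\<in>I. \<Sum>j\<in>I - {i}. \<Sum>k\<in>I - {i} - {j}.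
     ddy (p i) + slope_accel p i * (p i * (recip p i j * recip p i k) - recip p i j - recip p i k))"

definition web_form_y :: "nat set \<Rightarrow> (nat \<Rightarrow> germ) \<Rightarrow> germ" where
  "web_form_y I p = (\<Sum>i\<in>I. \<Sum>j\<in>I - {i}. \<Sum>k\<in>I - {i} - {j}.
     - (slope_accel p i * (recip p i j * recip p i k)))"

text \<open>An ordered triple of distinct indices lies in exactly one subset of size 3.\<close>

lemma sum_triples_extracted:
  fixes h :: "nat \<Rightarrow> nat \<Rightarrow> nat \<Rightarrow> germ"
  assumes "finite I"
  shows "(\<Sum>S | S \<subseteq> I \<and> card S = 3. \<Sum>i\<in>S. \<Sum>j\<in>S - {i}. \<Sum>k\<in>S - {i} - {j}. h i j k) =
    (\<Sum>i\<in>I. \<Sum>j\<in>I - {i}. \<Sum>k\<in>I - {i} - {j}. h i j k)"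
proof -
  let ?T = "\<lambda>S. SIGMA i:S. SIGMA j:S - {i}. S - {i} - {j}"
  let ?A = "{S. S \<subseteq> I \<and> card S = 3}"
  have T: "(\<Sum>i\<in>S. \<Sum>j\<in>S - {i}. \<Sum>k\<in>S - {i} - {j}. h i j k) = (\<Sum>(i, j, k)\<in>?T S. h i j k)"
    if "finite S" for S
    using that by (simp add: sum.Sigma)
  have fin: "finite S" if "S \<in> ?A" for S using that assms finite_subset by blast
  have "(\<Sum>S\<in>?A. \<Sum>i\<in>S. \<Sum>j\<in>S - {i}. \<Sum>k\<in>S - {i} - {j}. h i j k) = (\<Sum>S\<in>?A. \<Sum>(i, j, k)\<in>?T S. h i j k)"
    by (intro sum.cong refl T fin)
  also have "\<dots> = (\<Sum>(i, j, k)\<in>(\<Union>S\<in>?A. ?T S). h i j k)"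
  proof (rule sum.UNION_disjoint[symmetric])
    show "finite ?A" using assms by simp
    show "\<forall>S\<in>?A. finite (?T S)" using fin by auto
    have uniq: "S = {i, j, k}" if "S \<in> ?A" "(i, j, k) \<in> ?T S" for S i j k
    proof -
      have "{i, j, k} \<subseteq> S" "card {i, j, k} = card S" using that by auto
      then show ?thesis using card_subset_eq[OF fin[OF that(1)]] by metis
    qed
    show "\<forall>S\<in>?A. \<forall>S'\<in>?A. S \<noteq> S' \<longrightarrow> ?T S \<inter> ?T S' = {}"
    proof (intro ballI impI equals0I)
      fix S S' x assume S: "S \<in> ?A" "S' \<in> ?A" "S \<noteq> S'" and x: "x \<in> ?T S \<inter> ?T S'"
      obtain i j k where "x = (i, j, k)" using prod_cases3 by blast
      then have "S = {i, j, k}" "S' = {i, j, k}" using x uniq[OF S(1)] uniq[OF S(2)] by blast+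
      then show False using S(3) by simp
    qed
  qed
  also have "(\<Union>S\<in>?A. ?T S) = ?T I"
  proof
    show "?T I \<subseteq> (\<Union>S\<in>?A. ?T S)"
    proof
      fix x assume "x \<in> ?T I"
      then obtain i j k where x: "x = (i, j, k)" "i \<in> I" "j \<in> I - {i}" "k \<in> I - {i} - {j}" by auto
      then have "x \<in> ?T {i, j, k}" "{i, j, k} \<in> ?A" by auto
      then show "x \<in> (\<Union>S\<in>?A. ?T S)" by blast
    qed
  qed auto
  also have "(\<Sum>(i, j, k)\<in>?T I. h i j k) = (\<Sum>i\<in>I. \<Sum>j\<in>I - {i}. \<Sum>k\<in>I - {i} - {j}. h i j k)"
    by (rule T[OF assms, symmetric])
  finally show ?thesis .
qed

lemma web_form_additive:
  assumes "finite I"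
  shows "(\<Sum>S | S \<subseteq> I \<and> card S = 3. web_form_x S p) = web_form_x I p"
    and "(\<Sum>S | S \<subseteq> I \<and> card S = 3. web_form_y S p) = web_form_y I p"
  unfolding web_form_x_def web_form_y_def by (rule sum_triples_extracted[OF assms])+

text \<open>The value at \<open>p i\<close> of \<open>Q_b\<close> for \<open>r = 1\<close> and monic
  \<open>F\<close>, as \<open>leaf_div_eq\<close> shows with \<open>a = 1\<close>.\<close>

definition leaf_div :: "nat set \<Rightarrow> (nat \<Rightarrow> germ) \<Rightarrow> nat \<Rightarrow> germ" where
  "leaf_div I p i = (\<Sum>j\<in>I. ddy (p j)) - slope_accel p i * lagr_d1 I p i +
     (\<Sum>j\<in>I - {i}. slope_accel p j * recip p i j)"

context distinct_slopes
begin

lemma web_form_y_eq: "web_form_y I p = - (\<Sum>i\<in>I. slope_accel p i * lagr_d2 I p i)"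
  by (simp add: web_form_y_def lagr_d2_def sum_negf sum_distrib_left)

lemma web_form_x_eq:
  assumes "card I = Suc n" "1 \<le> n"
  shows "web_form_x I p = of_nat n * (of_nat n - 1) * (\<Sum>i\<in>I. ddy (p i)) +
    (\<Sum>i\<in>I. slope_accel p i * (p i * lagr_d2 I p i)) - 2 * (of_nat n - 1) * (\<Sum>i\<in>I. slope_accel p i * lagr_d1 I p i)"
proof -
  let ?c = "of_nat n - 1 :: germ"
  have n1: "of_nat (n - Suc 0) = ?c" using assms(2) by (simp add: of_nat_diff)
  have "(\<Sum>j\<in>I - {i}. \<Sum>k\<in>I - {i} - {j}.
      ddy (p i) + slope_accel p i * (p i * (recip p i j * recip p i k) - recip p i j - recip p i k)) =
      of_nat n * ?c * ddy (p i) + slope_accel p i * (p i * lagr_d2 I p i) - 2 * ?c * (slope_accel p i * lagr_d1 I p i)"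
    if i: "i \<in> I" for i
  proof -
    let ?J = "I - {i}" and ?g = "slope_accel p i"
    interpret J: distinct_slopes ?J p by standard (auto intro: unit)
    have cJ: "card ?J = n" using i assms by simp
    have c: "card (?J - {j}) = n - 1" if "j \<in> ?J" for j using that cJ by simp
    have a: "(\<Sum>j\<in>?J. \<Sum>k\<in>?J - {j}. x) = of_nat n * ?c * x" for x :: germ
      using c cJ by (simp add: n1)
    have b: "(\<Sum>j\<in>?J. \<Sum>k\<in>?J - {j}. recip p i j) = ?c * lagr_d1 I p i"
      using c by (simp add: n1 lagr_d1_def sum_distrib_left)
    have b': "(\<Sum>j\<in>?J. \<Sum>k\<in>?J - {j}. recip p i k) = ?c * lagr_d1 I p i"
      by (subst b[symmetric], rule J.sum_pairs_swap)
    have "(\<Sum>j\<in>?J. \<Sum>k\<in>?J - {j}. ddy (p i) + ?g * (p i * (recip p i j * recip p i k) - recip p i j - recip p i k)) =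
       (\<Sum>j\<in>?J. \<Sum>k\<in>?J - {j}. ddy (p i)) + ?g * (p i * (\<Sum>j\<in>?J. \<Sum>k\<in>?J - {j}. recip p i j * recip p i k)
         - (\<Sum>j\<in>?J. \<Sum>k\<in>?J - {j}. recip p i j) - (\<Sum>j\<in>?J. \<Sum>k\<in>?J - {j}. recip p i k))"
      by (simp only: sum.distrib sum_subtractf sum_distrib_left[symmetric])
    also have "\<dots> = of_nat n * ?c * ddy (p i) + ?g * (p i * lagr_d2 I p i) - 2 * ?c * (?g * lagr_d1 I p i)"
      unfolding a b b' lagr_d2_def[symmetric] by (simp add: algebra_simps)
    finally show ?thesis .
  qed
  then have "web_form_x I p = (\<Sum>i\<in>I. of_nat n * ?c * ddy (p i) + slope_accel p i * (p i * lagr_d2 I p i) -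
      2 * ?c * (slope_accel p i * lagr_d1 I p i))"
    unfolding web_form_x_def by (intro sum.cong refl) blast
  then show ?thesis
    by (simp only: sum.distrib sum_subtractf sum_distrib_left[symmetric])
qed

lemma dleaf_prod_recip:
  assumes "J \<subseteq> I - {i}" "i \<in> I"
  shows "dleaf c (\<Prod>j\<in>J. recip p i j) = - (\<Sum>j\<in>J. dleaf c (p i - p j) * recip p i j) * (\<Prod>j\<in>J. recip p i j)"
proof -
  have "finite J" using assms(1) finite_subset by fastforce
  then show ?thesis using assms(1)
  proof induction
    case (insert j J)
    have "dleaf c (recip p i j) = - (dleaf c (p i - p j) * recip p i j) * recip p i j"
      using insert.prems assms(2) by (intro dleaf_inverse recip) auto
    then show ?case using insert by (simp add: dleaf_mult algebra_simps)
  qed simp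
qed

text \<open>The derivatives along the leaves \<open>i\<close> and \<open>j\<close> differ by
  \<open>(p i - p j)\<close> times \<open>ddy\<close>; this brings the derivative of
  \<open>p j\<close> to its own leaf.\<close>

lemma dleaf_slope_diff:
  "dleaf (p i) (p i - p j) = slope_accel p i - slope_accel p j - (p i - p j) * ddy (p j)"
  by (simp add: dleaf_def slope_accel_def algebra_simps)

text \<open>
  With \<open>F'\<^sub>i = a \<Prod>(p\<^sub>i - p\<^sub>j)\<close> and \<open>\<phi> = 1 / F'\<^sub>i\<close>, this computes
  \<open>F'\<^sub>i (\<partial>\<^sub>x \<phi> + \<partial>\<^sub>y (p\<^sub>i \<phi>))\<close>.
\<close>

lemma leaf_div_eq:
  assumes i: "i \<in> I" and a: "a * \<alpha> = 1"
  shows "(a * (\<Prod>j\<in>I - {i}. p i - p j)) *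
      (ddx (lagr_weight I p i * \<alpha>) + ddy (p i * (lagr_weight I p i * \<alpha>))) =
    leaf_div I p i - \<alpha> * dleaf (p i) a"
proof -
  let ?J = "I - {i}" and ?w = "lagr_weight I p i" and ?D = "dleaf (p i)"
  let ?V = "\<Prod>j\<in>I - {i}. p i - p j" and ?s = "\<Sum>j\<in>I - {i}. ?D (p i - p j) * recip p i j"
  have wV: "?w * ?V = 1" unfolding lagr_weight_def by (rule weight_prod[OF order_refl i])
  have "ddx (?w * \<alpha>) + ddy (p i * (?w * \<alpha>)) = ?D (?w * \<alpha>) + ddy (p i) * (?w * \<alpha>)"
    by (simp add: dleaf_def ddy_mult algebra_simps)
  also have "?D (?w * \<alpha>) = - ?s * ?w * \<alpha> - ?w * (?D a * \<alpha> * \<alpha>)"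
    using dleaf_prod_recip[OF order_refl i, of "p i"] dleaf_inverse[OF a, of "p i"]
    by (simp add: dleaf_mult lagr_weight_def)
  finally have "ddx (?w * \<alpha>) + ddy (p i * (?w * \<alpha>)) =
      (?w * \<alpha>) * (ddy (p i) - ?s - \<alpha> * ?D a)"
    by (simp add: algebra_simps)
  then have "(a * ?V) * (ddx (?w * \<alpha>) + ddy (p i * (?w * \<alpha>))) =
      (?w * ?V) * (a * \<alpha>) * (ddy (p i) - ?s - \<alpha> * ?D a)"
    by (simp only: mult_ac)
  then have 1: "(a * ?V) * (ddx (?w * \<alpha>) + ddy (p i * (?w * \<alpha>))) = ddy (p i) - ?s - \<alpha> * ?D a"
    by (simp only: wV a mult_1)
  have "?s = (\<Sum>j\<in>?J. slope_accel p i * recip p i j - slope_accel p j * recip p i j - ddy (p j))"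
  proof (intro sum.cong refl)
    fix j assume "j \<in> ?J"
    then have R: "(p i - p j) * recip p i j = 1" using i recip by auto
    have "?D (p i - p j) * recip p i j = slope_accel p i * recip p i j - slope_accel p j * recip p i j -
        ((p i - p j) * recip p i j) * ddy (p j)"
      unfolding dleaf_slope_diff by (simp add: algebra_simps)
    then show "?D (p i - p j) * recip p i j = slope_accel p i * recip p i j - slope_accel p j * recip p i j - ddy (p j)"
      by (simp only: R mult_1)
  qed
  also have "\<dots> = slope_accel p i * lagr_d1 I p i - (\<Sum>j\<in>?J. slope_accel p j * recip p i j) - (\<Sum>j\<in>?J. ddy (p j))"
    by (simp only: sum_subtractf sum_distrib_left[symmetric] lagr_d1_def)
  finally have 2: "?s = slope_accel p i * lagr_d1 I p i - (\<Sum>j\<in>?J. slope_accel p j * recip p i j) - (\<Sum>j\<in>?J. ddy (p j))" .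
  have 3: "(\<Sum>j\<in>I. ddy (p j)) = ddy (p i) + (\<Sum>j\<in>?J. ddy (p j))"
    by (rule sum.remove[OF fin i])
  show ?thesis unfolding 1 2 leaf_div_def 3 by (simp add: algebra_simps)
qed

text \<open>For three leaves \<open>Q_b\<close> has degree at most 1 in \<open>p\<close>, and its
  coefficients are half the web forms. That one affine function of the slope serves all three leaves
  is what makes a common form \<open>\<gamma>\<close> possible for the Blaschke curvature.\<close>

lemma leaf_div_three:
  assumes "card I = 3" "i \<in> I"
  shows "2 * leaf_div I p i = web_form_x I p + p i * web_form_y I p"
proof -
  have "card (I - {i}) = 2" using assms by simp
  then obtain j k where jk: "I - {i} = {j, k}" "j \<noteq> k" by (meson card_2_iff)
  then have I: "I = {i, j, k}" "i \<noteq> j" "i \<noteq> k" using assms(2) by auto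
  have Is: "i \<in> I" "j \<in> I" "k \<in> I" using I by auto
  let ?a = "recip p i j" and ?b = "recip p i k" and ?c = "recip p j k"
  have sw: "recip p j i = - ?a" "recip p k i = - ?b" "recip p k j = - ?c"
    by (rule recip_swap; use I jk in auto)+
  have r: "(p i - p j) * ?a = 1" "(p i - p k) * ?b = 1" "(p j - p k) * ?c = 1"
    by (rule recip; use I jk in auto)+
  have d: "I - {j} = {i, k}" "I - {k} = {i, j}" "{j, k} - {j} = {k}" "{j, k} - {k} = {j}"
    "{i, k} - {i} = {k}" "{i, k} - {k} = {i}" "{i, j} - {i} = {j}" "{i, j} - {j} = {i}"
    using I jk by auto
  have s: "(\<Sum>x\<in>I. f x) = f i + f j + f k" for f :: "nat \<Rightarrow> germ"
    using I jk by (simp add: add_ac)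
  have s2: "(\<Sum>x\<in>{j, k}. f x) = f j + f k" "(\<Sum>x\<in>{i, k}. f x) = f i + f k"
    "(\<Sum>x\<in>{i, j}. f x) = f i + f j" "(\<Sum>x\<in>{z}. f x) = f z" for f :: "nat \<Rightarrow> germ" and z
    using I jk by simp_all
  have x: "web_form_x I p = 2 * (ddy (p i) + ddy (p j) + ddy (p k)) +
      2 * slope_accel p i * (p i * (?a * ?b) - ?a - ?b) + 2 * slope_accel p j * (p j * (- ?a * ?c) + ?a - ?c) +
      2 * slope_accel p k * (p k * (?b * ?c) + ?b + ?c)"
    unfolding web_form_x_def by (simp only: s jk(1) s2 d sw) (simp add: algebra_simps)
  have y: "web_form_y I p = - 2 * slope_accel p i * (?a * ?b) + 2 * slope_accel p j * (?a * ?c) -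
      2 * slope_accel p k * (?b * ?c)"
    unfolding web_form_y_def by (simp only: s jk(1) s2 d sw) (simp add: algebra_simps)
  have h: "leaf_div I p i = ddy (p i) + ddy (p j) + ddy (p k) - slope_accel p i * (?a + ?b) +
      slope_accel p j * ?a + slope_accel p k * ?b"
    unfolding leaf_div_def lagr_d1_def s jk(1) using jk by (simp add: algebra_simps)
  have "web_form_x I p + p i * web_form_y I p =
      2 * (ddy (p i) + ddy (p j) + ddy (p k)) - 2 * slope_accel p i * (?a + ?b) +
      2 * slope_accel p j * (((p i - p j) * ?a) * ?c + ?a - ?c) +
      2 * slope_accel p k * (?b + ?c - ((p i - p k) * ?b) * ?c)"
    unfolding x y by (simp add: algebra_simps)
  then show ?thesis unfolding r h by (simp add: algebra_simps)
qed

subsection \<open>The trace in terms of the slopes\<close>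

text \<open>The contribution of leaf \<open>i\<close> to the \<open>dx\<close>-part of the trace,
  with \<open>n = d - 1\<close> and weights \<open>d - 2 - k\<close>. A factor \<open>k\<close> on
  the coefficient of \<open>p ^ k\<close> is the operator \<open>p d/dp\<close>, so the sum
  evaluates the Lagrange polynomial and its derivatives at \<open>p i\<close>. Summing up to
  \<open>n\<close> uses the whole polynomial; the excess is removed in
  \<open>trace_slopes_x\<close>.\<close>

lemma lagr_sum_x:
  assumes i: "i \<in> I" and n: "card I = Suc n"
  shows "(\<Sum>k\<le>n. (of_nat n - 1 - of_nat k) *
      ((p i ^ k * H + of_nat k * p i ^ (k - 1) * g) * coeff (lagr_poly I p i) k)) =
    (of_nat n - 1) * (H + lagr_d1 I p i * g) -
    (p i * lagr_d1 I p i * H + (p i * lagr_d2 I p i + lagr_d1 I p i) * g)"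
proof -
  let ?c = "coeff (lagr_poly I p i)" and ?x = "p i"
  have deg: "degree (lagr_poly I p i) \<le> n" using degree_lagr_poly[OF i] n by simp
  note S = poly_as_coeff_sums[OF deg, of ?x]
  have s0: "(\<Sum>k\<le>n. ?c k * ?x ^ k) = 1" using S(1) lagr_poly_eval[OF i i] by simp
  have s1: "(\<Sum>k\<le>n. ?c k * (of_nat k * ?x ^ (k - 1))) = lagr_d1 I p i"
    using S(2) poly_pderiv_lagr_poly[OF i] by simp
  have s2: "(\<Sum>k\<le>n. ?c k * (of_nat k * (of_nat (k - 1) * ?x ^ (k - 2)))) = lagr_d2 I p i"
    using S(3) poly_pderiv2_lagr_poly[OF i] by simp
  have "(of_nat n - 1 - of_nat k) * ((?x ^ k * H + of_nat k * ?x ^ (k - 1) * g) * ?c k) =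
     (of_nat n - 1) * H * (?c k * ?x ^ k) + (of_nat n - 1) * g * (?c k * (of_nat k * ?x ^ (k - 1)))
     - ?x * H * (?c k * (of_nat k * ?x ^ (k - 1)))
     - ?x * g * (?c k * (of_nat k * (of_nat (k - 1) * ?x ^ (k - 2)))) - g * (?c k * (of_nat k * ?x ^ (k - 1)))" for k
  proof (cases k)
    case (Suc m)
    then show ?thesis by (cases m) (simp_all add: algebra_simps)
  qed (simp add: algebra_simps)
  then have "(\<Sum>k\<le>n. (of_nat n - 1 - of_nat k) * ((?x ^ k * H + of_nat k * ?x ^ (k - 1) * g) * ?c k)) =
     (of_nat n - 1) * H * 1 + (of_nat n - 1) * g * lagr_d1 I p i - ?x * H * lagr_d1 I p i
     - ?x * g * lagr_d2 I p i - g * lagr_d1 I p i"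
    by (simp only: sum.distrib sum_subtractf sum_distrib_left[symmetric] s0 s1 s2)
  then show ?thesis by (simp add: algebra_simps)
qed

lemma lagr_sum_y:
  assumes i: "i \<in> I" and n: "card I = Suc n"
  shows "(\<Sum>k<n. of_nat (Suc k) *
      ((p i ^ k * H + of_nat k * p i ^ (k - 1) * g) * coeff (lagr_poly I p i) (Suc k))) =
    lagr_d1 I p i * H + lagr_d2 I p i * g"
proof -
  let ?c = "coeff (lagr_poly I p i)" and ?x = "p i"
  have deg: "degree (lagr_poly I p i) \<le> n" using degree_lagr_poly[OF i] n by simp
  note S = poly_as_coeff_sums[OF deg, of ?x]
  have s1: "(\<Sum>k<n. ?c (Suc k) * (of_nat (Suc k) * ?x ^ k)) = lagr_d1 I p i"
    using S(2) poly_pderiv_lagr_poly[OF i]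
    by (simp add: lessThan_Suc_atMost[symmetric] sum.lessThan_Suc_shift del: sum.lessThan_Suc of_nat_Suc)
  have s2: "(\<Sum>k<n. ?c (Suc k) * (of_nat (Suc k) * (of_nat k * ?x ^ (k - 1)))) = lagr_d2 I p i"
    using S(3) poly_pderiv2_lagr_poly[OF i]
    by (simp add: lessThan_Suc_atMost[symmetric] sum.lessThan_Suc_shift numeral_2_eq_2 del: sum.lessThan_Suc of_nat_Suc)
  have "of_nat (Suc k) * ((?x ^ k * H + of_nat k * ?x ^ (k - 1) * g) * ?c (Suc k)) =
     H * (?c (Suc k) * (of_nat (Suc k) * ?x ^ k)) + g * (?c (Suc k) * (of_nat (Suc k) * (of_nat k * ?x ^ (k - 1))))" for k
    by (simp add: algebra_simps del: of_nat_Suc)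
  then have "(\<Sum>k<n. of_nat (Suc k) * ((?x ^ k * H + of_nat k * ?x ^ (k - 1) * g) * ?c (Suc k))) =
     H * lagr_d1 I p i + g * lagr_d2 I p i"
    by (simp only: sum.distrib sum_distrib_left[symmetric] s1 s2)
  then show ?thesis by (simp add: mult.commute)
qed

end

lemma dleaf_power: "dleaf c (x ^ k) = of_nat k * x ^ (k - 1) * dleaf c x"
proof (induction k)
  case (Suc k)
  then show ?case by (cases k) (simp_all add: dleaf_mult algebra_simps)
qed simp

context distinct_slopes
begin

lemma sum_leaf_div:
  "(\<Sum>i\<in>I. leaf_div I p i) = of_nat (card I) * (\<Sum>i\<in>I. ddy (p i)) - 2 * (\<Sum>i\<in>I. slope_accel p i * lagr_d1 I p i)"
proof -
  have "(\<Sum>i\<in>I. \<Sum>j\<in>I - {i}. slope_accel p j * recip p i j) =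
      (\<Sum>i\<in>I. \<Sum>j\<in>I - {i}. slope_accel p i * recip p j i)" by (rule sum_pairs_swap)
  also have "\<dots> = (\<Sum>i\<in>I. \<Sum>j\<in>I - {i}. slope_accel p i * (- recip p i j))"
    by (intro sum.cong refl arg_cong2[where f = "(*)"] recip_swap) auto
  also have "\<dots> = - (\<Sum>i\<in>I. slope_accel p i * lagr_d1 I p i)"
    by (simp add: lagr_d1_def sum_distrib_left sum_negf)
  finally show ?thesis
    by (simp add: leaf_div_def sum.distrib sum_subtractf)
qed

text \<open>Exchanging the leaves in the double sum collects the coefficient of each
  \<open>slope_accel p i\<close>; there the squares of \<open>recip\<close> cancel, and a multiple
  of \<open>lagr_d2\<close> remains.\<close>

lemma sum_lagr_d1_leaf_div:
  "2 * (\<Sum>i\<in>I. lagr_d1 I p i * leaf_div I p i) = - 3 * (\<Sum>i\<in>I. slope_accel p i * lagr_d2 I p i)"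
proof -
  let ?S = "lagr_d1 I p" and ?T = "lagr_d2 I p" and ?g = "slope_accel p"
  let ?V = "\<lambda>i. \<Sum>j\<in>I - {i}. ?S j * recip p j i"
  have "(\<Sum>i\<in>I. ?S i * (\<Sum>j\<in>I - {i}. ?g j * recip p i j)) = (\<Sum>i\<in>I. \<Sum>j\<in>I - {i}. ?S i * (?g j * recip p i j))"
    by (simp add: sum_distrib_left)
  also have "\<dots> = (\<Sum>i\<in>I. \<Sum>j\<in>I - {i}. ?S j * (?g i * recip p j i))" by (rule sum_pairs_swap)
  also have "\<dots> = (\<Sum>i\<in>I. ?g i * ?V i)" by (simp add: sum_distrib_left mult_ac)
  finally have W: "(\<Sum>i\<in>I. ?S i * (\<Sum>j\<in>I - {i}. ?g j * recip p i j)) = (\<Sum>i\<in>I. ?g i * ?V i)" .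
  have "(\<Sum>i\<in>I. ?S i * leaf_div I p i) =
      (\<Sum>i\<in>I. ?S i) * (\<Sum>j\<in>I. ddy (p j)) - (\<Sum>i\<in>I. ?g i * (?S i * ?S i)) +
      (\<Sum>i\<in>I. ?S i * (\<Sum>j\<in>I - {i}. ?g j * recip p i j))"
    unfolding sum_distrib_right sum_subtractf[symmetric] sum.distrib[symmetric]
    by (intro sum.cong refl) (simp add: leaf_div_def algebra_simps)
  then have "2 * (\<Sum>i\<in>I. ?S i * leaf_div I p i) = (\<Sum>i\<in>I. ?g i * (2 * ?V i - 2 * (?S i * ?S i)))"
    unfolding W sum_lagr_d1 by (simp add: sum_subtractf[symmetric] sum_distrib_left algebra_simps)
  also have "\<dots> = (\<Sum>i\<in>I. ?g i * (- 3 * ?T i))"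
  proof (intro sum.cong refl arg_cong2[where f = "(*)"])
    fix i assume i: "i \<in> I"
    show "2 * ?V i - 2 * (?S i * ?S i) = - 3 * ?T i"
      unfolding sum_lagr_d1_recip[OF i] lagr_d1_squared[OF i] by (simp add: algebra_simps)
  qed
  finally show ?thesis by (simp add: sum_distrib_left mult_ac)
qed

lemma sum_slope_lagr_d1_leaf_div:
  "2 * (\<Sum>i\<in>I. p i * lagr_d1 I p i * leaf_div I p i) =
    of_nat (card I * (card I - 1)) * (\<Sum>i\<in>I. ddy (p i)) - 3 * (\<Sum>i\<in>I. slope_accel p i * (p i * lagr_d2 I p i)) -
    2 * (\<Sum>i\<in>I. slope_accel p i * lagr_d1 I p i)"
proof -
  let ?S = "lagr_d1 I p" and ?T = "lagr_d2 I p" and ?g = "slope_accel p"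
  let ?V = "\<lambda>i. \<Sum>j\<in>I - {i}. ?S j * recip p j i"
  have "(\<Sum>i\<in>I. p i * ?S i * (\<Sum>j\<in>I - {i}. ?g j * recip p i j)) =
      (\<Sum>i\<in>I. \<Sum>j\<in>I - {i}. p i * ?S i * (?g j * recip p i j))"
    by (simp add: sum_distrib_left)
  also have "\<dots> = (\<Sum>i\<in>I. \<Sum>j\<in>I - {i}. p j * ?S j * (?g i * recip p j i))" by (rule sum_pairs_swap)
  also have "\<dots> = (\<Sum>i\<in>I. ?g i * (\<Sum>j\<in>I - {i}. p j * ?S j * recip p j i))"
    by (simp add: sum_distrib_left mult_ac)
  also have "\<dots> = (\<Sum>i\<in>I. ?g i * (p i * ?V i - ?S i))"
    by (intro sum.cong refl arg_cong2[where f = "(*)"] sum_slope_lagr_d1_recip)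
  finally have W: "(\<Sum>i\<in>I. p i * ?S i * (\<Sum>j\<in>I - {i}. ?g j * recip p i j)) =
      (\<Sum>i\<in>I. ?g i * (p i * ?V i - ?S i))" .
  have double: "x = y * z - u + v \<Longrightarrow> 2 * x = 2 * y * z + 2 * (v - u)" for x y z u v :: germ
    by (erule ssubst) (simp add: algebra_simps)
  have "(\<Sum>i\<in>I. p i * ?S i * leaf_div I p i) =
      (\<Sum>i\<in>I. p i * ?S i) * (\<Sum>j\<in>I. ddy (p j)) - (\<Sum>i\<in>I. ?g i * (p i * (?S i * ?S i))) +
      (\<Sum>i\<in>I. p i * ?S i * (\<Sum>j\<in>I - {i}. ?g j * recip p i j))"
    unfolding sum_distrib_right sum_subtractf[symmetric] sum.distrib[symmetric]
    by (intro sum.cong refl) (simp add: leaf_div_def algebra_simps)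
  then have "2 * (\<Sum>i\<in>I. p i * ?S i * leaf_div I p i) =
      (2 * (\<Sum>i\<in>I. p i * ?S i)) * (\<Sum>j\<in>I. ddy (p j)) +
      2 * ((\<Sum>i\<in>I. ?g i * (p i * ?V i - ?S i)) - (\<Sum>i\<in>I. ?g i * (p i * (?S i * ?S i))))"
    unfolding W by (rule double)
  also have "2 * ((\<Sum>i\<in>I. ?g i * (p i * ?V i - ?S i)) - (\<Sum>i\<in>I. ?g i * (p i * (?S i * ?S i)))) =
      (\<Sum>i\<in>I. ?g i * (p i * (2 * ?V i - 2 * (?S i * ?S i)) - 2 * ?S i))"
  proof -
    have "2 * (g * (x * v - s) - g * (x * (s * s))) = g * (x * (2 * v - 2 * (s * s)) - 2 * s)" for g x v s :: germ
      by (simp add: algebra_simps)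
    then show ?thesis by (simp only: sum_subtractf[symmetric]) (subst sum_distrib_left, intro sum.cong refl, blast)
  qed
  also have "\<dots> = (\<Sum>i\<in>I. - 3 * (?g i * (p i * ?T i)) - 2 * (?g i * ?S i))"
  proof (intro sum.cong refl)
    fix i assume i: "i \<in> I"
    have VS: "2 * ?V i - 2 * (?S i * ?S i) = - 3 * ?T i"
      unfolding sum_lagr_d1_recip[OF i] lagr_d1_squared[OF i] by (simp add: algebra_simps)
    show "?g i * (p i * (2 * ?V i - 2 * (?S i * ?S i)) - 2 * ?S i) = - 3 * (?g i * (p i * ?T i)) - 2 * (?g i * ?S i)"
      unfolding VS by (simp add: algebra_simps)
  qed
  finally show ?thesis
    unfolding sum_slope_lagr_d1 by (simp only: sum_subtractf sum_distrib_left[symmetric]) (simp add: algebra_simps)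
qed

text \<open>
  The value at \<open>p\<^sub>i\<close> of \<open>Q\<^sub>b\<close> for \<open>r(p) = p\<^sup>k\<close>, where \<open>a\<close> is the
  leading coefficient of the presentation and \<open>\<alpha> = 1 / a\<close>.
\<close>

definition Q_value :: "germ \<Rightarrow> germ \<Rightarrow> nat \<Rightarrow> nat \<Rightarrow> germ" where
  "Q_value a \<alpha> k i = p i ^ k * (leaf_div I p i - \<alpha> * dleaf (p i) a) +
     of_nat k * p i ^ (k - 1) * slope_accel p i"

section \<open>The values of Q_b at the slopes\<close>

lemma Q_value_eq:
  assumes i: "i \<in> I" and a: "a * \<alpha> = 1"
  shows "Q_value a \<alpha> k i = (a * (\<Prod>j\<in>I - {i}. p i - p j)) *
    (ddx (p i ^ k * (lagr_weight I p i * \<alpha>)) + ddy (p i ^ Suc k * (lagr_weight I p i * \<alpha>)))"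
proof -
  let ?V = "\<Prod>j\<in>I - {i}. p i - p j" and ?\<phi> = "lagr_weight I p i * \<alpha>"
  have wV: "lagr_weight I p i * ?V = 1" unfolding lagr_weight_def by (rule weight_prod[OF order_refl i])
  have "(a * ?V) * ?\<phi> = (lagr_weight I p i * ?V) * (a * \<alpha>)" by (simp only: mult_ac)
  then have F\<phi>: "(a * ?V) * ?\<phi> = 1" by (simp only: wV a mult_1)
  have "ddx (p i ^ k * ?\<phi>) + ddy (p i ^ Suc k * ?\<phi>) =
      p i ^ k * (ddx ?\<phi> + ddy (p i * ?\<phi>)) + ?\<phi> * dleaf (p i) (p i ^ k)"
  proof -
    have "p i ^ Suc k * ?\<phi> = p i ^ k * (p i * ?\<phi>)" by (simp add: mult_ac)
    then show ?thesis
      by (simp only: ddx_mult[of "p i ^ k"] ddy_mult[of "p i ^ k"] dleaf_def) (simp add: algebra_simps)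
  qed
  then have "(a * ?V) * (ddx (p i ^ k * ?\<phi>) + ddy (p i ^ Suc k * ?\<phi>)) =
      p i ^ k * ((a * ?V) * (ddx ?\<phi> + ddy (p i * ?\<phi>))) + ((a * ?V) * ?\<phi>) * dleaf (p i) (p i ^ k)"
    by (simp only: distrib_left mult_ac)
  then show ?thesis
    unfolding leaf_div_eq[OF i a] F\<phi> by (simp add: Q_value_def dleaf_power slope_accel_def)
qed

text \<open>The Lagrange weight cancels the product of slope differences in \<open>F'_i\<close>. The
  leading coefficient of the interpolation is then a divergence of sums known from Euler's
  identities.\<close>

lemma sum_Q_value_weight:
  assumes a: "a * \<alpha> = 1"
  shows "(\<Sum>i\<in>I. Q_value a \<alpha> k i * lagr_weight I p i) =
    a * (ddx (\<alpha> * (\<Sum>i\<in>I. p i ^ k * lagr_weight I p i)) + ddy (\<alpha> * (\<Sum>i\<in>I. p i ^ Suc k * lagr_weight I p i)))"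
proof -
  have "(\<Sum>i\<in>I. Q_value a \<alpha> k i * lagr_weight I p i) =
      (\<Sum>i\<in>I. a * (ddx (\<alpha> * (p i ^ k * lagr_weight I p i)) + ddy (\<alpha> * (p i ^ Suc k * lagr_weight I p i))))"
  proof (intro sum.cong refl)
    fix i assume i: "i \<in> I"
    let ?V = "\<Prod>j\<in>I - {i}. p i - p j" and ?w = "lagr_weight I p i"
    have wV: "?w * ?V = 1" unfolding lagr_weight_def by (rule weight_prod[OF order_refl i])
    have c: "p i ^ k * (?w * \<alpha>) = \<alpha> * (p i ^ k * ?w)" for k by (simp only: mult_ac)
    have "(a * ?V * x) * ?w = (?w * ?V) * (a * x)" for x by (simp only: mult_ac)
    then show "Q_value a \<alpha> k i * ?w = a * (ddx (\<alpha> * (p i ^ k * ?w)) + ddy (\<alpha> * (p i ^ Suc k * ?w)))"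
      unfolding Q_value_eq[OF i a] wV c by (simp only: mult_1)
  qed
  also have "\<dots> = a * (ddx (\<Sum>i\<in>I. \<alpha> * (p i ^ k * lagr_weight I p i)) + ddy (\<Sum>i\<in>I. \<alpha> * (p i ^ Suc k * lagr_weight I p i)))"
    by (simp only: ddx_sum ddy_sum sum.distrib sum_distrib_left distrib_left)
  finally show ?thesis by (simp only: sum_distrib_left)
qed

text \<open>Both exponents \<open>k\<close> and \<open>k + 1\<close> stay below
  \<open>d - 1\<close>, so both Euler sums vanish. This is why \<open>Q_b\<close> has degree at most
  \<open>d - 2\<close> and not \<open>d - 1\<close>.\<close>

lemma sum_Q_value_weight_small:
  assumes "a * \<alpha> = 1" "k + 2 < card I"
  shows "(\<Sum>i\<in>I. Q_value a \<alpha> k i * lagr_weight I p i) = 0"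
proof -
  have "k < card I" "k \<noteq> card I - 1" "Suc k < card I" "Suc k \<noteq> card I - 1"
    using assms(2) by auto
  then show ?thesis
    unfolding sum_Q_value_weight[OF assms(1)] by (simp only: sum_weight_power if_False mult_zero_right ddx_0 ddy_0 add_0)
qed

lemma log_derivative_inverse:
  assumes "a * \<alpha> = 1"
  shows "a * ddx \<alpha> = - (\<alpha> * ddx a)" and "a * ddy \<alpha> = - (\<alpha> * ddy a)"
  using arg_cong[OF assms, of ddx] arg_cong[OF assms, of ddy]
  by (simp_all add: ddx_mult ddy_mult eq_neg_iff_add_eq_0 algebra_simps)

text \<open>With \<open>m = d - 3\<close> and \<open>k = d - l\<close>, the factor
  \<open>Suc k\<close> is the multiplicity \<open>d + 1 - l\<close> from
  \<open>trace_lift_y\<close>; in \<open>trace_slopes_x\<close>, \<open>Suc m - k\<close> is the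
  multiplicity \<open>l - 2\<close>.\<close>

lemma trace_slopes_y:
  assumes a: "a * \<alpha> = 1" and m: "card I = m + 3"
  shows "2 * (\<Sum>k\<le>m. of_nat (Suc k) * (\<Sum>i\<in>I. Q_value a \<alpha> k i * coeff (lagr_poly I p i) (Suc k))) =
    web_form_y I p - of_nat ((m + 2) * (m + 1)) * (\<alpha> * ddy a)"
proof -
  let ?n = "Suc (Suc m)"
  have n: "card I = Suc ?n" using m by simp
  let ?X = "\<lambda>k. \<Sum>i\<in>I. Q_value a \<alpha> k i * coeff (lagr_poly I p i) (Suc k)"
  let ?H = "\<lambda>i. leaf_div I p i - \<alpha> * dleaf (p i) a"
  have "(\<Sum>k<?n. of_nat (Suc k) * ?X k) = (\<Sum>i\<in>I. \<Sum>k<?n. of_nat (Suc k) *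
      ((p i ^ k * ?H i + of_nat k * p i ^ (k - 1) * slope_accel p i) * coeff (lagr_poly I p i) (Suc k)))"
    unfolding sum_distrib_left Q_value_def by (rule sum.swap)
  also have "\<dots> = (\<Sum>i\<in>I. lagr_d1 I p i * ?H i + lagr_d2 I p i * slope_accel p i)"
    by (intro sum.cong refl lagr_sum_y n)
  also have "\<dots> = (\<Sum>i\<in>I. lagr_d1 I p i * leaf_div I p i - lagr_d1 I p i * (\<alpha> * ddx a) -
      (p i * lagr_d1 I p i) * (\<alpha> * ddy a) + slope_accel p i * lagr_d2 I p i)"
    by (intro sum.cong refl) (simp add: dleaf_def algebra_simps)
  also have "\<dots> = (\<Sum>i\<in>I. lagr_d1 I p i * leaf_div I p i) - (\<Sum>i\<in>I. lagr_d1 I p i) * (\<alpha> * ddx a) -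
      (\<Sum>i\<in>I. p i * lagr_d1 I p i) * (\<alpha> * ddy a) + (\<Sum>i\<in>I. slope_accel p i * lagr_d2 I p i)"
    by (simp only: sum.distrib sum_subtractf sum_distrib_right)
  finally have all: "(\<Sum>k<?n. of_nat (Suc k) * ?X k) =
      (\<Sum>i\<in>I. lagr_d1 I p i * leaf_div I p i) - (\<Sum>i\<in>I. p i * lagr_d1 I p i) * (\<alpha> * ddy a) +
      (\<Sum>i\<in>I. slope_accel p i * lagr_d2 I p i)"
    by (simp only: sum_lagr_d1 mult_zero_left diff_zero)
  \<comment> \<open>The trace has no term \<open>k = d - 2\<close>. It was included to complete the
    derivative of the Lagrange polynomials; as it involves only their leading coefficients it is
    known explicitly and can be subtracted.\<close>
  have "?X (Suc m) = (\<Sum>i\<in>I. Q_value a \<alpha> (Suc m) i * lagr_weight I p i)"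
    using coeff_lagr_poly n by (intro sum.cong refl) simp
  also have "\<dots> = - (\<alpha> * ddy a)"
    unfolding sum_Q_value_weight[OF a]
    using sum_weight_power[of "Suc m"] sum_weight_power[of ?n] n log_derivative_inverse[OF a] by simp
  finally have top: "?X (Suc m) = - (\<alpha> * ddy a)" .
  have double: "2 * y = 2 * w - (2 * z) * l + 2 * t + 2 * u * l"
    if "w - z * l + t = y + u * - l" for y w z l t u :: germ
  proof -
    have y: "y = w - z * l + t + u * l" using that by simp
    show ?thesis unfolding y by (simp add: algebra_simps)
  qed
  have "(\<Sum>k<?n. of_nat (Suc k) * ?X k) = (\<Sum>k\<le>m. of_nat (Suc k) * ?X k) + of_nat ?n * ?X (Suc m)"
    by (simp only: lessThan_Suc_atMost sum.atMost_Suc)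
  then have "2 * (\<Sum>k\<le>m. of_nat (Suc k) * ?X k) =
      2 * (\<Sum>i\<in>I. lagr_d1 I p i * leaf_div I p i) - (2 * (\<Sum>i\<in>I. p i * lagr_d1 I p i)) * (\<alpha> * ddy a) +
      2 * (\<Sum>i\<in>I. slope_accel p i * lagr_d2 I p i) + 2 * of_nat ?n * (\<alpha> * ddy a)"
    unfolding top all by (rule double)
  also have "\<dots> = - (\<Sum>i\<in>I. slope_accel p i * lagr_d2 I p i) -
      of_nat ((m + 2) * (m + 1)) * (\<alpha> * ddy a)"
    unfolding sum_slope_lagr_d1 sum_lagr_d1_leaf_div n by (simp add: algebra_simps)
  finally show ?thesis by (simp only: web_form_y_eq)
qed

lemma trace_slopes_x:
  assumes a: "a * \<alpha> = 1" and m: "card I = m + 3"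
  shows "2 * (\<Sum>k\<le>m. of_nat (Suc m - k) * (\<Sum>i\<in>I. Q_value a \<alpha> k i * coeff (lagr_poly I p i) k)) =
    web_form_x I p - of_nat ((m + 2) * (m + 1)) * (\<alpha> * ddx a)"
proof -
  let ?n = "Suc (Suc m)"
  have n: "card I = Suc ?n" using m by simp
  let ?X = "\<lambda>k. \<Sum>i\<in>I. Q_value a \<alpha> k i * coeff (lagr_poly I p i) k"
  let ?H = "\<lambda>i. leaf_div I p i - \<alpha> * dleaf (p i) a"
  let ?N = "of_nat ?n - 1 :: germ" and ?g = "slope_accel p" and ?S = "lagr_d1 I p" and ?T = "lagr_d2 I p"
  have "(\<Sum>k\<le>?n. (?N - of_nat k) * ?X k) = (\<Sum>i\<in>I. \<Sum>k\<le>?n. (?N - of_nat k) *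
      ((p i ^ k * ?H i + of_nat k * p i ^ (k - 1) * ?g i) * coeff (lagr_poly I p i) k))"
    unfolding sum_distrib_left Q_value_def by (rule sum.swap)
  also have "\<dots> = (\<Sum>i\<in>I. ?N * (?H i + ?S i * ?g i) - (p i * ?S i * ?H i + (p i * ?T i + ?S i) * ?g i))"
    by (intro sum.cong refl lagr_sum_x n)
  also have "\<dots> = (\<Sum>i\<in>I. ?N * leaf_div I p i - ?N * (\<alpha> * ddx a) - p i * (?N * (\<alpha> * ddy a)) +
      (?N - 1) * (?g i * ?S i) - p i * ?S i * leaf_div I p i + (p i * ?S i) * (\<alpha> * ddx a) +
      (p i * p i * ?S i) * (\<alpha> * ddy a) - ?g i * (p i * ?T i))"
    by (intro sum.cong refl) (simp add: dleaf_def algebra_simps)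
  also have "\<dots> = ?N * (\<Sum>i\<in>I. leaf_div I p i) - (\<Sum>i\<in>I. ?N * (\<alpha> * ddx a)) - (\<Sum>i\<in>I. p i) * (?N * (\<alpha> * ddy a)) +
      (?N - 1) * (\<Sum>i\<in>I. ?g i * ?S i) - (\<Sum>i\<in>I. p i * ?S i * leaf_div I p i) +
      (\<Sum>i\<in>I. p i * ?S i) * (\<alpha> * ddx a) + (\<Sum>i\<in>I. p i * p i * ?S i) * (\<alpha> * ddy a) -
      (\<Sum>i\<in>I. ?g i * (p i * ?T i))"
    by (simp only: sum.distrib sum_subtractf sum_distrib_right[symmetric] sum_distrib_left[symmetric])
  finally have all: "(\<Sum>k\<le>?n. (?N - of_nat k) * ?X k) = \<dots>" .
  have "?X ?n = (\<Sum>i\<in>I. Q_value a \<alpha> ?n i * lagr_weight I p i)"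
    using coeff_lagr_poly n by (intro sum.cong refl) simp
  also have "\<dots> = a * (ddx \<alpha> + ddy (\<alpha> * (\<Sum>i\<in>I. p i)))"
    unfolding sum_Q_value_weight[OF a]
    using sum_weight_power[of ?n] sum_weight_power_card n by fastforce
  also have "\<dots> = a * ddx \<alpha> + (a * ddy \<alpha>) * (\<Sum>i\<in>I. p i) + (a * \<alpha>) * (\<Sum>i\<in>I. ddy (p i))"
    by (simp add: ddy_mult algebra_simps)
  finally have top: "?X ?n = - (\<alpha> * ddx a) - (\<alpha> * ddy a) * (\<Sum>i\<in>I. p i) + (\<Sum>i\<in>I. ddy (p i))"
    by (simp add: log_derivative_inverse[OF a] a)
  \<comment> \<open>The weight is 0 at \<open>k = d - 2\<close> and -1 at \<open>k = d - 1\<close>,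
    so a single extra term is to be removed.\<close>
  have "(\<Sum>k\<le>?n. (?N - of_nat k) * ?X k) = (\<Sum>k\<le>m. (?N - of_nat k) * ?X k) - ?X ?n"
    by (simp add: algebra_simps)
  moreover have "(\<Sum>k\<le>m. (?N - of_nat k) * ?X k) = (\<Sum>k\<le>m. of_nat (Suc m - k) * ?X k)"
    by (intro sum.cong refl) (simp add: of_nat_diff Suc_diff_le)
  ultimately have low: "(\<Sum>k\<le>m. of_nat (Suc m - k) * ?X k) = (\<Sum>k\<le>?n. (?N - of_nat k) * ?X k) + ?X ?n"
    by simp
  \<comment> \<open>Letters replace the symmetric sums to leave a pure ring identity.
    \<open>N\<close>, \<open>n\<close>, \<open>d\<close> stand for \<open>d - 2\<close>,
    \<open>d - 1\<close>, \<open>d\<close>, while \<open>lx\<close> and \<open>ly\<close> are the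
    logarithmic derivatives of \<open>a\<close>, and \<open>X\<close> is the extra term.\<close>
  have "2 * (N * L - d * (N * lx) - \<sigma> * (N * ly) + (N - 1) * G - SL + Sp * lx + Spp * ly - T + X) =
      n * N * P + T - 2 * N * G - n * N * lx"
    if "L = d * P - 2 * G" "2 * Sp = d * n" "Spp = n * \<sigma>" "2 * SL = d * n * P - 3 * T - 2 * G"
      "X = - lx - ly * \<sigma> + P" "d = N + 2" "n = N + 1" for N L d lx ly \<sigma> G SL Sp Spp T X n P :: germ
  proof -
    have "2 * (N * L - d * (N * lx) - \<sigma> * (N * ly) + (N - 1) * G - SL + Sp * lx + Spp * ly - T + X) =
      2 * (N * L) - 2 * (d * (N * lx)) - 2 * (\<sigma> * (N * ly)) + 2 * ((N - 1) * G) - 2 * SL + (2 * Sp) * lx +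
      2 * (Spp * ly) - 2 * T + 2 * X" by (simp add: algebra_simps)
    then show ?thesis unfolding that by (simp add: algebra_simps)
  qed
  note combine = this
  have f1: "(\<Sum>i\<in>I. leaf_div I p i) = of_nat (Suc ?n) * (\<Sum>i\<in>I. ddy (p i)) - 2 * (\<Sum>i\<in>I. ?g i * ?S i)"
    unfolding n[symmetric] by (rule sum_leaf_div)
  have f2: "2 * (\<Sum>i\<in>I. p i * ?S i) = of_nat (Suc ?n) * of_nat ?n"
    using sum_slope_lagr_d1 unfolding n by (simp only: of_nat_mult diff_Suc_1)
  have f3: "(\<Sum>i\<in>I. p i * p i * ?S i) = of_nat ?n * (\<Sum>i\<in>I. p i)"
    using sum_slope2_lagr_d1 unfolding n by (simp only: diff_Suc_1)
  have f4: "2 * (\<Sum>i\<in>I. p i * ?S i * leaf_div I p i) = of_nat (Suc ?n) * of_nat ?n * (\<Sum>i\<in>I. ddy (p i)) -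
      3 * (\<Sum>i\<in>I. ?g i * (p i * ?T i)) - 2 * (\<Sum>i\<in>I. ?g i * ?S i)"
    using sum_slope_lagr_d1_leaf_div unfolding n by (simp only: of_nat_mult diff_Suc_1)
  have f6: "of_nat (Suc ?n) = ?N + 2" "of_nat ?n = ?N + 1" by simp_all
  have f8: "(\<Sum>i\<in>I. ?N * (\<alpha> * ddx a)) = of_nat (Suc ?n) * (?N * (\<alpha> * ddx a))"
    unfolding sum_constant n ..
  have "2 * (?N * (\<Sum>i\<in>I. leaf_div I p i) - (\<Sum>i\<in>I. ?N * (\<alpha> * ddx a)) - (\<Sum>i\<in>I. p i) * (?N * (\<alpha> * ddy a)) +
      (?N - 1) * (\<Sum>i\<in>I. ?g i * ?S i) - (\<Sum>i\<in>I. p i * ?S i * leaf_div I p i) +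
      (\<Sum>i\<in>I. p i * ?S i) * (\<alpha> * ddx a) + (\<Sum>i\<in>I. p i * p i * ?S i) * (\<alpha> * ddy a) -
      (\<Sum>i\<in>I. ?g i * (p i * ?T i)) + ?X ?n) =
      of_nat ?n * ?N * (\<Sum>i\<in>I. ddy (p i)) + (\<Sum>i\<in>I. ?g i * (p i * ?T i)) -
      2 * ?N * (\<Sum>i\<in>I. ?g i * ?S i) - of_nat ?n * ?N * (\<alpha> * ddx a)"
    unfolding f8 by (rule combine[OF f1 f2 f3 f4 top f6])
  then have "2 * (\<Sum>k\<le>m. of_nat (Suc m - k) * ?X k) =
      of_nat ?n * ?N * (\<Sum>i\<in>I. ddy (p i)) + (\<Sum>i\<in>I. ?g i * (p i * ?T i)) -
      2 * ?N * (\<Sum>i\<in>I. ?g i * ?S i) - of_nat ?n * ?N * (\<alpha> * ddx a)"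
    unfolding low all .
  also have "\<dots> = web_form_x I p - of_nat ?n * ?N * (\<alpha> * ddx a)"
    using web_form_x_eq[OF n] by simp
  also have "of_nat ?n * ?N = of_nat ((m + 2) * (m + 1))" by (simp add: algebra_simps)
  finally show ?thesis .
qed

text \<open>The unit vector of index \<open>l\<close> gives \<open>r = p ^ (d - l)\<close>. The
  interpolation of the resulting values has no term of degree \<open>d - 1\<close>, so it meets the
  degree bound in \<open>Q_spec\<close> and is \<open>Q_b\<close>.\<close>

lemma equation_zeroth_order:
  assumes F: "F = smult a (\<Prod>j\<in>I. [:- p j, 1:])" and a: "a * \<alpha> = 1" and l: "l \<in> {3..card I}"
  shows "equation F m 0 0 l = (\<Sum>i\<in>I. Q_value a \<alpha> (card I - l) i * coeff (lagr_poly I p i) m)"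
proof -
  let ?d = "card I" and ?k = "card I - l" and ?b = "\<lambda>k. if k = l then 1 else 0 :: germ"
  have a0: "a \<noteq> 0" using a by auto
  have deg: "degree F = ?d" using a0 by (simp add: F prod_linear)
  have roots: "poly F x = 0 \<longleftrightarrow> x \<in> p ` I" for x
    using a0 by (auto simp: F poly_prod)
  have r: "r_poly F ?b = monom 1 ?k"
  proof -
    have "r_poly F ?b = (\<Sum>j = 3..?d. if j = l then monom 1 ?k else 0)"
      unfolding r_poly_def deg by (intro sum.cong refl) auto
    then show ?thesis using l by simp
  qed
  have F': "poly (pderiv F) (p i) = a * (\<Prod>j\<in>I - {i}. p i - p j)" if i: "i \<in> I" for i
  proof -
    have "poly (pderiv F) (p i) = a * (\<Sum>x\<in>I. \<Prod>j\<in>I - {x}. p i - p j)"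
      by (simp add: F pderiv_smult pderiv_prod pderiv_pCons poly_sum poly_prod)
    also have "(\<Sum>x\<in>I. \<Prod>j\<in>I - {x}. p i - p j) = (\<Prod>j\<in>I - {i}. p i - p j) + (\<Sum>x\<in>I - {i}. \<Prod>j\<in>I - {x}. p i - p j)"
      by (rule sum.remove[OF fin i])
    also have "(\<Sum>x\<in>I - {i}. \<Prod>j\<in>I - {x}. p i - p j) = 0"
      using i by (intro sum.neutral ballI prod_zero) auto
    finally show ?thesis by simp
  qed
  have val: "poly (pderiv F) (p i) * (ddx (poly (r_poly F ?b) (p i) div poly (pderiv F) (p i)) +
      ddy (p i * poly (r_poly F ?b) (p i) div poly (pderiv F) (p i))) = Q_value a \<alpha> ?k i" if i: "i \<in> I" for i
  proof -
    let ?V = "\<Prod>j\<in>I - {i}. p i - p j" and ?w = "lagr_weight I p i"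
    have wV: "?w * ?V = 1" unfolding lagr_weight_def by (rule weight_prod[OF order_refl i])
    have "(a * ?V) * (x * (?w * \<alpha>)) = (?w * ?V) * (a * \<alpha>) * x" for x by (simp only: mult_ac)
    then have inv: "(a * ?V) * (x * (?w * \<alpha>)) = x" for x by (simp only: wV a mult_1)
    have u: "a * ?V dvd 1" using inv[of 1] by (metis dvdI)
    have quot: "x div (a * ?V) = x * (?w * \<alpha>)" for x by (rule unit_eq_divI[OF u inv])
    show ?thesis
      unfolding Q_value_eq[OF i a] F'[OF i] quot r by (simp add: poly_monom mult.assoc)
  qed
  have spec: "Q_spec F ?b q \<longleftrightarrow> degree q \<le> ?d - 2 \<and> (\<forall>i\<in>I. poly q (p i) = Q_value a \<alpha> ?k i)" for q
    unfolding Q_spec_def deg roots using val by auto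
  let ?q = "interp (Q_value a \<alpha> ?k)"
  have "coeff ?q (?d - 1) = 0"
    unfolding coeff_interp_top using l by (intro sum_Q_value_weight_small[OF a]) auto
  then have "degree ?q \<le> ?d - 2"
    using eq_zero_or_degree_less[OF degree_interp, of "Q_value a \<alpha> ?k"] by auto
  then have q: "Q_spec F ?b ?q" by (simp add: spec interp_eval)
  have "Q_poly F ?b = ?q"
    unfolding Q_poly_def
  proof (rule the_equality[of "Q_spec F ?b", OF q])
    fix q assume "Q_spec F ?b q"
    then show "q = ?q" using l by (intro interp_unique[symmetric]) (auto simp: spec)
  qed
  then show ?thesis by (simp add: equation_def coeff_interp)
qed

end

subsection \<open>Blaschke curvature\<close>

lemma d1_add: "d1 (v + w) = d1 v + d1 w"
  by (simp add: d1_def)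

text \<open>The web forms are doubled, whereas a Blaschke connection form must be exhibited
  itself.\<close>

lemma half_germ: "\<exists>\<eta>::germ. 2 * \<eta> = 1 \<and> ddx \<eta> = 0 \<and> ddy \<eta> = 0"
proof -
  have "at0 (1 + 1) = 2" by (simp only: at0_add at0_1) simp
  then have "(2::germ) dvd 1" using germ_unit_iff[of 2] by simp
  then obtain \<eta> :: germ where \<eta>: "1 = 2 * \<eta>" ..
  have "\<eta> + \<eta> = 1" using \<eta> by (simp only: mult_2)
  then have "ddx \<eta> + ddx \<eta> = 0" "ddy \<eta> + ddy \<eta> = 0"
    using ddx_add[of \<eta> \<eta>] ddy_add[of \<eta> \<eta>] by simp_all
  then have "2 * ddx \<eta> = 0" "2 * ddy \<eta> = 0" by (simp_all only: mult_2)
  then show ?thesis using \<eta> by (intro exI[of _ \<eta>]) simp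
qed

locale slopes_of_web = distinct_slopes +
  fixes f :: "nat \<Rightarrow> germ"
  assumes ddy_unit: "i \<in> I \<Longrightarrow> ddy (f i) dvd 1"
    and ddx_slope: "i \<in> I \<Longrightarrow> ddx (f i) = - (p i * ddy (f i))"
begin

text \<open>The \<open>dy\<close>-coefficients of three forms with sum zero satisfy two linear
  equations, whose solutions are the multiples of the Lagrange weights. For the weights themselves
  \<open>leaf_div_three\<close> gives the connection form; a common factor \<open>G\<close> adds the
  logarithmic differential of \<open>G\<close>, which is closed.\<close>

lemma blaschke_curvature_eq:
  assumes card: "card I = 3"
  shows "2 * blaschke_curvature I f = d1 (web_form_x I p, web_form_y I p)"
proof -
  obtain \<eta> :: germ where \<eta>: "2 * \<eta> = 1" "ddx \<eta> = 0" "ddy \<eta> = 0" using half_germ by blast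
  define gx where "gx = \<eta> * web_form_x I p"
  define gy where "gy = \<eta> * web_form_y I p"
  let ?w = "lagr_weight I p"
  have h: "leaf_div I p i = gx + p i * gy" if "i \<in> I" for i
  proof -
    have "leaf_div I p i = (2 * \<eta>) * leaf_div I p i" by (simp only: \<eta> mult_1)
    also have "\<dots> = \<eta> * (2 * leaf_div I p i)" by (simp only: mult_ac)
    finally show ?thesis unfolding leaf_div_three[OF card that] gx_def gy_def by (simp add: algebra_simps)
  qed
  have wV: "?w i * (\<Prod>j\<in>I - {i}. p i - p j) = 1" if "i \<in> I" for i
    unfolding lagr_weight_def by (rule weight_prod[OF order_refl that])
  have dw: "ddx (?w i) + ddy (p i * ?w i) = ?w i * (gx + p i * gy)" if i: "i \<in> I" for i
  proof -
    have "ddx (?w i) + ddy (p i * ?w i) =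
        (?w i * (\<Prod>j\<in>I - {i}. p i - p j)) * (ddx (?w i) + ddy (p i * ?w i))"
      by (simp only: wV[OF i] mult_1)
    also have "\<dots> = ?w i * ((1 * (\<Prod>j\<in>I - {i}. p i - p j)) * (ddx (?w i * 1) + ddy (p i * (?w i * 1))))"
      by (simp only: mult_1 mult_1_right mult.assoc)
    also have "\<dots> = ?w i * (leaf_div I p i)"
      by (subst leaf_div_eq[OF i mult_1]) (simp add: dleaf_def)
    finally show ?thesis using h[OF i] by simp
  qed
  let ?P = "\<lambda>\<rho> \<gamma>. (\<forall>i\<in>I. \<rho> i dvd 1) \<and> (\<Sum>i\<in>I. scale1 (\<rho> i) (d0 (f i))) = 0 \<and>
        (\<forall>i\<in>I. d1 (scale1 (\<rho> i) (d0 (f i))) = wedge \<gamma> (scale1 (\<rho> i) (d0 (f i))))"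
  have form: "scale1 r (d0 (f i)) = (- (p i * (r * ddy (f i))), r * ddy (f i))" if "i \<in> I" for r i
    using ddx_slope[OF that] by (simp add: scale1_def d0_def mult_ac)
  have sum_form: "(\<Sum>i\<in>I. scale1 (\<rho> i) (d0 (f i))) =
      (- (\<Sum>i\<in>I. p i * (\<rho> i * ddy (f i))), \<Sum>i\<in>I. \<rho> i * ddy (f i))" for \<rho>
  proof -
    have "(\<Sum>i\<in>I. scale1 (\<rho> i) (d0 (f i))) = (\<Sum>i\<in>I. (- (p i * (\<rho> i * ddy (f i))), \<rho> i * ddy (f i)))"
      by (intro sum.cong refl form)
    also have "\<dots> = (- (\<Sum>i\<in>I. p i * (\<rho> i * ddy (f i))), \<Sum>i\<in>I. \<rho> i * ddy (f i))"
      by (simp add: prod_eq_iff fst_sum snd_sum sum_negf)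
    finally show ?thesis .
  qed
  have ex: "\<exists>\<rho>. ?P \<rho> (gx, gy)"
  proof -
    \<comment> \<open>Normalises the forms to \<open>w i (dy - p i dx)\<close>. Their sum vanishes
      by Euler's identities with exponents 0 and 1.\<close>
    define \<rho> where "\<rho> i = ?w i div ddy (f i)" for i
    have \<rho>: "\<rho> i * ddy (f i) = ?w i" if "i \<in> I" for i
      using unit_div_cancel[OF ddy_unit[OF that]] by (simp add: \<rho>_def mult.commute)
    have "\<rho> i dvd 1" if "i \<in> I" for i
    proof -
      have "\<rho> i * (ddy (f i) * (\<Prod>j\<in>I - {i}. p i - p j)) = 1"
        using wV[OF that] \<rho>[OF that] by (simp add: mult.assoc[symmetric])
      then show ?thesis by (metis dvdI)
    qed
    moreover have "(\<Sum>i\<in>I. scale1 (\<rho> i) (d0 (f i))) = 0"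
    proof -
      have "(\<Sum>i\<in>I. \<rho> i * ddy (f i)) = (\<Sum>i\<in>I. p i ^ 0 * ?w i)"
        by (intro sum.cong refl) (simp add: \<rho>)
      also have "\<dots> = 0" using sum_weight_power[of 0] card by simp
      finally have 1: "(\<Sum>i\<in>I. \<rho> i * ddy (f i)) = 0" .
      have "(\<Sum>i\<in>I. p i * (\<rho> i * ddy (f i))) = (\<Sum>i\<in>I. p i ^ 1 * ?w i)"
        by (intro sum.cong refl) (simp add: \<rho>)
      also have "\<dots> = 0" using sum_weight_power[of 1] card by simp
      finally have 2: "(\<Sum>i\<in>I. p i * (\<rho> i * ddy (f i))) = 0" .
      show ?thesis unfolding sum_form 1 2 by (simp add: zero_prod_def)
    qed
    moreover have "d1 (scale1 (\<rho> i) (d0 (f i))) = wedge (gx, gy) (scale1 (\<rho> i) (d0 (f i)))" if "i \<in> I" for i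
      unfolding form[OF that] \<rho>[OF that] using dw[OF that] by (simp add: d1_def wedge_def algebra_simps)
    ultimately show ?thesis by (intro exI[of _ \<rho>]) blast
  qed
  have uniq: "d1 \<gamma> = d1 (gx, gy)" if P: "?P \<rho> \<gamma>" for \<rho> \<gamma>
  proof -
    define u where "u i = \<rho> i * ddy (f i)" for i
    obtain i j k where I: "I = {i, j, k}" "i \<noteq> j" "i \<noteq> k" "j \<noteq> k"
      using card by (metis card_3_iff)
    have s: "(\<Sum>x\<in>I. h x) = h i + h j + h k" for h :: "nat \<Rightarrow> germ"
      using I by (simp add: add_ac)
    have "(\<Sum>i\<in>I. u i) = 0" "(\<Sum>i\<in>I. p i * u i) = 0"
      using P unfolding sum_form u_def by (simp_all add: zero_prod_def)
    then have u0: "u i + u j + u k = 0" "p i * u i + p j * u j + p k * u k = 0"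
      unfolding s by simp_all
    have uk: "u k = - u i - u j" using u0(1) by (simp add: algebra_simps eq_neg_iff_add_eq_0)
    have e1: "u i * (p i - p k) = - (u j * (p j - p k))"
      using u0(2) unfolding uk by (simp add: algebra_simps eq_neg_iff_add_eq_0)
    have uj: "u j = - u i - u k" unfolding uk by simp
    have e2: "u i * (p i - p j) = - (u k * (p k - p j))"
      using u0(2) unfolding uj by (simp add: algebra_simps eq_neg_iff_add_eq_0)
    \<comment> \<open>The coefficient \<open>u i\<close> divided by its Lagrange weight; the two
      linear relations make the quotient the same for all three leaves.\<close>
    define G where "G = u i * ((p i - p j) * (p i - p k))"
    have V: "(\<Prod>l\<in>I - {i}. p i - p l) = (p i - p j) * (p i - p k)"
      "(\<Prod>l\<in>I - {j}. p j - p l) = (p j - p i) * (p j - p k)"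
      "(\<Prod>l\<in>I - {k}. p k - p l) = (p k - p i) * (p k - p j)"
    proof -
      have "I - {i} = {j, k}" "I - {j} = {i, k}" "I - {k} = {i, j}" using I by auto
      then show "(\<Prod>l\<in>I - {i}. p i - p l) = (p i - p j) * (p i - p k)"
        "(\<Prod>l\<in>I - {j}. p j - p l) = (p j - p i) * (p j - p k)"
        "(\<Prod>l\<in>I - {k}. p k - p l) = (p k - p i) * (p k - p j)"
        using I by simp_all
    qed
    have Gj: "G = u j * ((p j - p i) * (p j - p k))"
    proof -
      have "G = (u i * (p i - p k)) * (p i - p j)" by (simp add: G_def mult_ac)
      also have "\<dots> = u j * ((p j - p i) * (p j - p k))" unfolding e1 by (simp add: algebra_simps)
      finally show ?thesis .
    qed
    have Gk: "G = u k * ((p k - p i) * (p k - p j))"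
    proof -
      have "G = (u i * (p i - p j)) * (p i - p k)" by (simp add: G_def mult_ac)
      also have "\<dots> = u k * ((p k - p i) * (p k - p j))" unfolding e2 by (simp add: algebra_simps)
      finally show ?thesis .
    qed
    have GV: "G = u l * (\<Prod>j\<in>I - {l}. p l - p j)" if "l \<in> I" for l
      using that I Gj Gk G_def V by auto
    have u: "u l = G * ?w l" if "l \<in> I" for l
    proof -
      have "G * ?w l = u l * (?w l * (\<Prod>j\<in>I - {l}. p l - p j))" using GV[OF that] by (simp add: mult_ac)
      then show ?thesis unfolding wV[OF that] by simp
    qed
    have i: "i \<in> I" and j: "j \<in> I" using I by auto
    have "u i dvd 1"
    proof -
      have "\<rho> i dvd 1" using P i by blast
      then have "\<rho> i * ddy (f i) dvd 1 * 1" using ddy_unit[OF i] by (rule mult_dvd_mono)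
      then show ?thesis by (simp add: u_def)
    qed
    then obtain v where v: "1 = u i * v" ..
    define G' where "G' = ?w i * v"
    have GG': "G * G' = 1" using v u[OF i] by (simp add: G'_def mult_ac)
    define kx where "kx = fst \<gamma> - gx"
    define ky where "ky = snd \<gamma> - gy"
    have eq: "ddx G + p l * ddy G = G * (kx + p l * ky)" if l: "l \<in> I" for l
    proof -
      have "d1 (scale1 (\<rho> l) (d0 (f l))) = wedge \<gamma> (scale1 (\<rho> l) (d0 (f l)))" using P l by blast
      then have "ddx (G * ?w l) + ddy (p l * (G * ?w l)) = G * ?w l * (fst \<gamma> + p l * snd \<gamma>)"
        unfolding form[OF l] u_def[symmetric] u[OF l] by (simp add: d1_def wedge_def algebra_simps)
      moreover have "ddx (G * ?w l) + ddy (p l * (G * ?w l)) =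
          ?w l * (ddx G + p l * ddy G) + G * (ddx (?w l) + ddy (p l * ?w l))"
        by (simp add: ddx_mult ddy_mult algebra_simps)
      ultimately have "?w l * (ddx G + p l * ddy G) = ?w l * (G * (kx + p l * ky))"
        unfolding dw[OF l] kx_def ky_def by (simp add: algebra_simps)
      moreover have "?w l \<noteq> 0" using wV[OF l] by auto
      ultimately show ?thesis by simp
    qed
    \<comment> \<open>Comparing two leaves with different slopes separates the \<open>dx\<close>-
      and \<open>dy\<close>-parts of \<open>dG = G (\<gamma> - (gx, gy))\<close>.\<close>
    have "(p i - p j) * ddy G = (p i - p j) * (G * ky)"
    proof -
      have "(p i - p j) * ddy G = (ddx G + p i * ddy G) - (ddx G + p j * ddy G)"
        by (simp add: algebra_simps)
      also have "\<dots> = (p i - p j) * (G * ky)"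
        unfolding eq[OF i] eq[OF j] by (simp add: algebra_simps)
      finally show ?thesis .
    qed
    moreover have "p i - p j \<noteq> 0" using recip[OF i j] I by auto
    ultimately have y: "ddy G = G * ky" by simp
    have x: "ddx G = G * kx" using eq[OF i] unfolding y by (simp add: algebra_simps)
    have kx': "kx = G' * ddx G" and ky': "ky = G' * ddy G"
      unfolding x y using GG' by (simp_all add: mult.assoc[symmetric] mult.commute[of G' G])
    have "\<gamma> = (gx, gy) + (kx, ky)" by (simp add: kx_def ky_def)
    then have "d1 \<gamma> = d1 (gx, gy) + d1 (kx, ky)" by (simp only: d1_add)
    also have "d1 (kx, ky) = 0" unfolding kx' ky' by (rule d1_dlog[OF GG'])
    finally show ?thesis by simp
  qed
  have "blaschke_curvature I f = d1 (gx, gy)"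
    unfolding blaschke_curvature_def
  proof (rule the_equality)
    show "\<exists>\<rho> \<gamma>. (\<forall>i\<in>I. \<rho> i dvd 1) \<and> (\<Sum>i\<in>I. scale1 (\<rho> i) (d0 (f i))) = 0 \<and>
        (\<forall>i\<in>I. d1 (scale1 (\<rho> i) (d0 (f i))) = wedge \<gamma> (scale1 (\<rho> i) (d0 (f i)))) \<and> d1 (gx, gy) = d1 \<gamma>"
      using ex by blast
  qed (use uniq in blast)
  also have "2 * d1 (gx, gy) = (2 * \<eta>) * d1 (web_form_x I p, web_form_y I p)"
    by (simp add: gx_def gy_def d1_def ddx_mult ddy_mult \<eta>(2,3) algebra_simps)
  finally show ?thesis by (simp only: \<eta>(1) mult_1)
qed

lemma slopes_of_web_subset: "S \<subseteq> I \<Longrightarrow> slopes_of_web S p f"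
  by unfold_locales (meson ddy_unit ddx_slope unit finite_subset[OF _ fin] subsetD)+

end

section \<open>Comparison of the trace with the Blaschke curvatures\<close>

theorem curvature_trace_eq_sum_blaschke:
  fixes d :: nat and f :: "nat \<Rightarrow> germ" and F :: "germ poly"
  assumes d: "3 \<le> d" and web: "nonsingular_web {..<d} f" and pres: "presents_web F d f"
  shows "curvature_trace F = (\<Sum>S | S \<subseteq> {..<d} \<and> card S = 3. blaschke_curvature S f)"
proof -
  define p where "p i = slope (f i)" for i
  let ?I = "{..<d}"
  have deg: "degree F = d" and lead: "at0 (lead_coeff F) \<noteq> 0"
    and tr: "\<And>i. i < d \<Longrightarrow> at0 (ddy (f i)) \<noteq> 0"
    and roots: "{x. poly F x = 0} = p ` ?I"
    using pres by (auto simp: presents_web_def p_def)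
  have yu: "ddy (f i) dvd 1" if "i < d" for i using tr[OF that] by (simp add: germ_unit_iff)
  have xs: "ddx (f i) = - (p i * ddy (f i))" if "i < d" for i
    using unit_div_cancel[OF yu[OF that], of "ddx (f i)"] by (simp add: p_def slope_def mult.commute)
  have un: "p i - p j dvd 1" if "i < d" "j < d" "i \<noteq> j" for i j
  proof -
    have "at0 (wedge (d0 (f i)) (d0 (f j))) \<noteq> 0"
      using web that unfolding nonsingular_web_def by blast
    also have "wedge (d0 (f i)) (d0 (f j)) = ddy (f i) * ddy (f j) * (p j - p i)"
      using xs[OF that(1)] xs[OF that(2)] by (simp add: wedge_def d0_def algebra_simps)
    finally show ?thesis by (auto simp: germ_unit_iff)
  qed
  interpret slopes_of_web ?I p f
    by unfold_locales (use un yu xs in auto)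
  define a where "a = lead_coeff F"
  have "a dvd 1" using lead by (simp add: a_def germ_unit_iff)
  then obtain \<alpha> where \<alpha>: "a * \<alpha> = 1" by (metis dvdE)
  \<comment> \<open>The two sides share the degree, the leading coefficient and \<open>d\<close>
    distinct roots; a non-zero difference would have more roots than its degree.\<close>
  have F: "F = smult a (\<Prod>j\<in>?I. [:- p j, 1:])" (is "F = ?G")
  proof (rule ccontr)
    assume ne: "F \<noteq> ?G"
    then have nz: "F - ?G \<noteq> 0" by simp
    have "degree (F - ?G) \<le> d"
      by (rule degree_diff_le) (use deg degree_smult_le[of a "\<Prod>j\<in>?I. [:- p j, 1:]"] in \<open>simp_all add: prod_linear\<close>)
    moreover have "coeff (F - ?G) d = 0"
      using deg prod_linear(2)[of ?I p] by (simp add: a_def)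
    ultimately have "degree (F - ?G) < d"
      using eq_zero_or_degree_less[of "F - ?G" d] nz by auto
    moreover have "card (p ` ?I) \<le> card {x. poly (F - ?G) x = 0}"
    proof (rule card_mono)
      show "finite {x. poly (F - ?G) x = 0}" by (rule poly_roots_finite[OF nz])
      have "poly (F - ?G) (p i) = 0" if i: "i < d" for i
      proof -
        have "poly F (p i) = 0" using roots i by blast
        moreover have "(\<Prod>j\<in>?I. p i - p j) = 0" using i by (intro prod_zero) auto
        ultimately show ?thesis by (simp add: poly_prod)
      qed
      then show "p ` ?I \<subseteq> {x. poly (F - ?G) x = 0}" by auto
    qed
    ultimately show False using card_poly_roots_bound[OF nz] card_image[OF inj_slopes] by simp
  qed
  obtain m where m: "d = m + 3" using d by (metis add.commute le_Suc_ex)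
  have cI: "card ?I = m + 3" using m by simp
  let ?x = "\<Sum>l = 3..d. of_nat (l - 2) * equation F (d - l) 0 0 l"
  let ?y = "\<Sum>l = 3..d. of_nat (d + 1 - l) * equation F (d + 1 - l) 0 0 l"
  let ?c = "of_nat ((m + 2) * (m + 1)) :: germ"
  have eqn: "equation F n 0 0 l = (\<Sum>i\<in>?I. Q_value a \<alpha> (d - l) i * coeff (lagr_poly ?I p i) n)"
    if "l \<in> {3..d}" for l n
    using equation_zeroth_order[OF F \<alpha>, of l n] that by simp
  \<comment> \<open>Substitution \<open>k = d - l\<close>, the exponent in
    \<open>r = p ^ (d - l)\<close>.\<close>
  have "?x = (\<Sum>k\<le>m. of_nat (Suc m - k) * (\<Sum>i\<in>?I. Q_value a \<alpha> k i * coeff (lagr_poly ?I p i) k))"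
    by (rule sum.reindex_bij_witness[of _ "\<lambda>k. d - k" "\<lambda>l. d - l"]) (auto simp: eqn m Suc_diff_le)
  then have x: "2 * ?x = web_form_x ?I p - ?c * (\<alpha> * ddx a)"
    using trace_slopes_x[OF \<alpha> cI] by simp
  have "?y = (\<Sum>l = 3..d. of_nat (Suc (d - l)) *
      (\<Sum>i\<in>?I. Q_value a \<alpha> (d - l) i * coeff (lagr_poly ?I p i) (Suc (d - l))))"
  proof (intro sum.cong refl)
    fix l assume l: "l \<in> {3..d}"
    then have "d + 1 - l = Suc (d - l)" by auto
    then show "of_nat (d + 1 - l) * equation F (d + 1 - l) 0 0 l = of_nat (Suc (d - l)) *
      (\<Sum>i\<in>?I. Q_value a \<alpha> (d - l) i * coeff (lagr_poly ?I p i) (Suc (d - l)))"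
      by (simp only: eqn[OF l])
  qed
  also have "\<dots> = (\<Sum>k\<le>m. of_nat (Suc k) * (\<Sum>i\<in>?I. Q_value a \<alpha> k i * coeff (lagr_poly ?I p i) (Suc k)))"
    by (rule sum.reindex_bij_witness[of _ "\<lambda>k. d - k" "\<lambda>l. d - l"]) (auto simp: m)
  finally have y: "2 * ?y = web_form_y ?I p - ?c * (\<alpha> * ddy a)"
    using trace_slopes_y[OF \<alpha> cI] by simp
  have "2 * curvature_trace F = d1 (2 * ?x, 2 * ?y)"
  proof -
    have ct: "curvature_trace F = d1 (?x, ?y)"
      using curvature_trace_eq[of F] d by (simp only: deg)
    have "2 * d1 (u, v) = d1 (2 * u, 2 * v)" for u v
      by (simp only: d1_def mult_2 fst_conv snd_conv ddx_add ddy_add add_diff_add)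
    then show ?thesis unfolding ct .
  qed
  \<comment> \<open>The last term is a constant times the differential of \<open>da / a\<close> and
    drops out, which removes the dependence on the leading coefficient of \<open>F\<close>.\<close>
  also have "\<dots> = d1 (web_form_x ?I p, web_form_y ?I p) - ?c * d1 (\<alpha> * ddx a, \<alpha> * ddy a)"
  proof -
    have const: "ddx (of_nat k) = 0 \<and> ddy (of_nat k) = 0" for k
      by (induction k) simp_all
    have "d1 (u - of_nat k * l, v - of_nat k * l') = d1 (u, v) - of_nat k * d1 (l, l')" for u v l l' k
      by (simp add: d1_def ddx_mult ddy_mult const algebra_simps)
    then show ?thesis unfolding x y .
  qed
  also have "\<dots> = d1 (\<Sum>S | S \<subseteq> ?I \<and> card S = 3. web_form_x S p, \<Sum>S | S \<subseteq> ?I \<and> card S = 3. web_form_y S p)"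
    by (simp only: d1_dlog[OF \<alpha>] web_form_additive[OF fin] mult_zero_right diff_zero)
  also have "\<dots> = (\<Sum>S | S \<subseteq> ?I \<and> card S = 3. d1 (web_form_x S p, web_form_y S p))"
    by (simp add: d1_def sum_subtractf)
  also have "\<dots> = (\<Sum>S | S \<subseteq> ?I \<and> card S = 3. 2 * blaschke_curvature S f)"
    using slopes_of_web.blaschke_curvature_eq[OF slopes_of_web_subset] by (intro sum.cong refl) auto
  also have "\<dots> = 2 * (\<Sum>S | S \<subseteq> ?I \<and> card S = 3. blaschke_curvature S f)"
    by (simp add: sum_distrib_left)
  finally show ?thesis by simp
qed

theorem mainTheorem1:
  fixes d :: nat and f :: "nat \<Rightarrow> germ" and F :: "germ poly"
  assumes "d \<in> {4, 5, 6}"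
    and "nonsingular_web {..<d} f"
    and "presents_web F d f"
  shows "curvature_trace F = (\<Sum>S | S \<subseteq> {..<d} \<and> card S = 3. blaschke_curvature S f)"
  using assms by (intro curvature_trace_eq_sum_blaschke) auto

end
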